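(* Let $X=\mathbb T^d$ and $T(x_1,\dots,x_d)=(x_1+\alpha,\,x_2+f_1(x_1),\,\dots,\,x_d+f_{d-1}(x_1,\dots,x_{d-1}))$, where $\alpha$ is irrational and, for $k=1,\dots,d-1$, $f_k:\mathbb T^k\to\mathbb T$ is Lipschitz and for each fixed $(x_1,\dots,x_{k-1})$ the loop $t\mapsto f_k(x_1,\dots,x_{k-1},t)$ is homotopically non-trivial. If $\mu$ is a Borel probability measure on $X$ whose projection onto the first $d-1$ coordinates is absolutely continuous with respect to Haar measure on $\mathbb T^{d-1}$, then every weak$^*$ limit point of $(T^n_*\mu)$ is invariant under the rotations $(x_1,\dots,x_d)\mapsto(x_1,\dots,x_{d-1},x_d+t)$, $t\in\mathbb T$.
   Context: $\mathbb T=\mathbb R/\mathbb Z$. A loop $\mathbb T\to\mathbb T$ is homotopically non-trivial if it has nonzero degree. $T^n_*\mu$ denotes the push-forward of $\mu$ under $T^n$. *)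

theory Defs
  imports "HOL-Probability.Probability"
begin

text \<open>The circle T = R/Z is represented by representatives in [0,1);
  the torus T^k by functions nat => real whose first k coordinates
  (indices 0..k-1) lie in [0,1). Coordinate x_j of the paper is index j-1.\<close>

definition tdist :: "real \<Rightarrow> real \<Rightarrow> real" where
  "tdist a b = min (frac (a - b)) (1 - frac (a - b))"

definition tdistn :: "nat \<Rightarrow> (nat \<Rightarrow> real) \<Rightarrow> (nat \<Rightarrow> real) \<Rightarrow> real" where
  "tdistn k x y = (if k = 0 then 0 else Max ((\<lambda>i. tdist (x i) (y i)) ` {..<k}))"

definition torus_pts :: "nat \<Rightarrow> (nat \<Rightarrow> real) set" where
  "torus_pts k = {x. \<forall>i<k. x i \<in> {0..<1}}"

definition torus_space :: "nat \<Rightarrow> (nat \<Rightarrow> real) measure" where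
  "torus_space k = PiM {..<k} (\<lambda>_. restrict_space borel {0..<1::real})"

definition haar_torus :: "nat \<Rightarrow> (nat \<Rightarrow> real) measure" where
  "haar_torus k = PiM {..<k} (\<lambda>_. restrict_space lborel {0..<1::real})"

text \<open>g : T^k -> T (values read mod 1) depends only on the first k coordinates.\<close>
definition depends_on_first :: "nat \<Rightarrow> ((nat \<Rightarrow> real) \<Rightarrow> real) \<Rightarrow> bool" where
  "depends_on_first k g \<longleftrightarrow> (\<forall>x y. (\<forall>i<k. x i = y i) \<longrightarrow> g x = g y)"

definition lipschitz_torus :: "nat \<Rightarrow> ((nat \<Rightarrow> real) \<Rightarrow> real) \<Rightarrow> bool" where
  "lipschitz_torus k g \<longleftrightarrow>
     (\<exists>L. \<forall>x\<in>torus_pts k. \<forall>y\<in>torus_pts k. tdist (g x) (g y) \<le> L * tdistn k x y)"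

definition circle_lift :: "(real \<Rightarrow> real) \<Rightarrow> (real \<Rightarrow> real) \<Rightarrow> bool" where
  "circle_lift g F \<longleftrightarrow> continuous_on UNIV F \<and> (\<forall>t. frac (F t) = frac (g (frac t)))"

definition circle_degree :: "(real \<Rightarrow> real) \<Rightarrow> int" where
  "circle_degree g = (THE n::int. \<exists>F. circle_lift g F \<and> F 1 - F 0 = of_int n)"

definition skew_map :: "nat \<Rightarrow> real \<Rightarrow> (nat \<Rightarrow> (nat \<Rightarrow> real) \<Rightarrow> real)
    \<Rightarrow> (nat \<Rightarrow> real) \<Rightarrow> (nat \<Rightarrow> real)" where
  "skew_map d \<alpha> f x = (\<lambda>i\<in>{..<d}. frac (x i + (if i = 0 then \<alpha> else f i x)))"

definition vert_rot :: "nat \<Rightarrow> real \<Rightarrow> (nat \<Rightarrow> real) \<Rightarrow> (nat \<Rightarrow> real)" where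
  "vert_rot d t x = x(d - 1 := frac (x (d - 1) + t))"

definition torus_continuous :: "nat \<Rightarrow> ((nat \<Rightarrow> real) \<Rightarrow> real) \<Rightarrow> bool" where
  "torus_continuous d g \<longleftrightarrow>
     (\<forall>x\<in>space (torus_space d). \<forall>e>0. \<exists>\<delta>>0. \<forall>y\<in>space (torus_space d).
        tdistn d x y < \<delta> \<longrightarrow> \<bar>g y - g x\<bar> < e)"

definition weak_star_limit_point ::
    "nat \<Rightarrow> (nat \<Rightarrow> (nat \<Rightarrow> real) measure) \<Rightarrow> (nat \<Rightarrow> real) measure \<Rightarrow> bool" where
  "weak_star_limit_point d \<mu>s \<nu> \<longleftrightarrow>
     (\<exists>r. strict_mono r \<and> (\<forall>g. torus_continuous d g \<longrightarrow>
        (\<lambda>j. integral\<^sup>L (\<mu>s (r j)) g) \<longlonglongrightarrow> integral\<^sup>L \<nu> g))"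

end

theory Submission
  imports Defs "HOL-Analysis.Kronecker_Approximation_Theorem"
begin

text \<open>Write R_t for the rotation of the last coordinate by t and U_s for the rotation of the
  preceding coordinate by s. Shifting by U_s before applying T^n has the same effect as applying T^n
  first, then U_s, and then rotating the last coordinate by the ergodic sum, along the base orbit, of
  the increment of the last cocycle under U_s. The mean of this increment over its last variable is
  s D, where D is the degree. If the ergodic averages of the difference quotients converge to D in
  mean, then with s = t / (n D) the rotation is close to R_t, while the shift by s hardly changes an
  absolutely continuous measure; so the push-forwards under T^n become invariant under R_t.

  Convergence of the averages goes by induction on the dimension. For one coordinate it is the
  equidistribution of the irrational rotation. The conclusion in dimension k + 1, applied to measures
  with Lipschitz density, says that functions with zero mean in the last coordinate have decaying
  correlations, hence that their ergodic averages tend to 0 in mean.\<close>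

subsection \<open>Arithmetic on the circle\<close>

text \<open>The step t / (n D) shrinks as n grows, whereas an ergodic statement concerns one fixed
  function, and no derivative of the cocycle is at hand to pass to. Both are met by an estimate
  uniform over all subdivisions \<sigma> / N of one coarse step \<sigma>; N is then chosen from n so
  that \<sigma> / N is just below the step wanted.

  The measure is controlled only through its projection and may be singular in the last coordinate.
  Since T commutes with rotations of that coordinate, the coordinate can be frozen on short cells at
  a cost that does not grow with n; what remains lives on the base, where Lipschitz densities
  suffice by approximation in L1.

  Decay of correlations is read off from vertical invariance: with h as weight, composing h with a
  vertical rotation does not change the correlations in the limit, and the average of h over
  vertical rotations is 0. The degree has to be one constant D, independent of the point, because
  the same step s is used at all points; it is constant because it is an integer that varies
  continuously.\<close>

definition crep :: "real \<Rightarrow> real" where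
  "crep a = a - of_int (round a)"

lemma crep_le: "\<bar>crep a\<bar> \<le> \<bar>a - of_int m\<bar>"
  unfolding crep_def by (rule round_diff_minimal)

lemma crep_le_half: "\<bar>crep a\<bar> \<le> 1 / 2"
  using of_int_round_abs_le[of a] by (simp add: crep_def abs_minus_commute)

lemma crep_unique: "\<bar>a - of_int m\<bar> < 1 / 2 \<Longrightarrow> crep a = a - of_int m"
  unfolding crep_def using round_unique'[of a m] by simp

lemma crep_eqI:
  assumes "\<bar>b\<bar> < 1 / 2" "a - b \<in> \<int>"
  shows "crep a = b"
proof -
  obtain m where "a - b = of_int m" using assms(2) by (auto elim: Ints_cases)
  then show ?thesis using crep_unique[of a m] assms(1) by (simp add: algebra_simps)
qed

lemma diff_crep_Ints: "a - crep a \<in> \<int>"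
  by (simp add: crep_def)

lemma frac_eq_iff_diff_Ints: "frac a = frac b \<longleftrightarrow> a - b \<in> \<int>" for a b :: real
  by (metis frac_diff_eq frac_diff_zero frac_eq_0_iff)

lemma frac_add_crep: "frac (a + crep b) = frac (a + b)"
  unfolding frac_eq_iff_diff_Ints using Ints_minus[OF diff_crep_Ints[of b]] by simp

lemma diff_frac_Ints: "a - frac a \<in> \<int>" for a :: real
  by (simp add: frac_def)

text \<open>Joins two descriptions of the distance mod 1: \<open>crep a\<close> is a representative
  of a mod 1 of least absolute value, so facts on \<open>tdist\<close> reduce to adding real numbers
  congruent to the differences.\<close>

lemma tdist_eq_crep: "tdist a b = \<bar>crep (a - b)\<bar>"
proof -
  define c where "c = a - b"
  have "\<bar>crep c\<bar> \<le> \<bar>c - of_int \<lfloor>c\<rfloor>\<bar>" "\<bar>crep c\<bar> \<le> \<bar>c - of_int (\<lfloor>c\<rfloor> + 1)\<bar>"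
    by (rule crep_le)+
  moreover have "real_of_int (round c) = of_int \<lfloor>c\<rfloor> \<or> real_of_int (round c) = of_int \<lfloor>c\<rfloor> + 1"
    using round_altdef[of c] ceiling_altdef[of c] by (auto split: if_splits)
  ultimately have "min (c - of_int \<lfloor>c\<rfloor>) (1 - (c - of_int \<lfloor>c\<rfloor>)) = \<bar>crep c\<bar>"
    using floor_correct[of c] unfolding crep_def by (elim disjE) (auto simp: min_def)
  then show ?thesis
    unfolding tdist_def c_def[symmetric] frac_def .
qed

lemma tdist_le: "a - b - c \<in> \<int> \<Longrightarrow> tdist a b \<le> \<bar>c\<bar>"
proof (elim Ints_cases)
  fix m assume "a - b - c = of_int m"
  then have "a - b - of_int m = c" by simp
  with crep_le[of "a - b" m] show "tdist a b \<le> \<bar>c\<bar>" unfolding tdist_eq_crep by simp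
qed

lemma tdist_le_abs: "tdist a b \<le> \<bar>a - b\<bar>"
  by (rule tdist_le) simp

lemma tdist_nonneg [simp]: "0 \<le> tdist a b"
  by (simp add: tdist_eq_crep)

lemma tdist_le_half: "tdist a b \<le> 1 / 2"
  unfolding tdist_eq_crep by (rule crep_le_half)

lemma tdist_self [simp]: "tdist a a = 0"
  using tdist_le_abs[of a a] tdist_nonneg[of a a] by simp

lemma tdist_eq_0_iff: "tdist a b = 0 \<longleftrightarrow> a - b \<in> \<int>"
proof
  assume "tdist a b = 0"
  then show "a - b \<in> \<int>" using diff_crep_Ints[of "a - b"] by (simp add: tdist_eq_crep)
next
  assume "a - b \<in> \<int>"
  then show "tdist a b = 0" using tdist_le[of a b 0] tdist_nonneg[of a b] by simp
qed

text \<open>Stated for an arbitrary congruence mod 1, so that the usual triangle inequality, the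
  dependence of \<open>tdist\<close> on the difference mod 1 alone, and the four-point estimate for
  increments are all instances.\<close>

lemma tdist_triangle_gen:
  assumes "(a - b) - ((c - c') + (e - e')) \<in> \<int>"
  shows "tdist a b \<le> tdist c c' + tdist e e'"
proof -
  have "(a - b) - (crep (c - c') + crep (e - e')) \<in> \<int>"
    using Ints_add[OF Ints_add[OF assms diff_crep_Ints[of "c-c'"]] diff_crep_Ints[of "e-e'"]]
    by (simp add: algebra_simps)
  from tdist_le[OF this] show ?thesis unfolding tdist_eq_crep by linarith
qed

lemma tdist_triangle: "tdist a c \<le> tdist a b + tdist b c"
  by (rule tdist_triangle_gen) simp

lemma tdist_cong: "(a - b) - (c - e) \<in> \<int> \<Longrightarrow> tdist a b = tdist c e"
  using tdist_triangle_gen[of a b c e 0 0] tdist_triangle_gen[of c e a b 0 0]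
    Ints_minus[of "(a - b) - (c - e)"] by simp

lemma tdist_commute: "tdist a b = tdist b a"
proof -
  have "tdist x y \<le> tdist y x" for x y
    unfolding tdist_eq_crep[of y x]
    using tdist_le[of x y "- crep (y - x)"] Ints_minus[OF diff_crep_Ints[of "y - x"]]
    by (simp add: algebra_simps)
  then show ?thesis by (simp add: antisym)
qed

lemma tdist_frac_left [simp]: "tdist (frac a) b = tdist a b"
  by (rule tdist_cong) (use Ints_minus[OF diff_frac_Ints[of a]] in \<open>simp add: algebra_simps\<close>)

lemma tdist_frac_right [simp]: "tdist a (frac b) = tdist a b"
  using tdist_frac_left[of b a] by (simp add: tdist_commute)

lemma tdist_add_right [simp]: "tdist (a + c) (b + c) = tdist a b"
  by (simp add: tdist_def)

lemma abs_tdist_diff_le: "\<bar>tdist a c - tdist b c\<bar> \<le> tdist a b"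
  using tdist_triangle[of a c b] tdist_triangle[of b c a] tdist_commute[of a b] by linarith

text \<open>The half-open arc from 0 to b is the open arc around its midpoint together with 0.\<close>
lemma frac_less_iff_tdist:
  assumes "0 < b" "b \<le> 1"
  shows "frac a < b \<longleftrightarrow> tdist a (b / 2) < b / 2 \<or> tdist a 0 = 0"
proof -
  define x where "x = frac a"
  have x: "0 \<le> x" "x < 1" by (auto simp: x_def frac_lt_1)
  have f: "frac (x - b/2) = (if x \<ge> b/2 then x - b/2 else x - b/2 + 1)"
    by (subst frac_unique_iff) (use x assms in auto)
  have "tdist x (b/2) < b/2 \<or> x = 0 \<longleftrightarrow> x < b"
    using x assms by (auto simp: tdist_def f min_def split: if_splits)
  moreover have "tdist a 0 = 0 \<longleftrightarrow> x = 0"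
    by (simp add: x_def tdist_eq_0_iff)
  moreover have "tdist a (b/2) = tdist x (b/2)" by (simp add: x_def)
  ultimately show ?thesis unfolding x_def[symmetric] by metis
qed

text \<open>Serves the two step-function approximations below. The last clause is an equivalence so
  that a sum of indicators over all cells collapses to the single term \<open>l\<close>.\<close>

lemma unit_interval_cell:
  fixes t :: real
  assumes t: "0 \<le> t" "t < 1" and M: "1 \<le> M"
  obtains l where "l < M" "real l / real M \<le> t" "t \<le> real l / real M + 1 / real M"
    "\<And>l'. real l' / real M \<le> t \<and> t < real (Suc l') / real M \<longleftrightarrow> l' = l"
proof
  define l where "l = nat \<lfloor>t * M\<rfloor>"
  have "real l = of_int \<lfloor>t * M\<rfloor>" using t by (simp add: l_def)
  then have l: "real l \<le> t * M" "t * M < real l + 1" by linarith+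
  have "t * M < 1 * real M" using t M by (intro mult_strict_right_mono) auto
  then show "l < M" using l by simp
  have "t \<le> (real l + 1) / real M" using l M by (simp add: field_simps)
  then show "t \<le> real l / real M + 1 / real M" by (simp add: add_divide_distrib)
  show "real l / real M \<le> t" using l M by (simp add: field_simps)
  fix l'
  have "real l' / real M \<le> t \<and> t < real (Suc l') / real M \<longleftrightarrow> real l' \<le> t * M \<and> t * M < real l' + 1"
    using M by (auto simp: field_simps)
  also have "\<dots> \<longleftrightarrow> l' = l" using l by linarith
  finally show "real l' / real M \<le> t \<and> t < real (Suc l') / real M \<longleftrightarrow> l' = l" .
qed

subsection \<open>The torus\<close>

abbreviation torus :: "nat \<Rightarrow> (nat \<Rightarrow> real) set" where
  "torus k \<equiv> space (torus_space k)"

lemma in_torus_space_iff: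
  "x \<in> torus k \<longleftrightarrow> x \<in> extensional {..<k} \<and> (\<forall>i<k. 0 \<le> x i \<and> x i < 1)"
  by (auto simp: torus_space_def space_PiM space_restrict_space PiE_iff Ball_def)

lemma torus_space_subset_pts: "x \<in> torus k \<Longrightarrow> x \<in> torus_pts k"
  by (auto simp: in_torus_space_iff torus_pts_def)

lemma tdistn_le_iff: "0 \<le> c \<Longrightarrow> tdistn k x y \<le> c \<longleftrightarrow> (\<forall>i<k. tdist (x i) (y i) \<le> c)"
  by (cases "k = 0") (auto simp: tdistn_def Max_le_iff lessThan_empty_iff)

lemma tdistn_nonneg [simp]: "0 \<le> tdistn k x y"
proof (cases "k = 0")
  case False
  then have "tdist (x 0) (y 0) \<le> Max ((\<lambda>i. tdist (x i) (y i)) ` {..<k})" by (intro Max_ge) auto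
  with tdist_nonneg[of "x 0" "y 0"] have "0 \<le> Max ((\<lambda>i. tdist (x i) (y i)) ` {..<k})"
    by (rule order_trans)
  then show ?thesis unfolding tdistn_def using False by simp
qed (simp add: tdistn_def)

lemma tdist_le_tdistn: "i < k \<Longrightarrow> tdist (x i) (y i) \<le> tdistn k x y"
  using iffD1[OF tdistn_le_iff[OF tdistn_nonneg] order_refl] by blast

lemma tdistn_le_1: "tdistn k x y \<le> 1"
  unfolding tdistn_le_iff[OF zero_le_one] using order_trans[OF tdist_le_half] by auto

lemma sets_haar_torus [measurable_cong]: "sets (haar_torus k) = sets (torus_space k)"
  unfolding haar_torus_def torus_space_def
  by (intro sets_PiM_cong) (auto simp: sets_restrict_space)

lemma space_haar_torus [simp]: "space (haar_torus k) = torus k"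
  by (rule sets_eq_imp_space_eq[OF sets_haar_torus])

lemma prob_space_unit: "prob_space (restrict_space lborel {0..<1::real})"
  by (rule prob_spaceI) (simp add: space_restrict_space emeasure_restrict_space)

lemma prob_space_haar_torus: "prob_space (haar_torus k)"
  unfolding haar_torus_def by (rule prob_space_PiM) (rule prob_space_unit)

lemma measurable_torus_component:
  "i < k \<Longrightarrow> (\<lambda>x. x i) \<in> borel_measurable (torus_space k)"
  unfolding torus_space_def
  by (rule measurable_compose[OF measurable_component_singleton[of i]])
     (auto intro: measurable_restrict_space1)

lemma measurable_torus_spaceI:
  assumes "\<And>i. i < k \<Longrightarrow> (\<lambda>x. g x i) \<in> borel_measurable M"
    and "\<And>x. x \<in> space M \<Longrightarrow> g x \<in> torus k"
  shows "g \<in> measurable M (torus_space k)"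
  unfolding torus_space_def
proof (rule measurable_PiM_single')
  fix i assume "i \<in> {..<k}"
  then show "(\<lambda>x. g x i) \<in> measurable M (restrict_space borel {0..<1})"
    using assms by (intro measurable_restrict_space2) (auto simp: in_torus_space_iff)
qed (use assms(2) in \<open>auto simp: torus_space_def space_PiM\<close>)

text \<open>Boxes with a corner at the origin suffice because coordinates are nonnegative. They are
  a generating system stable under intersection, on which measures are compared and inductions over
  sets run. A bound \<open>b i\<close> above 1 imposes nothing.\<close>

definition torus_boxes :: "nat \<Rightarrow> (nat \<Rightarrow> real) set set" where
  "torus_boxes k = range (\<lambda>b. {x\<in>torus k. \<forall>i<k. x i < b i})"

lemma torus_boxes_subset: "torus_boxes k \<subseteq> Pow (torus k)"
  by (auto simp: torus_boxes_def)

lemma Int_stable_torus_boxes: "Int_stable (torus_boxes k)"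
proof (rule Int_stableI)
  fix A B assume "A \<in> torus_boxes k" "B \<in> torus_boxes k"
  then obtain a b where "A = {x\<in>torus k. \<forall>i<k. x i < a i}"
    "B = {x\<in>torus k. \<forall>i<k. x i < b i}" by (auto simp: torus_boxes_def)
  then have "A \<inter> B = {x\<in>torus k. \<forall>i<k. x i < min (a i) (b i)}" by auto
  then show "A \<inter> B \<in> torus_boxes k"
    unfolding torus_boxes_def by (intro image_eqI[where x="\<lambda>i. min (a i) (b i)"]) auto
qed

lemma space_in_torus_boxes: "torus k \<in> torus_boxes k"
proof -
  have "torus k = {x\<in>torus k. \<forall>i<k. x i < 1}"
    by (auto simp: in_torus_space_iff)
  then show ?thesis unfolding torus_boxes_def by (rule image_eqI[where x="\<lambda>_. 1"]) simp
qed

lemma sets_torus_space: "sets (torus_space k) = sigma_sets (torus k) (torus_boxes k)"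
proof
  define N where "N = sigma (torus k) (torus_boxes k)"
  have sp: "space N = torus k"
    unfolding N_def by (rule space_measure_of[OF torus_boxes_subset])
  have st: "sets N = sigma_sets (torus k) (torus_boxes k)"
    unfolding N_def by (rule sets_measure_of[OF torus_boxes_subset])
  \<comment> \<open>The identity is measurable into the product once its coordinates are, and a
    sublevel set of one coordinate is a box whose other bounds are 1.\<close>
  have "(\<lambda>x. x) \<in> measurable N (torus_space k)"
  proof (rule measurable_torus_spaceI)
    fix i assume i: "i < k"
    show "(\<lambda>x. x i) \<in> borel_measurable N"
      unfolding borel_measurable_iff_less
    proof
      fix a
      have "{w \<in> space N. w i < a} = {x\<in>torus k. \<forall>j<k. x j < (if j = i then a else 1)}"
        using i by (auto simp: sp in_torus_space_iff)
      then have "{w \<in> space N. w i < a} \<in> torus_boxes k"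
        unfolding torus_boxes_def by (intro image_eqI[where x="\<lambda>j. if j = i then a else 1"]) auto
      then show "{w \<in> space N. w i < a} \<in> sets N" unfolding st by auto
    qed
  qed (simp add: sp)
  then have "sets (torus_space k) \<subseteq> sets N"
    by (auto dest!: measurable_sets simp: sp)
  then show "sets (torus_space k) \<subseteq> sigma_sets (torus k) (torus_boxes k)"
    by (simp add: st)
next
  have "torus_boxes k \<subseteq> sets (torus_space k)"
    unfolding torus_boxes_def
  proof (rule image_subsetI, rule sets.sets_Collect_countable_All)
    fix b :: "nat \<Rightarrow> real" and i
    show "{x \<in> torus k. i < k \<longrightarrow> x i < b i} \<in> sets (torus_space k)"
    proof (cases "i < k")
      case True
      note measurable_torus_component[OF this, measurable]
      show ?thesis using True by simp
    qed simp
  qed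
  then show "sigma_sets (torus k) (torus_boxes k) \<subseteq> sets (torus_space k)"
    by (rule sets.sigma_sets_subset)
qed

lemma torus_boxes_sets: "A \<in> torus_boxes k \<Longrightarrow> A \<in> sets (torus_space k)"
  by (auto simp: sets_torus_space)

section \<open>Continuous and Lipschitz functions on the torus, and their measurability\<close>

definition torus_grid :: "nat \<Rightarrow> nat \<Rightarrow> (nat \<Rightarrow> real) \<Rightarrow> nat \<Rightarrow> real" where
  "torus_grid k n x = (\<lambda>i\<in>{..<k}. real_of_int \<lfloor>x i * Suc n\<rfloor> / Suc n)"

lemma torus_grid_in:
  assumes "x \<in> torus k"
  shows "torus_grid k n x \<in> torus k"
  unfolding in_torus_space_iff
proof (intro conjI allI impI)
  fix i assume i: "i < k"
  then have x: "0 \<le> x i" "x i < 1" using assms by (auto simp: in_torus_space_iff)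
  show "0 \<le> torus_grid k n x i" using i x by (simp add: torus_grid_def)
  have "real_of_int \<lfloor>x i * Suc n\<rfloor> \<le> x i * Suc n" by linarith
  also have "\<dots> < 1 * real (Suc n)" using x by (intro mult_strict_right_mono) auto
  finally show "torus_grid k n x i < 1" using i by (simp add: torus_grid_def)
qed (simp add: torus_grid_def)

text \<open>For real values; \<open>circle_lip\<close> is the counterpart for values read mod 1,
  such as those of \<open>f k\<close>, which as real functions may jump by integers.\<close>

definition torus_lip :: "nat \<Rightarrow> real \<Rightarrow> ((nat \<Rightarrow> real) \<Rightarrow> real) \<Rightarrow> bool" where
  "torus_lip k L g \<longleftrightarrow> 0 \<le> L \<and>
     (\<forall>x\<in>torus k. \<forall>y\<in>torus k. \<bar>g x - g y\<bar> \<le> L * tdistn k x y)"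

definition circle_lip :: "nat \<Rightarrow> real \<Rightarrow> ((nat \<Rightarrow> real) \<Rightarrow> real) \<Rightarrow> bool" where
  "circle_lip k L c \<longleftrightarrow> 0 \<le> L \<and>
     (\<forall>x\<in>torus k. \<forall>y\<in>torus k. tdist (c x) (c y) \<le> L * tdistn k x y)"

lemma torus_lipD:
  "torus_lip k L g \<Longrightarrow> x \<in> torus k \<Longrightarrow> y \<in> torus k \<Longrightarrow>
     \<bar>g x - g y\<bar> \<le> L * tdistn k x y"
  by (simp add: torus_lip_def)

lemma circle_lipD:
  "circle_lip k L c \<Longrightarrow> x \<in> torus k \<Longrightarrow> y \<in> torus k \<Longrightarrow>
     tdist (c x) (c y) \<le> L * tdistn k x y"
  by (simp add: circle_lip_def)

lemma torus_lip_continuous: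
  assumes "torus_lip k L g"
  shows "torus_continuous k g"
  unfolding torus_continuous_def
proof (intro ballI allI impI)
  fix x and e :: real assume x: "x \<in> torus k" and e: "0 < e"
  have L: "0 \<le> L" using assms by (simp add: torus_lip_def)
  show "\<exists>\<delta>>0. \<forall>y\<in>torus k. tdistn k x y < \<delta> \<longrightarrow> \<bar>g y - g x\<bar> < e"
  proof (intro exI[of _ "e / (L + 1)"] conjI ballI impI)
    fix y assume y: "y \<in> torus k" and d: "tdistn k x y < e / (L + 1)"
    have "\<bar>g y - g x\<bar> = \<bar>g x - g y\<bar>" by (rule abs_minus_commute)
    also have "\<dots> \<le> L * tdistn k x y" by (rule torus_lipD[OF assms x y])
    also have "\<dots> \<le> (L + 1) * tdistn k x y" by (intro mult_right_mono) auto
    also have "\<dots> < e" using d L by (simp add: pos_less_divide_eq mult.commute)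
    finally show "\<bar>g y - g x\<bar> < e" .
  qed (use e L in auto)
qed

lemma torus_grid_close:
  assumes "x \<in> torus k"
  shows "tdistn k x (torus_grid k n x) \<le> 1 / Suc n"
proof (subst tdistn_le_iff)
  show "\<forall>i<k. tdist (x i) (torus_grid k n x i) \<le> 1 / real (Suc n)"
  proof (intro allI impI)
    fix i assume i: "i < k"
    have "tdist (x i) (torus_grid k n x i) \<le> \<bar>x i - real_of_int \<lfloor>x i * Suc n\<rfloor> / Suc n\<bar>"
      using tdist_le_abs[of "x i" "torus_grid k n x i"] i by (simp add: torus_grid_def)
    also have "x i - real_of_int \<lfloor>x i * Suc n\<rfloor> / Suc n = frac (x i * Suc n) / Suc n"
      by (simp add: frac_def field_simps del: of_nat_Suc)
    also have "\<bar>\<dots>\<bar> \<le> 1 / Suc n"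
      using frac_lt_1[of "x i * Suc n"] by (simp add: divide_right_mono del: of_nat_Suc)
    finally show "tdist (x i) (torus_grid k n x i) \<le> 1 / real (Suc n)" .
  qed
qed simp

text \<open>Continuity is phrased by \<open>tdistn\<close> and not by a topology on functions, so it
  is linked to the product sigma-algebra by hand: g is the pointwise limit of its values on grids of
  mesh \<open>1 / Suc n\<close>, and each of these takes finitely many values.\<close>

lemma torus_continuous_measurable:
  assumes "torus_continuous k g"
  shows "g \<in> borel_measurable (torus_space k)"
proof (rule borel_measurable_LIMSEQ_real)
  fix x assume x: "x \<in> torus k"
  show "(\<lambda>n. g (torus_grid k n x)) \<longlonglongrightarrow> g x"
  proof (rule LIMSEQ_I)
    fix e :: real assume "0 < e"
    then obtain \<delta> where \<delta>: "\<delta> > 0"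
      "\<And>y. y\<in>torus k \<Longrightarrow> tdistn k x y < \<delta> \<Longrightarrow> \<bar>g y - g x\<bar> < e"
      using assms x unfolding torus_continuous_def by metis
    obtain N where N: "1 / Suc N < \<delta>" using nat_approx_posE[OF \<delta>(1)] by blast
    show "\<exists>N. \<forall>n\<ge>N. norm (g (torus_grid k n x) - g x) < e"
    proof (intro exI allI impI)
      fix n assume "n \<ge> N"
      then have "1 / real (Suc n) \<le> 1 / Suc N" by (intro divide_left_mono) auto
      with torus_grid_close[OF x, of n] N have "tdistn k x (torus_grid k n x) < \<delta>" by linarith
      with \<delta>(2)[OF torus_grid_in[OF x, of n]] show "norm (g (torus_grid k n x) - g x) < e" by simp
    qed
  qed
next
  fix n
  define F where "F = PiE {..<k} (\<lambda>_. (\<lambda>j. real j / Suc n) ` {..n})"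
  have fin: "finite F" unfolding F_def by (intro finite_PiE) auto
  have "torus_grid k n \<in> measurable (torus_space k) (count_space F)"
    unfolding measurable_count_space_eq2[OF fin]
  proof (intro conjI ballI)
    show "torus_grid k n \<in> torus k \<rightarrow> F"
    proof
      fix x assume x: "x \<in> torus k"
      show "torus_grid k n x \<in> F"
        unfolding F_def
      proof (rule PiE_I)
        fix i assume i: "i \<in> {..<k}"
        then have x: "0 \<le> x i" "x i < 1" using x by (auto simp: in_torus_space_iff)
        have "x i * Suc n < 1 * real (Suc n)" using x by (intro mult_strict_right_mono) auto
        then have "x i * Suc n < of_int (int n + 1)" by (simp add: add.commute)
        then have "\<lfloor>x i * Suc n\<rfloor> < int n + 1" unfolding floor_less_iff .
        then have "nat \<lfloor>x i * Suc n\<rfloor> \<le> n" by linarith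
        moreover have "real (nat \<lfloor>x i * Suc n\<rfloor>) = real_of_int \<lfloor>x i * Suc n\<rfloor>"
          using x by simp
        ultimately show "torus_grid k n x i \<in> (\<lambda>j. real j / Suc n) ` {..n}"
          using i by (intro image_eqI[where x="nat \<lfloor>x i * Suc n\<rfloor>"]) (auto simp: torus_grid_def)
      qed (auto simp: torus_grid_def)
    qed
  next
    fix a assume a: "a \<in> F"
    have "torus_grid k n -` {a} \<inter> torus k =
      {x \<in> torus k. \<forall>i. i < k \<longrightarrow> real_of_int \<lfloor>x i * Suc n\<rfloor> / Suc n = a i}"
      using a by (auto simp: torus_grid_def F_def fun_eq_iff PiE_iff extensional_def)
    also have "\<dots> \<in> sets (torus_space k)"
    proof (rule sets.sets_Collect_countable_All)
      fix i
      show "{x \<in> torus k. i < k \<longrightarrow> real_of_int \<lfloor>x i * Suc n\<rfloor> / Suc n = a i}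
        \<in> sets (torus_space k)"
      proof (cases "i < k")
        case True
        note measurable_torus_component[OF this, measurable]
        show ?thesis using True by simp
      qed simp
    qed
    finally show "torus_grid k n -` {a} \<inter> torus k \<in> sets (torus_space k)" .
  qed
  then show "(\<lambda>x. g (torus_grid k n x)) \<in> borel_measurable (torus_space k)"
    by (rule measurable_compose) simp
qed

lemmas torus_lip_measurable = torus_continuous_measurable[OF torus_lip_continuous]

lemma circle_lip_tdist:
  assumes "circle_lip k L c"
  shows "torus_lip k L (\<lambda>x. tdist (c x) r)"
  unfolding torus_lip_def
  using assms order_trans[OF abs_tdist_diff_le circle_lipD[OF assms]]
  by (auto simp: circle_lip_def)

text \<open>As a real function \<open>frac (c x)\<close> jumps where c passes through 0 mod 1. Its
  sublevel sets are preimages of arcs, and membership in an arc is expressed by distances to fixed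
  points, which are Lipschitz real functions of x.\<close>

lemma circle_lip_frac_measurable:
  assumes "circle_lip k L c"
  shows "(\<lambda>x. frac (c x)) \<in> borel_measurable (torus_space k)"
  unfolding borel_measurable_iff_less
proof
  fix b :: real
  consider "b \<le> 0" | "0 < b \<and> b \<le> 1" | "1 < b" by linarith
  then show "{w \<in> torus k. frac (c w) < b} \<in> sets (torus_space k)"
  proof cases
    case 1
    then have "{w \<in> torus k. frac (c w) < b} = {}"
      using frac_ge_0 by (auto simp: not_less intro: order_trans)
    then show ?thesis by (metis sets.empty_sets)
  next
    case 2
    have [measurable]: "(\<lambda>x. tdist (c x) r) \<in> borel_measurable (torus_space k)" for r
      by (rule torus_lip_measurable[OF circle_lip_tdist[OF assms]])
    have "{w \<in> torus k. frac (c w) < b} =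
      {w \<in> torus k. tdist (c w) (b / 2) < b / 2 \<or> tdist (c w) 0 = 0}"
      using frac_less_iff_tdist 2 by auto
    also have "\<dots> \<in> sets (torus_space k)" by measurable
    finally show ?thesis .
  next
    case 3
    then have "{w \<in> torus k. frac (c w) < b} = torus k"
      using frac_lt_1 by (auto intro: less_trans)
    then show ?thesis by (metis sets.top)
  qed
qed

lemma torus_lip_bounded:
  assumes "torus_lip k L g"
  obtains C where "C > 0" "\<And>x. x \<in> torus k \<Longrightarrow> \<bar>g x\<bar> \<le> C"
proof -
  define x0 :: "nat \<Rightarrow> real" where "x0 = (\<lambda>i\<in>{..<k}. 0)"
  have x0: "x0 \<in> torus k" by (auto simp: in_torus_space_iff x0_def)
  have L: "0 \<le> L" using assms by (simp add: torus_lip_def)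
  show thesis
  proof
    show "0 < \<bar>g x0\<bar> + L + 1" using L by linarith
    fix x assume x: "x \<in> torus k"
    have "\<bar>g x - g x0\<bar> \<le> L * tdistn k x x0" by (rule torus_lipD[OF assms x x0])
    also have "\<dots> \<le> L * 1" using L tdistn_le_1 by (intro mult_left_mono) auto
    finally show "\<bar>g x\<bar> \<le> \<bar>g x0\<bar> + L + 1" by linarith
  qed
qed

lemma torus_lip_const: "torus_lip k 0 (\<lambda>_. c)"
  by (simp add: torus_lip_def)

lemma torus_lip_add:
  assumes "torus_lip k L g" "torus_lip k L' g'"
  shows "torus_lip k (L + L') (\<lambda>x. g x + g' x)"
  unfolding torus_lip_def
proof (intro conjI ballI)
  fix x y assume "x \<in> torus k" "y \<in> torus k"
  with torus_lipD[OF assms(1) this] torus_lipD[OF assms(2) this]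
  show "\<bar>g x + g' x - (g y + g' y)\<bar> \<le> (L + L') * tdistn k x y"
    by (simp add: distrib_right)
qed (use assms in \<open>auto simp: torus_lip_def\<close>)

lemma torus_lip_mult:
  assumes "torus_lip k L g" "torus_lip k L' g'"
  obtains L'' where "torus_lip k L'' (\<lambda>x. g x * g' x)"
proof -
  obtain C where C: "C > 0" "\<And>x. x \<in> torus k \<Longrightarrow> \<bar>g x\<bar> \<le> C"
    using torus_lip_bounded[OF assms(1)] by blast
  obtain C' where C': "C' > 0" "\<And>x. x \<in> torus k \<Longrightarrow> \<bar>g' x\<bar> \<le> C'"
    using torus_lip_bounded[OF assms(2)] by blast
  have "torus_lip k (C * L' + C' * L) (\<lambda>x. g x * g' x)"
    unfolding torus_lip_def
  proof (intro conjI ballI)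
    fix x y assume xy: "x \<in> torus k" "y \<in> torus k"
    have "\<bar>g x * g' x - g y * g' y\<bar> = \<bar>g x * (g' x - g' y) + g' y * (g x - g y)\<bar>"
      by (simp add: algebra_simps)
    also have "\<dots> \<le> \<bar>g x\<bar> * \<bar>g' x - g' y\<bar> + \<bar>g' y\<bar> * \<bar>g x - g y\<bar>"
      by (metis abs_mult abs_triangle_ineq)
    also have "\<dots> \<le> C * (L' * tdistn k x y) + C' * (L * tdistn k x y)"
      using C C' xy by (intro add_mono mult_mono torus_lipD[OF assms(1)] torus_lipD[OF assms(2)]) auto
    finally show "\<bar>g x * g' x - g y * g' y\<bar> \<le> (C * L' + C' * L) * tdistn k x y"
      by (simp add: algebra_simps)
  qed (use assms C C' in \<open>auto simp: torus_lip_def\<close>)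
  then show thesis by (rule that)
qed

subsection \<open>Haar measure\<close>

lemma borel_measurable_frac [measurable]: "frac \<in> borel_measurable (borel :: real measure)"
  unfolding frac_def[abs_def] by measurable

abbreviation "unit_lborel \<equiv> restrict_space lborel {0..<1::real}"

lemma measurable_unit_rotation: "(\<lambda>t. frac (t + c)) \<in> measurable unit_lborel unit_lborel"
  by (rule measurable_restrict_space2) (auto simp: frac_lt_1 intro!: measurable_restrict_space1)

lemma emeasure_lborel_shift:
  assumes "B \<in> sets (borel :: real measure)"
  shows "emeasure lborel {t. t + a \<in> B} = emeasure lborel B"
proof -
  have "emeasure lborel B = emeasure (distr lborel borel ((+) a)) B" by (simp add: lborel_distr_plus)
  also have "\<dots> = emeasure lborel ((+) a -` B \<inter> space lborel)"
    using assms by (intro emeasure_distr) auto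
  also have "(+) a -` B \<inter> space lborel = {t. t + a \<in> B}" by (auto simp: add.commute)
  finally show ?thesis by simp
qed

lemma unit_rotation_invariant: "distr unit_lborel unit_lborel (\<lambda>t. frac (t + c)) = unit_lborel"
proof (rule measure_eqI)
  fix A assume "A \<in> sets (distr unit_lborel unit_lborel (\<lambda>t. frac (t + c)))"
  then have A: "A \<in> sets unit_lborel" by simp
  then have A': "A \<subseteq> {0..<1}" "A \<in> sets borel" by (auto simp: sets_restrict_space)
  define e where "e = frac c"
  have e: "0 \<le> e" "e < 1" by (auto simp: e_def frac_lt_1)
  \<comment> \<open>The preimage of A is cut where the rotation wraps round: B1 lies in [0, 1 - e)
    and is translated by e onto the part of A above e, B2 lies in [1 - e, 1) and is translated by e
    - 1 onto the part below e.\<close>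
  define B1 where "B1 = {t. t + e \<in> A \<inter> {e..<1}}"
  define B2 where "B2 = {t. t + (e - 1) \<in> A \<inter> {0..<e}}"
  have mB: "B1 \<in> sets borel" "B2 \<in> sets borel"
    using A' unfolding B1_def B2_def by (auto intro!: borel_measurable_add measurable_sets_borel[where f="\<lambda>t. t + _", unfolded vimage_def])
  have fr: "frac (t + c) = (if t + e < 1 then t + e else t + (e - 1))" if "0 \<le> t" "t < 1" for t
  proof -
    have "frac (t + c) = frac (t + e)" by (simp add: e_def)
    also have "\<dots> = (if t + e < 1 then t + e else t + (e - 1))"
      by (subst frac_unique_iff) (use that e in auto)
    finally show ?thesis .
  qed
  have "emeasure (distr unit_lborel unit_lborel (\<lambda>t. frac (t + c))) A
      = emeasure unit_lborel ((\<lambda>t. frac (t + c)) -` A \<inter> space unit_lborel)"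
    by (rule emeasure_distr[OF measurable_unit_rotation A])
  also have "(\<lambda>t. frac (t + c)) -` A \<inter> space unit_lborel = B1 \<union> B2"
    using A' e by (auto simp: space_restrict_space fr B1_def B2_def split: if_splits)
  also have "emeasure unit_lborel (B1 \<union> B2) = emeasure lborel (B1 \<union> B2)"
    using mB A' e by (intro emeasure_restrict_space) (auto simp: B1_def B2_def)
  also have "\<dots> = emeasure lborel B1 + emeasure lborel B2"
    using mB by (intro plus_emeasure[symmetric]) (auto simp: B1_def B2_def)
  also have "\<dots> = emeasure lborel (A \<inter> {e..<1}) + emeasure lborel (A \<inter> {0..<e})"
    unfolding B1_def B2_def using A' by (intro arg_cong2[where f=plus] emeasure_lborel_shift) auto
  also have "\<dots> = emeasure lborel ((A \<inter> {e..<1}) \<union> (A \<inter> {0..<e}))"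
    using A' by (intro plus_emeasure) auto
  also have "(A \<inter> {e..<1}) \<union> (A \<inter> {0..<e}) = A" using A' by force
  also have "emeasure lborel A = emeasure unit_lborel A"
    using A' by (intro emeasure_restrict_space[symmetric]) auto
  finally show "emeasure (distr unit_lborel unit_lborel (\<lambda>t. frac (t + c))) A = emeasure unit_lborel A" .
qed simp

lemma measurable_torus_extend:
  "(\<lambda>(x, t). x(k := t)) \<in> measurable (torus_space k \<Otimes>\<^sub>M restrict_space borel {0..<1}) (torus_space (Suc k))"
  unfolding torus_space_def lessThan_Suc by (rule measurable_add_dim)

lemma nn_integral_haar_Suc:
  assumes "g \<in> borel_measurable (torus_space (Suc k))"
  shows "(\<integral>\<^sup>+ x. g x \<partial>haar_torus (Suc k)) = (\<integral>\<^sup>+ x. (\<integral>\<^sup>+ t. g (x(k := t)) \<partial>unit_lborel) \<partial>haar_torus k)"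
proof -
  interpret product_sigma_finite "\<lambda>_::nat. unit_lborel"
    using prob_space_imp_sigma_finite[OF prob_space_unit] by (simp add: product_sigma_finite_def)
  have "g \<in> borel_measurable (haar_torus (Suc k))"
    using assms by (simp cong: measurable_cong_sets add: sets_haar_torus)
  then show ?thesis
    unfolding haar_torus_def lessThan_Suc by (intro product_nn_integral_insert) auto
qed

section \<open>Maps of the torus that preserve Haar measure\<close>

definition haar_preserving :: "nat \<Rightarrow> ((nat \<Rightarrow> real) \<Rightarrow> nat \<Rightarrow> real) \<Rightarrow> bool" where
  "haar_preserving k \<Phi> \<longleftrightarrow> \<Phi> \<in> measurable (torus_space k) (torus_space k) \<and>
     distr (haar_torus k) (torus_space k) \<Phi> = haar_torus k"

lemma haar_preserving_measurable:
  "haar_preserving k \<Phi> \<Longrightarrow> \<Phi> \<in> measurable (torus_space k) (torus_space k)"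
  by (simp add: haar_preserving_def)

lemma haar_preserving_in:
  "haar_preserving k \<Phi> \<Longrightarrow> x \<in> torus k \<Longrightarrow> \<Phi> x \<in> torus k"
  by (rule measurable_space[OF haar_preserving_measurable])

lemma measurable_haar_iff: "measurable (haar_torus k) N = measurable (torus_space k) N"
  by (rule measurable_cong_sets[OF sets_haar_torus refl])

lemma haar_preserving_nn_integral:
  assumes "haar_preserving k \<Phi>" "g \<in> borel_measurable (torus_space k)"
  shows "(\<integral>\<^sup>+ x. g (\<Phi> x) \<partial>haar_torus k) = (\<integral>\<^sup>+ x. g x \<partial>haar_torus k)"
proof -
  have "(\<integral>\<^sup>+ x. g x \<partial>haar_torus k) = (\<integral>\<^sup>+ x. g x \<partial>distr (haar_torus k) (torus_space k) \<Phi>)"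
    using assms(1) by (simp add: haar_preserving_def)
  also have "\<dots> = (\<integral>\<^sup>+ x. g (\<Phi> x) \<partial>haar_torus k)"
    using assms by (intro nn_integral_distr) (auto simp: haar_preserving_def measurable_haar_iff)
  finally show ?thesis by simp
qed

lemma haar_preserving_integral:
  fixes g :: "_ \<Rightarrow> real"
  assumes "haar_preserving k \<Phi>" "g \<in> borel_measurable (torus_space k)"
  shows "(\<integral>x. g (\<Phi> x) \<partial>haar_torus k) = (\<integral>x. g x \<partial>haar_torus k)"
proof -
  have "(\<integral>x. g x \<partial>haar_torus k) = (\<integral>x. g x \<partial>distr (haar_torus k) (torus_space k) \<Phi>)"
    using assms(1) by (simp add: haar_preserving_def)
  also have "\<dots> = (\<integral>x. g (\<Phi> x) \<partial>haar_torus k)"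
    using assms by (intro integral_distr) (auto simp: haar_preserving_def measurable_haar_iff)
  finally show ?thesis by simp
qed

lemma haar_preserving_comp:
  assumes "haar_preserving k \<Phi>" "haar_preserving k \<Psi>"
  shows "haar_preserving k (\<Phi> \<circ> \<Psi>)"
  unfolding haar_preserving_def
proof
  show "\<Phi> \<circ> \<Psi> \<in> measurable (torus_space k) (torus_space k)"
    using assms by (auto simp: haar_preserving_def)
  show "distr (haar_torus k) (torus_space k) (\<Phi> \<circ> \<Psi>) = haar_torus k"
    using assms distr_distr[of \<Phi> "torus_space k" "torus_space k" \<Psi> "haar_torus k"]
    by (simp add: haar_preserving_def measurable_haar_iff)
qed

lemma haar_preserving_id: "haar_preserving k (\<lambda>x. x)"
  unfolding haar_preserving_def by (auto intro: distr_id2 simp: sets_haar_torus)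

lemma haar_preserving_funpow: "haar_preserving k \<Phi> \<Longrightarrow> haar_preserving k (\<Phi> ^^ n)"
  by (induction n) (auto intro: haar_preserving_comp simp: haar_preserving_id id_def)

lemma restrict_in_torus:
  "x \<in> torus m \<Longrightarrow> k \<le> m \<Longrightarrow> restrict x {..<k} \<in> torus k"
  by (auto simp: in_torus_space_iff)

lemma extend_in_torus:
  "x \<in> torus k \<Longrightarrow> 0 \<le> t \<Longrightarrow> t < 1 \<Longrightarrow> x(k := t) \<in> torus (Suc k)"
  by (auto simp: in_torus_space_iff extensional_def less_Suc_eq)

lemma restrict_extend:
  "x \<in> torus k \<Longrightarrow> restrict (x(k := t)) {..<k} = x"
  by (auto simp: in_torus_space_iff fun_eq_iff extensional_def)

lemma measurable_torus_restrict:
  "k \<le> m \<Longrightarrow> (\<lambda>x. restrict x {..<k}) \<in> measurable (torus_space m) (torus_space k)"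
  by (rule measurable_torus_spaceI)
     (auto intro: measurable_torus_component simp: restrict_in_torus)

text \<open>By Tonelli: the inner integral over a fibre is unchanged by the rotation of that fibre,
  the outer one by \<Phi>. Measurability is asked of \<open>frac (c x)\<close>, since c has a
  meaning mod 1 only.\<close>

lemma haar_preserving_skew:
  assumes \<Phi>: "haar_preserving k \<Phi>"
    and c: "(\<lambda>x. frac (c x)) \<in> borel_measurable (torus_space k)"
    and \<Psi>: "\<And>x. x \<in> torus (Suc k) \<Longrightarrow>
      \<Psi> x = (\<Phi> (restrict x {..<k}))(k := frac (x k + c (restrict x {..<k})))"
  shows "haar_preserving (Suc k) \<Psi>"
proof -
  have \<Psi>_in: "\<Psi> x \<in> torus (Suc k)" if "x \<in> torus (Suc k)" for x
    unfolding \<Psi>[OF that]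
    using that by (intro extend_in_torus haar_preserving_in[OF \<Phi>] restrict_in_torus) (auto simp: frac_lt_1)
  note measurable_torus_restrict[of k "Suc k", simplified, measurable]
    c[measurable] haar_preserving_measurable[OF \<Phi>, measurable]
    measurable_torus_component[of k "Suc k", simplified, measurable]
  have m: "\<Psi> \<in> measurable (torus_space (Suc k)) (torus_space (Suc k))"
  proof (rule measurable_torus_spaceI)
    fix i assume i: "i < Suc k"
    show "(\<lambda>x. \<Psi> x i) \<in> borel_measurable (torus_space (Suc k))"
    proof (cases "i = k")
      case True
      have "(\<lambda>x. frac (x k + frac (c (restrict x {..<k})))) \<in> borel_measurable (torus_space (Suc k))"
        by measurable
      also have "?this \<longleftrightarrow> ?thesis"
        by (rule measurable_cong) (simp add: \<Psi> True)
      finally show ?thesis .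
    next
      case False
      with i have ik: "i < k" by simp
      note measurable_torus_component[OF ik, measurable]
      have "(\<lambda>x. \<Phi> (restrict x {..<k}) i) \<in> borel_measurable (torus_space (Suc k))"
        by measurable
      also have "?this \<longleftrightarrow> ?thesis"
        by (rule measurable_cong) (simp add: \<Psi> False)
      finally show ?thesis .
    qed
  qed (rule \<Psi>_in)
  moreover have "distr (haar_torus (Suc k)) (torus_space (Suc k)) \<Psi> = haar_torus (Suc k)"
  proof (rule measure_eqI)
    fix A assume "A \<in> sets (distr (haar_torus (Suc k)) (torus_space (Suc k)) \<Psi>)"
    then have A: "A \<in> sets (torus_space (Suc k))" by simp
    define G where "G y = (\<integral>\<^sup>+ t. indicator A (y(k := t)) \<partial>unit_lborel)" for y
    interpret U: sigma_finite_measure unit_lborel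
      by (rule prob_space_imp_sigma_finite[OF prob_space_unit])
    have su: "sets unit_lborel = sets (restrict_space borel {0..<1})" by (simp add: sets_restrict_space)
    have up: "(\<lambda>(x, t). x(k := t)) \<in> measurable (torus_space k \<Otimes>\<^sub>M unit_lborel) (torus_space (Suc k))"
      using measurable_torus_extend by (simp cong: measurable_cong_sets sets_pair_measure_cong add: su)
    have "(\<lambda>p. indicator A (case p of (x, t) \<Rightarrow> x(k := t)) :: ennreal) \<in> borel_measurable (torus_space k \<Otimes>\<^sub>M unit_lborel)"
      using A by (intro measurable_compose[OF up]) auto
    then have G: "G \<in> borel_measurable (torus_space k)"
      unfolding G_def by (intro U.borel_measurable_nn_integral) (simp add: split_beta')
    have "emeasure (distr (haar_torus (Suc k)) (torus_space (Suc k)) \<Psi>) A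
        = (\<integral>\<^sup>+ x. indicator A x \<partial>distr (haar_torus (Suc k)) (torus_space (Suc k)) \<Psi>)"
      using A by simp
    also have "\<dots> = (\<integral>\<^sup>+ x. indicator A (\<Psi> x) \<partial>haar_torus (Suc k))"
      using A m by (intro nn_integral_distr) (auto simp: measurable_haar_iff)
    also have "\<dots> = (\<integral>\<^sup>+ x. (\<integral>\<^sup>+ t. indicator A (\<Psi> (x(k := t))) \<partial>unit_lborel) \<partial>haar_torus k)"
      using A by (intro nn_integral_haar_Suc measurable_compose[OF m]) auto
    also have "\<dots> = (\<integral>\<^sup>+ x. G (\<Phi> x) \<partial>haar_torus k)"
    proof (rule nn_integral_cong)
      fix x assume "x \<in> space (haar_torus k)"
      then have x: "x \<in> torus k" by simp
      then have px: "\<Phi> x \<in> torus k" by (rule haar_preserving_in[OF \<Phi>])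
      have "(\<integral>\<^sup>+ t. indicator A (\<Psi> (x(k := t))) \<partial>unit_lborel)
          = (\<integral>\<^sup>+ t. indicator A ((\<Phi> x)(k := frac (t + c x))) \<partial>unit_lborel)"
        by (rule nn_integral_cong)
           (simp add: space_restrict_space \<Psi> extend_in_torus x restrict_extend del: restrict_fupd)
      also have "\<dots> = (\<integral>\<^sup>+ t. indicator A ((\<Phi> x)(k := t)) \<partial>distr unit_lborel unit_lborel (\<lambda>t. frac (t + c x)))"
      proof (rule nn_integral_distr[symmetric, OF measurable_unit_rotation])
        have "(\<lambda>t. (\<Phi> x)(k := t)) \<in> measurable unit_lborel (torus_space (Suc k))"
          using measurable_compose[OF measurable_Pair1'[OF px] up] by simp
        then show "(\<lambda>t. indicator A ((\<Phi> x)(k := t))) \<in> borel_measurable (distr unit_lborel unit_lborel (\<lambda>t. frac (t + c x)))"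
          using A by (simp add: measurable_compose)
      qed
      also have "\<dots> = G (\<Phi> x)" by (simp add: unit_rotation_invariant G_def)
      finally show "(\<integral>\<^sup>+ t. indicator A (\<Psi> (x(k := t))) \<partial>unit_lborel) = G (\<Phi> x)" .
    qed
    also have "\<dots> = (\<integral>\<^sup>+ x. G x \<partial>haar_torus k)"
      by (rule haar_preserving_nn_integral[OF \<Phi> G])
    also have "\<dots> = (\<integral>\<^sup>+ x. indicator A x \<partial>haar_torus (Suc k))"
      unfolding G_def using A by (intro nn_integral_haar_Suc[symmetric]) auto
    also have "\<dots> = emeasure (haar_torus (Suc k)) A"
      using A by (simp add: sets_haar_torus)
    finally show "emeasure (distr (haar_torus (Suc k)) (torus_space (Suc k)) \<Psi>) A = emeasure (haar_torus (Suc k)) A" .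
  qed (simp add: sets_haar_torus)
  ultimately show ?thesis by (simp add: haar_preserving_def)
qed

lemma vert_rot_haar_preserving: "haar_preserving (Suc k) (vert_rot (Suc k) s)"
proof (rule haar_preserving_skew[OF haar_preserving_id])
  fix x assume x: "x \<in> torus (Suc k)"
  show "vert_rot (Suc k) s x = (restrict x {..<k})(k := frac (x k + s))"
    using x by (auto simp: vert_rot_def in_torus_space_iff fun_eq_iff extensional_def)
qed simp

subsection \<open>The skew product\<close>

text \<open>The two dimensions are kept apart because \<open>vert_rot k\<close> also acts on
  \<open>torus (Suc k)\<close>, where it rotates the coordinate before the last.\<close>

lemma vert_rot_in: "x \<in> torus m \<Longrightarrow> 1 \<le> k \<Longrightarrow> k \<le> m \<Longrightarrow> vert_rot k s x \<in> torus m"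
  by (auto simp: in_torus_space_iff vert_rot_def extensional_def frac_lt_1)

lemma vert_rot_add: "vert_rot k a (vert_rot k b x) = vert_rot k (a + b) x"
  by (simp add: vert_rot_def fun_eq_iff algebra_simps)

lemma vert_rot_0: "x \<in> torus m \<Longrightarrow> 1 \<le> k \<Longrightarrow> k \<le> m \<Longrightarrow> vert_rot k 0 x = x"
  by (auto simp: in_torus_space_iff vert_rot_def frac_eq)

lemma vert_rot_cong: "a - b \<in> \<int> \<Longrightarrow> vert_rot k a x = vert_rot k b x"
proof -
  assume "a - b \<in> \<int>"
  then have "frac (x (k - 1) + a) = frac (x (k - 1) + b)" by (simp add: frac_eq_iff_diff_Ints)
  then show ?thesis by (simp add: vert_rot_def)
qed

lemma restrict_vert_rot:
  "1 \<le> k \<Longrightarrow> restrict (vert_rot k s x) {..<k} = vert_rot k s (restrict x {..<k})"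
  by (auto simp: vert_rot_def fun_eq_iff restrict_def)

lemma tdistn_vert_rot_self: "tdistn m (vert_rot k s x) x \<le> \<bar>s\<bar>"
proof (subst tdistn_le_iff)
  have "tdist (frac (x i + s)) (x i) \<le> \<bar>s\<bar>" for i
    using tdist_le_abs[of "x i + s" "x i"] by simp
  then show "\<forall>i<m. tdist (vert_rot k s x i) (x i) \<le> \<bar>s\<bar>" by (auto simp: vert_rot_def)
qed simp

lemma tdistn_vert_rot: "tdistn m (vert_rot k s x) (vert_rot k s y) \<le> tdistn m x y"
  by (subst tdistn_le_iff) (auto simp: vert_rot_def intro: tdist_le_tdistn)

lemma torus_lip_vert_rot:
  assumes "torus_lip m L g" "1 \<le> k" "k \<le> m"
  shows "torus_lip m L (\<lambda>x. g (vert_rot k s x))"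
  unfolding torus_lip_def
proof (intro conjI ballI)
  show L: "0 \<le> L" using assms by (simp add: torus_lip_def)
  fix x y assume "x \<in> torus m" "y \<in> torus m"
  then have "\<bar>g (vert_rot k s x) - g (vert_rot k s y)\<bar> \<le> L * tdistn m (vert_rot k s x) (vert_rot k s y)"
    using assms by (intro torus_lipD[OF assms(1)] vert_rot_in)
  also have "\<dots> \<le> L * tdistn m x y" using L by (intro mult_left_mono tdistn_vert_rot)
  finally show "\<bar>g (vert_rot k s x) - g (vert_rot k s y)\<bar> \<le> L * tdistn m x y" .
qed

text \<open>Any real e congruent to a - b may be used, so an angle can be exchanged for the
  representative that gives the best bound.\<close>

lemma torus_lip_vert_rot_diff:
  assumes "torus_lip m L g" "x \<in> torus m" "1 \<le> k" "k \<le> m" "a - b - e \<in> \<int>"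
  shows "\<bar>g (vert_rot k a x) - g (vert_rot k b x)\<bar> \<le> L * \<bar>e\<bar>"
proof -
  have L: "0 \<le> L" using assms by (simp add: torus_lip_def)
  have "vert_rot k a x = vert_rot k (e + b) x"
    by (rule vert_rot_cong) (use assms(5) in \<open>simp add: algebra_simps\<close>)
  then have "\<bar>g (vert_rot k a x) - g (vert_rot k b x)\<bar> =
      \<bar>g (vert_rot k e (vert_rot k b x)) - g (vert_rot k b x)\<bar>" by (simp add: vert_rot_add)
  also have "\<dots> \<le> L * tdistn m (vert_rot k e (vert_rot k b x)) (vert_rot k b x)"
    using assms by (intro torus_lipD[OF assms(1)] vert_rot_in)
  also have "\<dots> \<le> L * \<bar>e\<bar>" using L by (intro mult_left_mono tdistn_vert_rot_self)
  finally show ?thesis .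
qed

section \<open>Iterates of the skew product and their interplay with rotations\<close>

locale skew_product =
  fixes d :: nat and \<alpha> :: real and f :: "nat \<Rightarrow> (nat \<Rightarrow> real) \<Rightarrow> real"
  assumes depends: "1 \<le> k \<Longrightarrow> k < d \<Longrightarrow> depends_on_first k (f k)"
    and lipschitz: "1 \<le> k \<Longrightarrow> k < d \<Longrightarrow> lipschitz_torus k (f k)"
begin

abbreviation T :: "nat \<Rightarrow> (nat \<Rightarrow> real) \<Rightarrow> nat \<Rightarrow> real" where
  "T k \<equiv> skew_map k \<alpha> f"

lemma f_cong: "1 \<le> k \<Longrightarrow> k < d \<Longrightarrow> (\<And>i. i < k \<Longrightarrow> x i = y i) \<Longrightarrow> f k x = f k y"
  using depends unfolding depends_on_first_def by blast

lemma f_restrict: "1 \<le> k \<Longrightarrow> k < d \<Longrightarrow> f k (restrict x {..<k}) = f k x"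
  by (rule f_cong) auto

lemma f_circle_lip:
  assumes "1 \<le> k" "k < d"
  obtains L where "0 < L" "circle_lip k L (f k)"
proof -
  obtain L where L: "\<forall>x\<in>torus_pts k. \<forall>y\<in>torus_pts k. tdist (f k x) (f k y) \<le> L * tdistn k x y"
    using lipschitz[OF assms] by (auto simp: lipschitz_torus_def)
  have "circle_lip k (\<bar>L\<bar> + 1) (f k)"
    unfolding circle_lip_def
  proof (intro conjI ballI)
    fix x y assume "x \<in> torus k" "y \<in> torus k"
    then have "tdist (f k x) (f k y) \<le> L * tdistn k x y"
      using L by (auto intro: torus_space_subset_pts)
    also have "\<dots> \<le> (\<bar>L\<bar> + 1) * tdistn k x y" by (intro mult_right_mono) auto
    finally show "tdist (f k x) (f k y) \<le> (\<bar>L\<bar> + 1) * tdistn k x y" .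
  qed simp
  then show thesis using that[of "\<bar>L\<bar> + 1"] by simp
qed

text \<open>Exhibits \<open>T (Suc k)\<close> as a fibrewise rotation over \<open>T k\<close>. For k
  = 0 the base is a point and the fibre is rotated by \<alpha>, which lets the induction for
  invariance of Haar measure start at dimension 0.\<close>

lemma skew_Suc:
  assumes "k < d" "x \<in> torus (Suc k)"
  shows "T (Suc k) x = (T k (restrict x {..<k}))(k := frac (x k + (if k = 0 then \<alpha> else f k (restrict x {..<k}))))"
proof
  fix i
  have "f i (restrict x {..<k}) = f i x" if "0 < i" "i < Suc k"
    using that assms(1) by (intro f_cong) auto
  then show "T (Suc k) x i = ((T k (restrict x {..<k}))(k := frac (x k + (if k = 0 then \<alpha> else f k (restrict x {..<k}))))) i"
    by (auto simp: skew_map_def)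
qed

lemma T_haar_preserving: "k \<le> d \<Longrightarrow> haar_preserving k (T k)"
proof (induction k)
  case 0
  \<comment> \<open>\<open>torus 0\<close> has a single point, on which T 0 is the identity. The two
    differ outside it, hence the detour through congruence on the space.\<close>
  have id: "T 0 x = x" if "x \<in> torus 0" for x
    using that by (auto simp: in_torus_space_iff skew_map_def fun_eq_iff)
  have "T 0 \<in> measurable (torus_space 0) (torus_space 0) \<longleftrightarrow> (\<lambda>x. x) \<in> measurable (torus_space 0) (torus_space 0)"
    by (rule measurable_cong) (rule id)
  moreover have "distr (haar_torus 0) (torus_space 0) (T 0) = distr (haar_torus 0) (torus_space 0) (\<lambda>x. x)"
    by (rule distr_cong) (auto simp: id)
  ultimately show ?case using haar_preserving_id[of 0] by (simp add: haar_preserving_def)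
next
  case (Suc k)
  define c where "c = (if k = 0 then (\<lambda>_. \<alpha>) else f k)"
  have c: "(\<lambda>x. frac (c x)) \<in> borel_measurable (torus_space k)"
  proof (cases "k = 0")
    case False
    with Suc.prems obtain L where "circle_lip k L (f k)" using f_circle_lip[of k] by auto
    then show ?thesis using circle_lip_frac_measurable False by (auto simp: c_def)
  qed (simp add: c_def)
  show ?case
  proof (rule haar_preserving_skew[OF _ c])
    fix x assume "x \<in> torus (Suc k)"
    then have "T (Suc k) x = (T k (restrict x {..<k}))(k := frac (x k + (if k = 0 then \<alpha> else f k (restrict x {..<k}))))"
      using Suc.prems by (intro skew_Suc) auto
    also have "(if k = 0 then \<alpha> else f k (restrict x {..<k})) = c (restrict x {..<k})"
      by (auto simp: c_def)
    finally show "T (Suc k) x = (T k (restrict x {..<k}))(k := frac (x k + c (restrict x {..<k})))" .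
  qed (use Suc in auto)
qed

lemma T_funpow_haar_preserving: "k \<le> d \<Longrightarrow> haar_preserving k (T k ^^ n)"
  by (intro haar_preserving_funpow T_haar_preserving)

lemma T_funpow_in:
  "k \<le> d \<Longrightarrow> x \<in> torus k \<Longrightarrow> (T k ^^ n) x \<in> torus k"
  by (rule haar_preserving_in[OF T_funpow_haar_preserving])

lemma restrict_T_funpow:
  assumes "k < d" "x \<in> torus (Suc k)"
  shows "restrict ((T (Suc k) ^^ n) x) {..<k} = (T k ^^ n) (restrict x {..<k})"
proof (induction n)
  case (Suc n)
  have y: "(T (Suc k) ^^ n) x \<in> torus (Suc k)"
    using assms by (intro T_funpow_in) auto
  have "T k (restrict ((T (Suc k) ^^ n) x) {..<k}) \<in> torus k"
    using assms y by (intro haar_preserving_in[OF T_haar_preserving] restrict_in_torus) auto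
  then have "restrict (T (Suc k) ((T (Suc k) ^^ n) x)) {..<k} = T k (restrict ((T (Suc k) ^^ n) x) {..<k})"
    unfolding skew_Suc[OF assms(1) y] by (rule restrict_extend)
  then show ?case unfolding Suc by (simp only: funpow.simps comp_apply)
qed simp

text \<open>Coordinate \<open>k - 1\<close> is read by none of the cocycles \<open>f i\<close> with
  \<open>i < k\<close>, so it enters T k by addition only.\<close>

lemma T_vert_rot:
  assumes "1 \<le> k" "k \<le> d"
  shows "T k (vert_rot k s x) = vert_rot k s (T k x)"
proof
  fix i
  have "f i (vert_rot k s x) = f i x" if "0 < i" "i < k"
    using that assms by (intro f_cong) (auto simp: vert_rot_def)
  then show "T k (vert_rot k s x) i = vert_rot k s (T k x) i"
    using assms by (auto simp: skew_map_def vert_rot_def algebra_simps)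
qed

lemma T_funpow_vert_rot:
  "1 \<le> k \<Longrightarrow> k \<le> d \<Longrightarrow> (T k ^^ n) (vert_rot k s x) = vert_rot k s ((T k ^^ n) x)"
  by (induction n) (auto simp: T_vert_rot)

text \<open>The increment of the cocycle is determined mod 1 only. Its representative nearest to 0
  is a real number of size at most L times the step, which can be summed along orbits and divided by
  s.\<close>

definition incr :: "nat \<Rightarrow> real \<Rightarrow> (nat \<Rightarrow> real) \<Rightarrow> real" where
  "incr k s x = crep (f k (vert_rot k s x) - f k x)"

lemma incr_restrict: "1 \<le> k \<Longrightarrow> k < d \<Longrightarrow> incr k s (restrict x {..<k}) = incr k s x"
  unfolding incr_def by (simp add: restrict_vert_rot[symmetric] f_restrict)

lemma T_Suc_vert_rot:
  assumes "1 \<le> k" "k < d"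
  shows "T (Suc k) (vert_rot k s x) = vert_rot (Suc k) (incr k s x) (vert_rot k s (T (Suc k) x))"
proof
  fix i
  have 1: "f i (vert_rot k s x) = f i x" if "0 < i" "i < k"
    using that assms by (intro f_cong) (auto simp: vert_rot_def)
  have 2: "frac (x k + f k x + crep (f k (vert_rot k s x) - f k x)) = frac (x k + f k (vert_rot k s x))"
    unfolding frac_add_crep by (simp add: algebra_simps)
  show "T (Suc k) (vert_rot k s x) i = vert_rot (Suc k) (incr k s x) (vert_rot k s (T (Suc k) x)) i"
  proof (cases "i = k")
    case True
    then have "T (Suc k) (vert_rot k s x) i = frac (x k + f k (vert_rot k s x))"
      using assms by (auto simp: skew_map_def vert_rot_def[of k s x])
    moreover have "vert_rot k s (T (Suc k) x) k = frac (x k + f k x)"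
      using assms by (auto simp: skew_map_def vert_rot_def)
    ultimately show ?thesis using True 2
      by (simp add: vert_rot_def[of "Suc k"] incr_def)
  next
    case False
    then show ?thesis using assms 1
      by (auto simp: skew_map_def vert_rot_def algebra_simps)
  qed
qed

lemma vert_rot_commute:
  "1 \<le> k \<Longrightarrow> vert_rot (Suc k) a (vert_rot k s x) = vert_rot k s (vert_rot (Suc k) a x)"
  by (auto simp: vert_rot_def fun_eq_iff)

text \<open>Induction on n: by \<open>T_vert_rot\<close> the rotation of the last coordinate
  accumulated so far passes through T, and \<open>T_Suc_vert_rot\<close> adds one increment, which
  depends on the base orbit alone by \<open>incr_restrict\<close>.\<close>

lemma T_Suc_funpow_vert_rot:
  assumes "1 \<le> k" "k < d" "x \<in> torus (Suc k)"
  shows "(T (Suc k) ^^ n) (vert_rot k s x) =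
    vert_rot (Suc k) (\<Sum>j<n. incr k s ((T k ^^ j) (restrict x {..<k}))) (vert_rot k s ((T (Suc k) ^^ n) x))"
proof (induction n)
  case 0
  then show ?case using assms vert_rot_in[OF assms(3), of k s] vert_rot_0[of "vert_rot k s x" "Suc k" "Suc k"] by simp
next
  case (Suc n)
  let ?y = "(T (Suc k) ^^ n) x" and ?a = "\<Sum>j<n. incr k s ((T k ^^ j) (restrict x {..<k}))"
  have "(T (Suc k) ^^ Suc n) (vert_rot k s x) = T (Suc k) (vert_rot (Suc k) ?a (vert_rot k s ?y))"
    unfolding Suc[symmetric] by simp
  also have "\<dots> = vert_rot (Suc k) ?a (T (Suc k) (vert_rot k s ?y))"
    using assms by (intro T_vert_rot) auto
  also have "\<dots> = vert_rot (Suc k) (?a + incr k s ?y) (vert_rot k s (T (Suc k) ?y))"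
    using assms by (simp add: T_Suc_vert_rot vert_rot_add)
  also have "incr k s ?y = incr k s ((T k ^^ n) (restrict x {..<k}))"
    using assms by (simp add: incr_restrict[symmetric, of k s ?y] restrict_T_funpow)
  finally show ?case by (simp only: funpow.simps comp_apply sum.lessThan_Suc)
qed

lemma incr_bound:
  assumes "circle_lip k L (f k)" "x \<in> torus k" "1 \<le> k"
  shows "\<bar>incr k s x\<bar> \<le> L * \<bar>s\<bar>"
proof -
  have L: "0 \<le> L" using assms by (simp add: circle_lip_def)
  have "\<bar>incr k s x\<bar> = tdist (f k (vert_rot k s x)) (f k x)" by (simp add: incr_def tdist_eq_crep)
  also have "\<dots> \<le> L * tdistn k (vert_rot k s x) x"
    using assms by (intro circle_lipD[OF assms(1)] vert_rot_in) auto
  also have "\<dots> \<le> L * \<bar>s\<bar>" using L by (intro mult_left_mono tdistn_vert_rot_self)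
  finally show ?thesis .
qed

text \<open>Both increments are below 1/4 in absolute value, so their difference is below 1/2 and
  its absolute value is a distance mod 1. That distance splits into one between the rotated points
  and one between the original points, whence the factor 2.\<close>

lemma incr_torus_lip:
  assumes L: "circle_lip k L (f k)" "1 \<le> k" and s: "L * \<bar>s\<bar> < 1 / 4"
  shows "torus_lip k (2 * L) (incr k s)"
  unfolding torus_lip_def
proof (intro conjI ballI)
  show L0: "0 \<le> 2 * L" using L by (simp add: circle_lip_def)
  fix x y assume x: "x \<in> torus k" and y: "y \<in> torus k"
  let ?x = "vert_rot k s x" and ?y = "vert_rot k s y"
  have xy': "?x \<in> torus k" "?y \<in> torus k"
    using x y L(2) by (auto intro: vert_rot_in)
  have b: "\<bar>incr k s x\<bar> < 1/4" "\<bar>incr k s y\<bar> < 1/4"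
    using incr_bound[OF L(1) x L(2), of s] incr_bound[OF L(1) y L(2), of s] s by auto
  have i: "(f k ?x - f k ?y) - ((f k x - f k y) + (incr k s x - incr k s y)) \<in> \<int>"
    using Ints_diff[OF diff_crep_Ints[of "f k ?x - f k x"] diff_crep_Ints[of "f k ?y - f k y"]]
    by (simp add: incr_def algebra_simps)
  have "\<bar>incr k s x - incr k s y\<bar> = tdist (incr k s x) (incr k s y)"
  proof -
    have "\<bar>incr k s x - incr k s y - of_int 0\<bar> < 1 / 2" using b by linarith
    from crep_unique[OF this] show ?thesis by (simp add: tdist_eq_crep)
  qed
  also have "\<dots> \<le> tdist (f k ?x) (f k ?y) + tdist (f k y) (f k x)"
    using Ints_minus[OF i] by (intro tdist_triangle_gen) (simp add: algebra_simps)
  also have "\<dots> \<le> L * tdistn k ?x ?y + L * tdistn k x y"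
    using circle_lipD[OF L(1)] x y xy' by (intro add_mono) (auto simp: tdist_commute[of "f k y"])
  also have "\<dots> \<le> L * tdistn k x y + L * tdistn k x y"
    using L0 by (intro add_mono mult_left_mono tdistn_vert_rot) auto
  finally show "\<bar>incr k s x - incr k s y\<bar> \<le> 2 * L * tdistn k x y" by simp
qed

text \<open>Mod 1 this is a telescoping sum. The smallness condition keeps the sum of the two
  representatives below 1/2, which makes it an equality of real numbers; through
  \<open>incr_mult\<close> a coarse difference quotient becomes an average of rotated fine
  ones.\<close>

lemma incr_add:
  assumes L: "circle_lip k L (f k)" "1 \<le> k" and x: "x \<in> torus k"
    and s: "L * (\<bar>a\<bar> + \<bar>b\<bar>) < 1 / 2"
  shows "incr k (a + b) x = incr k a (vert_rot k b x) + incr k b x"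
  unfolding incr_def[of k "a + b"]
proof (rule crep_eqI)
  have "\<bar>incr k a (vert_rot k b x)\<bar> \<le> L * \<bar>a\<bar>" "\<bar>incr k b x\<bar> \<le> L * \<bar>b\<bar>"
    using L x by (auto intro!: incr_bound vert_rot_in)
  then show "\<bar>incr k a (vert_rot k b x) + incr k b x\<bar> < 1 / 2"
    using s unfolding distrib_left by linarith
  show "f k (vert_rot k (a + b) x) - f k x - (incr k a (vert_rot k b x) + incr k b x) \<in> \<int>"
    using Ints_add[OF diff_crep_Ints[of "f k (vert_rot k a (vert_rot k b x)) - f k (vert_rot k b x)"]
        diff_crep_Ints[of "f k (vert_rot k b x) - f k x"]]
    by (simp add: incr_def vert_rot_add algebra_simps)
qed

lemma incr_mult:
  fixes N :: nat
  assumes L: "circle_lip k L (f k)" "1 \<le> k" and x: "x \<in> torus k" and s: "0 \<le> s"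
    and N: "L * (real N * s) < 1 / 2"
  shows "incr k (real N * s) x = (\<Sum>i<N. incr k s (vert_rot k (real i * s) x))"
  using N
proof (induction N)
  case 0
  then show ?case using vert_rot_0[OF x L(2)] by (simp add: incr_def crep_def)
next
  case (Suc N)
  have "0 \<le> L" using L by (simp add: circle_lip_def)
  then have "L * (real N * s) \<le> L * (real (Suc N) * s)" using s by (intro mult_left_mono mult_right_mono) auto
  then have IH: "incr k (real N * s) x = (\<Sum>i<N. incr k s (vert_rot k (real i * s) x))"
    using Suc by simp
  have "incr k (real (Suc N) * s) x = incr k (s + real N * s) x" by (simp add: algebra_simps)
  also have "\<dots> = incr k s (vert_rot k (real N * s) x) + incr k (real N * s) x"
    using Suc.prems s by (intro incr_add[OF L x]) (simp add: algebra_simps)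
  finally show ?case using IH by simp
qed

end

subsection \<open>The degree as a mean increment\<close>

lemma continuous_Ints_constant:
  fixes h :: "'a::topological_space \<Rightarrow> real"
  assumes "connected S" "continuous_on S h" "\<And>x. x \<in> S \<Longrightarrow> h x \<in> \<int>" "x \<in> S" "y \<in> S"
  shows "h x = h y"
proof -
  have "h constant_on S"
  proof (rule continuous_discrete_range_constant[OF assms(1,2)])
    fix x assume x: "x \<in> S"
    show "\<exists>e>0. \<forall>y. y \<in> S \<and> h y \<noteq> h x \<longrightarrow> e \<le> norm (h y - h x)"
    proof (intro exI[of _ 1] conjI allI impI)
      fix y assume y: "y \<in> S \<and> h y \<noteq> h x"
      then have "h y - h x \<in> \<int>" "h y - h x \<noteq> 0" using assms(3) x by auto
      then show "1 \<le> norm (h y - h x)" using Ints_nonzero_abs_ge1 by fastforce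
    qed simp
  qed
  then show ?thesis using assms(4,5) by (auto simp: constant_on_def)
qed

lemma cis_2pi_eq_1_iff: "cis (2 * pi * a) = 1 \<longleftrightarrow> a \<in> \<int>"
proof
  assume "cis (2 * pi * a) = 1"
  then have "Re (cis (2 * pi * a)) = 1" by simp
  then have "cos (2 * pi * a) = 1" by simp
  then obtain n :: int where "2 * pi * a = n * 2 * pi" by (auto simp: cos_one_2pi_int)
  then have "a = of_int n" by simp
  then show "a \<in> \<int>" by simp
qed simp

text \<open>\<open>circle_degree\<close> is a definite description over lifts, so a lift has to be
  produced first. The line is contractible, hence \<open>cis (2 * pi * g (frac t))\<close> has a
  continuous logarithm, and its imaginary part divided by 2 pi is a lift.\<close>

lemma circle_lift_exists:
  assumes g: "\<And>a b. tdist (g (frac a)) (g (frac b)) \<le> L * tdist a b" and L: "0 \<le> L"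
  obtains F where "circle_lift g F"
proof -
  have "continuous_on UNIV (\<lambda>t. cis (2 * pi * g (frac t)))"
  proof (rule continuous_at_imp_continuous_on, rule ballI)
    fix t0 :: real
    have lim: "((\<lambda>t. crep (g (frac t) - g (frac t0))) \<longlongrightarrow> 0) (at t0)"
    proof (rule Lim_null_comparison)
      have "norm (crep (g (frac t) - g (frac t0))) \<le> L * \<bar>t - t0\<bar>" for t
        using order_trans[OF g[of t t0] mult_left_mono[OF tdist_le_abs L]] by (simp add: tdist_eq_crep)
      then show "eventually (\<lambda>t. norm (crep (g (frac t) - g (frac t0))) \<le> L * \<bar>t - t0\<bar>) (at t0)"
        by simp
      have "((\<lambda>t. L * \<bar>t - t0\<bar>) \<longlongrightarrow> L * \<bar>t0 - t0\<bar>) (at t0)" by (intro tendsto_intros)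
      then show "((\<lambda>t. L * \<bar>t - t0\<bar>) \<longlongrightarrow> 0) (at t0)" by simp
    qed
    have eq: "cis (2 * pi * g (frac t)) = cis (2 * pi * g (frac t0)) * cis (2 * pi * crep (g (frac t) - g (frac t0)))" for t
    proof -
      define m where "m = round (g (frac t) - g (frac t0))"
      have "2 * pi * g (frac t) = 2 * pi * g (frac t0) + 2 * pi * crep (g (frac t) - g (frac t0)) + 2 * pi * of_int m"
        by (simp add: crep_def m_def algebra_simps)
      then show ?thesis by (simp add: cis_mult[symmetric])
    qed
    have "((\<lambda>t. cis (2 * pi * g (frac t0)) * cis (2 * pi * crep (g (frac t) - g (frac t0)))) \<longlongrightarrow>
       cis (2 * pi * g (frac t0)) * cis (2 * pi * 0)) (at t0)"
      by (intro tendsto_intros lim)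
    then show "isCont (\<lambda>t. cis (2 * pi * g (frac t))) t0"
      unfolding isCont_def eq[symmetric] by simp
  qed
  then obtain G where G: "continuous_on UNIV G" "\<And>t::real. cis (2 * pi * g (frac t)) = exp (G t)"
    using continuous_logarithm_on_contractible[of "UNIV :: real set" "\<lambda>t. cis (2 * pi * g (frac t))"]
    by (auto simp: convex_imp_contractible)
  define F where "F t = Im (G t) / (2 * pi)" for t
  have "circle_lift g F"
    unfolding circle_lift_def
  proof (intro conjI allI)
    show "continuous_on UNIV F" unfolding F_def by (intro continuous_intros G(1)) simp
    fix t
    have "norm (exp (G t)) = 1" unfolding G(2)[symmetric] by simp
    then have "Re (G t) = 0" by simp
    then have "exp (G t) = cis (2 * pi * F t)" by (simp add: exp_eq_polar F_def)
    then have "cis (2 * pi * F t) / cis (2 * pi * g (frac t)) = 1" by (simp add: G(2))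
    then have "cis (2 * pi * (F t - g (frac t))) = 1" by (simp add: cis_divide algebra_simps)
    then show "frac (F t) = frac (g (frac t))" by (simp add: cis_2pi_eq_1_iff frac_eq_iff_diff_Ints)
  qed
  then show thesis by (rule that)
qed

text \<open>Continuous integer-valued functions on the line are constant. Applied to F (t + 1) - F t
  this gives independence of t; applied to the difference of two lifts it gives the uniqueness that
  the definite description in \<open>circle_degree\<close> requires.\<close>

lemma circle_lift_period:
  assumes "circle_lift g F"
  shows "F (t + 1) - F t = of_int (circle_degree g)"
proof -
  have F: "continuous_on UNIV F" "\<And>t. frac (F t) = frac (g (frac t))"
    using assms by (auto simp: circle_lift_def)
  have per: "F (t + 1) - F t = F 1 - F 0" for t
    using continuous_Ints_constant[of UNIV "\<lambda>t. F (t + 1) - F t" t 0]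
    by (simp add: frac_eq_iff_diff_Ints[symmetric] F(2) frac_1_eq continuous_on_diff F(1)
        continuous_on_compose2[OF F(1)] continuous_intros)
  have "F 1 - F 0 \<in> \<int>" unfolding frac_eq_iff_diff_Ints[symmetric] F(2) by (simp add: frac_def)
  then obtain n where n: "F 1 - F 0 = of_int n" by (auto elim: Ints_cases)
  have "circle_degree g = n"
    unfolding circle_degree_def
  proof (rule the_equality)
    show "\<exists>F. circle_lift g F \<and> F 1 - F 0 = of_int n" using assms n by blast
    fix m assume "\<exists>F. circle_lift g F \<and> F 1 - F 0 = of_int m"
    then obtain F' where F': "circle_lift g F'" "F' 1 - F' 0 = of_int m" by blast
    then have c: "continuous_on UNIV F'" "\<And>t. frac (F' t) = frac (g (frac t))"
      by (auto simp: circle_lift_def)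
    have "F' 1 - F 1 = F' 0 - F 0"
      using continuous_Ints_constant[of UNIV "\<lambda>t. F' t - F t" 1 0]
      by (simp add: frac_eq_iff_diff_Ints[symmetric] F(2) c(2) continuous_on_diff F(1) c(1))
    then have "real_of_int m = of_int n" using n F'(2) by linarith
    then show "m = n" by simp
  qed
  then show ?thesis using per[of t] n by simp
qed

lemma circle_lift_diff:
  assumes F: "circle_lift g F"
    and g: "\<And>a b. tdist (g (frac a)) (g (frac b)) \<le> L * tdist a b" and L: "0 \<le> L"
    and s: "0 \<le> s" "L * s < 1 / 4"
  shows "crep (g (frac (t + s)) - g (frac t)) = F (t + s) - F t"
proof (rule crep_eqI)
  have c: "continuous_on UNIV F" and fr: "\<And>t. frac (F t) = frac (g (frac t))"
    using F by (auto simp: circle_lift_def)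
  have int: "g (frac u) - F u \<in> \<int>" for u
    unfolding frac_eq_iff_diff_Ints[symmetric] fr ..
  show "g (frac (t + s)) - g (frac t) - (F (t + s) - F t) \<in> \<int>"
    using Ints_diff[OF int[of "t + s"] int[of t]] by (simp add: algebra_simps)
  show "\<bar>F (t + s) - F t\<bar> < 1 / 2"
  proof (rule ccontr)
    assume ge: "\<not> ?thesis"
    have "continuous_on {0..s} (\<lambda>r. \<bar>F (t + r) - F t\<bar>)"
      by (auto intro!: continuous_intros continuous_on_compose2[OF c])
    \<comment> \<open>On its way from 0 the increment of the lift has absolute value exactly 1/2
      somewhere in [0, s]. The distance mod 1 is 1/2 there, while the Lipschitz bound leaves less
      than 1/4.\<close>
    then obtain r where r: "0 \<le> r" "r \<le> s" "\<bar>F (t + r) - F t\<bar> = 1 / 2"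
      using IVT'[of "\<lambda>r. \<bar>F (t + r) - F t\<bar>" 0 "1/2" s] s ge by auto
    then have half: "F (t + r) - F t = 1 / 2 \<or> F (t + r) - F t = - (1 / 2)" by linarith
    have f1: "frac (1/2::real) = 1/2" by (simp add: frac_eq)
    have f2: "frac (- (1/2)::real) = 1/2" by (subst frac_unique_iff) auto
    have "tdist (F (t + r)) (F t) = 1 / 2"
      using half by (auto simp: tdist_def f1 f2)
    moreover have "tdist (F (t + r)) (F t) = tdist (g (frac (t + r))) (g (frac t))"
      using Ints_diff[OF int[of t] int[of "t + r"]] by (intro tdist_cong) (simp add: algebra_simps)
    moreover have "\<dots> \<le> L * tdist (t + r) t" by (rule g)
    moreover have "\<dots> \<le> L * s"
      using tdist_le_abs[of "t + r" t] r L by (intro mult_left_mono) auto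
    ultimately show False using s by linarith
  qed
qed

lemma integral_unit_lborel:
  fixes h :: "real \<Rightarrow> real"
  assumes "continuous_on UNIV h"
  shows "(\<integral>t. h t \<partial>unit_lborel) = integral {0..1} h"
proof -
  have "(\<integral>t. h t \<partial>unit_lborel) = (\<integral>t. indicator {0..<1} t *\<^sub>R h t \<partial>lborel)"
    by (rule integral_restrict_space) simp
  also have "\<dots> = (\<integral>t. indicator {0..1} t *\<^sub>R h t \<partial>lborel)"
  proof (rule integral_cong_AE)
    have hm: "h \<in> borel_measurable borel" by (rule borel_measurable_continuous_onI[OF assms])
    show "(\<lambda>t. indicator {0..<1} t *\<^sub>R h t) \<in> borel_measurable lborel"
      "(\<lambda>t. indicator {0..1} t *\<^sub>R h t) \<in> borel_measurable lborel"
      using hm by measurable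
    show "AE t in lborel. indicator {0..<1} t *\<^sub>R h t = indicator {0..1} t *\<^sub>R h t"
      using AE_lborel_singleton[of 1] by eventually_elim (auto simp: indicator_def)
  qed
  also have "\<dots> = (LINT t : {0..1} | lborel. h t)" by (simp add: set_lebesgue_integral_def)
  also have "\<dots> = integral {0..1} h"
    by (rule set_borel_integral_eq_integral(2), rule borel_integrable_atLeastAtMost', rule continuous_on_subset[OF assms]) simp
  finally show ?thesis .
qed

text \<open>Moving the window of integration from [0, 1] to [s, 1 + s] exchanges the piece over
  [0, s] for the piece over [1, 1 + s], and there the lift is larger by exactly the degree.\<close>

lemma mean_increment:
  assumes g: "\<And>a b. tdist (g (frac a)) (g (frac b)) \<le> L * tdist a b" and L: "0 \<le> L"
    and s: "0 \<le> s" "L * s < 1 / 4"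
  shows "(\<integral>t. crep (g (frac (t + s)) - g (frac t)) \<partial>unit_lborel) = s * of_int (circle_degree g)"
proof -
  obtain F where F: "circle_lift g F" using circle_lift_exists[OF g L] by blast
  then have c: "continuous_on UNIV F" by (simp add: circle_lift_def)
  have cs: "continuous_on S (\<lambda>t. F (t + a))" for S a
    by (rule continuous_on_compose2[OF c]) (auto intro: continuous_intros)
  have cF: "continuous_on S F" for S by (rule continuous_on_subset[OF c]) simp
  have int: "F integrable_on {a..b}" "(\<lambda>t. F (t + e)) integrable_on {a..b}" for a b e
    by (auto intro: integrable_continuous_real cF cs)
  have sh: "integral {a..b} (\<lambda>t. F (t + e)) = integral {a+e..b+e} F" for a b e
    using integral_shift_Icc_real[of a b F e] by (simp add: comp_def add.commute)
  have "(\<integral>t. crep (g (frac (t + s)) - g (frac t)) \<partial>unit_lborel) = (\<integral>t. F (t + s) - F t \<partial>unit_lborel)"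
    by (simp add: circle_lift_diff[OF F g L s])
  also have "\<dots> = integral {0..1} (\<lambda>t. F (t + s) - F t)"
    by (intro integral_unit_lborel continuous_on_diff cs c)
  also have "\<dots> = integral {0..1} (\<lambda>t. F (t + s)) - integral {0..1} F"
    by (intro integral_diff int)
  also have "integral {0..1} (\<lambda>t. F (t + s)) = integral {s..1+s} F" by (simp add: sh)
  also have "integral {s..1+s} F - integral {0..1} F = integral {1..1+s} F - integral {0..s} F"
    using Henstock_Kurzweil_Integration.integral_combine[of 0 s "1+s" F]
      Henstock_Kurzweil_Integration.integral_combine[of 0 1 "1+s" F] s int by simp
  also have "integral {1..1+s} F = integral {0..s} (\<lambda>t. F (t + 1))" by (simp add: sh add.commute)
  also have "\<dots> - integral {0..s} F = integral {0..s} (\<lambda>t. F (t + 1) - F t)"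
    by (intro integral_diff[symmetric] int)
  also have "\<dots> = s * of_int (circle_degree g)"
    using s by (simp add: circle_lift_period[OF F])
  finally show ?thesis .
qed

lemma update_in_torus:
  "x \<in> torus k \<Longrightarrow> i < k \<Longrightarrow> 0 \<le> t \<Longrightarrow> t < 1 \<Longrightarrow> x(i := t) \<in> torus k"
  by (auto simp: in_torus_space_iff extensional_def)

lemma tdistn_update_le: "tdistn k (x(i := t)) (y(i := t)) \<le> tdistn k x y"
  by (subst tdistn_le_iff) (auto intro: tdist_le_tdistn)

lemma torus_lip_unit_integrable:
  assumes "torus_lip k L h" "x \<in> torus k" "i < k"
  shows "integrable unit_lborel (\<lambda>t. h (x(i := t)))"
proof -
  interpret U: prob_space unit_lborel by (rule prob_space_unit)
  obtain C where C: "\<And>x. x \<in> torus k \<Longrightarrow> \<bar>h x\<bar> \<le> C" using torus_lip_bounded[OF assms(1)] by blast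
  have "(\<lambda>t. x(i := t)) \<in> measurable unit_lborel (torus_space k)"
    using assms(2,3)
    by (intro measurable_torus_spaceI)
       (auto simp: space_restrict_space intro!: update_in_torus measurable_restrict_space1)
  then have "(\<lambda>t. h (x(i := t))) \<in> borel_measurable unit_lborel"
    by (rule measurable_compose[OF _ torus_lip_measurable[OF assms(1)]])
  then show ?thesis
    using assms
    by (intro U.integrable_const_bound[where B=C]) (auto simp: space_restrict_space intro!: C update_in_torus AE_I2)
qed

context skew_product
begin

lemma incr_mean_degree:
  assumes k: "1 \<le> k" and L: "circle_lip k L (f k)"
    and x: "x \<in> torus k" and s: "0 \<le> s" "L * s < 1 / 4"
  shows "(\<integral>t. incr k s (x(k - 1 := t)) \<partial>unit_lborel) = s * of_int (circle_degree (\<lambda>t. f k (x(k - 1 := t))))"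
proof -
  define g where "g t = f k (x(k - 1 := t))" for t
  have L0: "0 \<le> L" using L by (simp add: circle_lip_def)
  have up: "x(k - 1 := frac a) \<in> torus k" for a
    using x k by (intro update_in_torus) (auto simp: frac_lt_1)
  have g: "tdist (g (frac a)) (g (frac b)) \<le> L * tdist a b" for a b
  proof -
    have "tdist (g (frac a)) (g (frac b)) \<le> L * tdistn k (x(k - 1 := frac a)) (x(k - 1 := frac b))"
      unfolding g_def by (rule circle_lipD[OF L up up])
    also have "\<dots> \<le> L * tdist a b"
      using L0 by (intro mult_left_mono) (auto simp: tdistn_le_iff)
    finally show ?thesis .
  qed
  have "(\<integral>t. incr k s (x(k - 1 := t)) \<partial>unit_lborel) = (\<integral>t. crep (g (frac (t + s)) - g (frac t)) \<partial>unit_lborel)"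
    by (rule Bochner_Integration.integral_cong)
       (auto simp: incr_def g_def vert_rot_def space_restrict_space frac_eq)
  also have "\<dots> = s * of_int (circle_degree g)" by (rule mean_increment[OF g L0 s])
  finally show ?thesis unfolding g_def[abs_def] .
qed

text \<open>One constant D for all base points: s times the degree is the vertical mean of
  \<open>incr k s\<close>, hence Lipschitz in x. The degree is therefore continuous along paths, and
  being an integer it is constant.\<close>

lemma incr_mean:
  assumes k: "1 \<le> k" and L: "circle_lip k L (f k)"
    and deg: "\<And>x. x \<in> torus_pts (k - 1) \<Longrightarrow> circle_degree (\<lambda>t. f k (x(k - 1 := t))) \<noteq> 0"
  obtains D where "D \<noteq> 0" "\<And>s x. x \<in> torus k \<Longrightarrow> 0 \<le> s \<Longrightarrow> L * s < 1 / 4 \<Longrightarrow>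
    (\<integral>t. incr k s (x(k - 1 := t)) \<partial>unit_lborel) = s * D"
proof -
  define D where "D x = real_of_int (circle_degree (\<lambda>t. f k (x(k - 1 := t))))" for x
  have L0: "0 \<le> L" using L by (simp add: circle_lip_def)
  \<comment> \<open>Any fixed positive step with L s < 1/4 would do to carry the Lipschitz bound
    from the increment over to D; L + 1 avoids division by 0.\<close>
  define s where "s = 1 / (8 * (L + 1))"
  have s: "0 < s" "L * s < 1 / 4" "L * \<bar>s\<bar> < 1 / 4"
    using L0 by (auto simp: s_def field_simps)
  have mean: "(\<integral>t. incr k s (x(k - 1 := t)) \<partial>unit_lborel) = s * D x"
    if "x \<in> torus k" "0 \<le> s" "L * s < 1 / 4" for x s
    unfolding D_def by (rule incr_mean_degree[OF k L that])
  note lip = incr_torus_lip[OF L k s(3)]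
  have Dlip: "\<bar>D x - D y\<bar> \<le> 2 * L / s * tdistn k x y"
    if x: "x \<in> torus k" and y: "y \<in> torus k" for x y
  proof -
    interpret U: prob_space unit_lborel by (rule prob_space_unit)
    have i: "integrable unit_lborel (\<lambda>t. incr k s (x(k - 1 := t)))" "integrable unit_lborel (\<lambda>t. incr k s (y(k - 1 := t)))"
      using k x y by (auto intro!: torus_lip_unit_integrable[OF lip])
    have "s * \<bar>D x - D y\<bar> = \<bar>s * D x - s * D y\<bar>"
      using s by (simp add: abs_mult right_diff_distrib[symmetric])
    also have "\<dots> = \<bar>\<integral>t. incr k s (x(k - 1 := t)) - incr k s (y(k - 1 := t)) \<partial>unit_lborel\<bar>"
      unfolding Bochner_Integration.integral_diff[OF i] mean[OF x less_imp_le[OF s(1)] s(2)]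
        mean[OF y less_imp_le[OF s(1)] s(2)] ..
    also have "\<dots> \<le> (\<integral>t. \<bar>incr k s (x(k - 1 := t)) - incr k s (y(k - 1 := t))\<bar> \<partial>unit_lborel)"
      by (rule integral_abs_bound)
    also have "\<dots> \<le> (\<integral>t. 2 * L * tdistn k x y \<partial>unit_lborel)"
    proof (rule integral_mono)
      fix t assume "t \<in> space unit_lborel"
      then have t: "0 \<le> t" "t < 1" by (auto simp: space_restrict_space)
      have "\<bar>incr k s (x(k - 1 := t)) - incr k s (y(k - 1 := t))\<bar> \<le> 2 * L * tdistn k (x(k - 1 := t)) (y(k - 1 := t))"
        using t k x y by (intro torus_lipD[OF lip] update_in_torus) auto
      also have "\<dots> \<le> 2 * L * tdistn k x y" using L0 by (intro mult_left_mono tdistn_update_le) auto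
      finally show "\<bar>incr k s (x(k - 1 := t)) - incr k s (y(k - 1 := t))\<bar> \<le> 2 * L * tdistn k x y" .
    qed (use i in auto)
    also have "\<dots> = 2 * L * tdistn k x y" using U.prob_space by simp
    finally show ?thesis using s by (simp add: field_simps)
  qed
  \<comment> \<open>The straight path inside [0, 1)^k from the origin (\<theta> = 0) to x (\<theta>
    = 1).\<close>
  define z :: "(nat \<Rightarrow> real) \<Rightarrow> real \<Rightarrow> nat \<Rightarrow> real" where "z x \<theta> = (\<lambda>i\<in>{..<k}. \<theta> * x i)" for x \<theta>
  have z: "z x \<theta> \<in> torus k" if "x \<in> torus k" "0 \<le> \<theta>" "\<theta> \<le> 1" for x \<theta>
    using that mult_le_less_imp_less[of \<theta> 1] by (auto simp: in_torus_space_iff z_def)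
      (metis mult.left_neutral mult_left_le_one_le order_le_less_trans)
  have Dconst: "D x = D (z x 0)" if x: "x \<in> torus k" for x
  proof -
    have "continuous_on {0..1} (\<lambda>\<theta>. D (z x \<theta>))"
    proof (rule lipschitz_on_continuous_on)
      show "(2 * L / s)-lipschitz_on {0..1} (\<lambda>\<theta>. D (z x \<theta>))"
      proof (rule lipschitz_onI)
        fix a b :: real assume ab: "a \<in> {0..1}" "b \<in> {0..1}"
        have "tdistn k (z x a) (z x b) \<le> \<bar>a - b\<bar>"
        proof (subst tdistn_le_iff)
          show "\<forall>i<k. tdist (z x a i) (z x b i) \<le> \<bar>a - b\<bar>"
          proof (intro allI impI)
            fix i assume i: "i < k"
            have "tdist (z x a i) (z x b i) \<le> \<bar>a * x i - b * x i\<bar>"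
              using tdist_le_abs[of "z x a i" "z x b i"] i by (simp add: z_def)
            also have "\<dots> = \<bar>a - b\<bar> * x i"
              using x i by (simp add: in_torus_space_iff left_diff_distrib[symmetric] abs_mult)
            also have "\<dots> \<le> \<bar>a - b\<bar> * 1"
              using x i by (intro mult_left_mono) (auto simp: in_torus_space_iff less_imp_le)
            finally show "tdist (z x a i) (z x b i) \<le> \<bar>a - b\<bar>" by simp
          qed
        qed simp
        then have "2 * L / s * tdistn k (z x a) (z x b) \<le> 2 * L / s * \<bar>a - b\<bar>"
          using s L0 by (intro mult_left_mono) auto
        with Dlip[OF z[OF x] z[OF x], of a b] ab
        show "dist (D (z x a)) (D (z x b)) \<le> 2 * L / s * dist a b" by (auto simp: dist_real_def)
      qed (use s L0 in auto)
    qed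
    then have "D (z x 1) = D (z x 0)"
      by (rule continuous_Ints_constant[rotated]) (auto simp: D_def)
    moreover have "z x 1 = x" using x by (auto simp: z_def in_torus_space_iff fun_eq_iff extensional_def)
    ultimately show ?thesis by simp
  qed
  define D0 where "D0 = D (\<lambda>i\<in>{..<k}. 0)"
  have "z x 0 = (\<lambda>i\<in>{..<k}. 0)" for x by (auto simp: z_def fun_eq_iff)
  then have D0: "D x = D0" if "x \<in> torus k" for x using Dconst[OF that] by (simp add: D0_def)
  show thesis
  proof (rule that[of D0])
    have "(\<lambda>i\<in>{..<k}. 0) \<in> torus_pts (k - 1)" by (auto simp: torus_pts_def)
    from deg[OF this] show "D0 \<noteq> 0" unfolding D0_def D_def by simp
  qed (use mean D0 in metis)
qed

end

subsection \<open>Averages of the increments\<close>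

lemma haar_integrable_bounded:
  fixes g :: "_ \<Rightarrow> real"
  assumes "g \<in> borel_measurable (torus_space k)" "\<And>x. x \<in> torus k \<Longrightarrow> \<bar>g x\<bar> \<le> C"
  shows "integrable (haar_torus k) g"
proof -
  interpret prob_space "haar_torus k" by (rule prob_space_haar_torus)
  show ?thesis using assms
    by (intro integrable_const_bound[where B=C]) (auto simp: measurable_haar_iff intro!: AE_I2)
qed

lemma haar_integral_le_const:
  fixes g :: "_ \<Rightarrow> real"
  assumes "integrable (haar_torus k) g" "\<And>x. x \<in> torus k \<Longrightarrow> g x \<le> C"
  shows "(\<integral>x. g x \<partial>haar_torus k) \<le> C"
proof -
  interpret prob_space "haar_torus k" by (rule prob_space_haar_torus)
  show ?thesis using assms by (intro integral_le_const) (auto intro!: AE_I2)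
qed

text \<open>A form of Cauchy-Schwarz, obtained by integrating the inequality between \<bar>g\<bar>
  and its square that comes from (\<bar>g\<bar> - \<eta>)^2 being nonnegative.\<close>

lemma (in prob_space) integral_abs_le_of_square:
  fixes g :: "_ \<Rightarrow> real"
  assumes "integrable M g" "integrable M (\<lambda>x. (g x)\<^sup>2)" "0 < \<eta>" "(\<integral>x. (g x)\<^sup>2 \<partial>M) \<le> \<eta>\<^sup>2"
  shows "(\<integral>x. \<bar>g x\<bar> \<partial>M) \<le> \<eta>"
proof -
  have "(\<integral>x. \<bar>g x\<bar> \<partial>M) \<le> (\<integral>x. (g x)\<^sup>2 / (2 * \<eta>) + \<eta> / 2 \<partial>M)"
  proof (rule integral_mono)
    fix x
    have "0 \<le> (\<bar>g x\<bar> - \<eta>)\<^sup>2" by simp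
    then have "2 * \<bar>g x\<bar> * \<eta> \<le> (g x)\<^sup>2 + \<eta>\<^sup>2" by (simp add: power2_diff)
    then show "\<bar>g x\<bar> \<le> (g x)\<^sup>2 / (2 * \<eta>) + \<eta> / 2"
      using assms(3) by (simp add: field_simps power2_eq_square)
  qed (use assms in auto)
  also have "\<dots> = (\<integral>x. (g x)\<^sup>2 \<partial>M) / (2 * \<eta>) + \<eta> / 2"
    using assms by (simp add: prob_space)
  also have "\<dots> \<le> \<eta>\<^sup>2 / (2 * \<eta>) + \<eta> / 2"
    using assms by (intro add_mono divide_right_mono) auto
  also have "\<dots> = \<eta>" using assms by (simp add: power2_eq_square)
  finally show ?thesis .
qed

context skew_product
begin

text \<open>The mean square of the difference quotients of step s increases when the step is subdivided,
  and the increase measures the distance to the quotient of the coarser step. A coarse step that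
  nearly attains the supremum therefore controls all its subdivisions, which replaces
  differentiation of the Lipschitz function.\<close>
lemma quotient_approx:
  assumes k: "1 \<le> k" and L: "circle_lip k L (f k)" and \<eta>: "0 < \<eta>"
  obtains \<sigma> where "0 < \<sigma>" "L * \<sigma> < 1 / 4"
    "\<And>N. 1 \<le> N \<Longrightarrow> \<exists>r. (\<integral>x. \<bar>incr k (\<sigma> / real N) (vert_rot k r x) / (\<sigma> / real N) - incr k \<sigma> x / \<sigma>\<bar> \<partial>haar_torus k) \<le> \<eta>"
proof -
  interpret H: prob_space "haar_torus k" by (rule prob_space_haar_torus)
  have L0: "0 \<le> L" using L by (simp add: circle_lip_def)
  define s0 where "s0 = 1 / (8 * (L + 1))"
  have s0: "0 < s0" using L0 by (auto simp: s0_def)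
  have Ls0: "L * s < 1 / 4" if "0 < s" "s < s0" for s
  proof -
    have "L * s \<le> (L + 1) * s" using that by (simp add: algebra_simps)
    also have "\<dots> \<le> (L + 1) * s0" using that L0 by (intro mult_left_mono) auto
    also have "\<dots> = 1 / 8" using L0 by (simp add: s0_def)
    finally show ?thesis by simp
  qed
  define u where "u s x = incr k s x / s" for s x
  have um: "u s \<in> borel_measurable (torus_space k)" if "0 < s" "s < s0" for s
    using torus_lip_measurable[OF incr_torus_lip[OF L k, of s]] Ls0[OF that] that
    by (auto simp: u_def[abs_def])
  have ub: "\<bar>u s x\<bar> \<le> L" if "0 < s" "s < s0" "x \<in> torus k" for s x
    using incr_bound[OF L that(3) k, of s] that by (simp add: u_def field_simps)
  have rot: "vert_rot k r x \<in> torus k" if "x \<in> torus k" for r x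
    using that k by (intro vert_rot_in) auto
  have hp: "haar_preserving k (vert_rot k r)" for r
    using vert_rot_haar_preserving[of "k - 1" r] k by simp
  define I where "I s = (\<integral>x. (u s x)\<^sup>2 \<partial>haar_torus k)" for s
  have sq: "(u s x)\<^sup>2 \<le> L\<^sup>2" if "0 < s" "s < s0" "x \<in> torus k" for s x
    using ub[OF that] L0 by (simp add: abs_le_square_iff[symmetric])
  have usq_int: "integrable (haar_torus k) (\<lambda>x. (u s (vert_rot k r x))\<^sup>2)" if "0 < s" "s < s0" for s r
    by (rule haar_integrable_bounded[where C="L\<^sup>2"])
       (use that um[OF that] haar_preserving_measurable[OF hp[of r]] sq[OF that] rot in \<open>auto intro: measurable_compose\<close>)
  have usq_int0: "integrable (haar_torus k) (\<lambda>x. (u s x)\<^sup>2)" if "0 < s" "s < s0" for s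
    by (rule haar_integrable_bounded[where C="L\<^sup>2"])
       (use that um[OF that] sq[OF that] in auto)
  have Ile: "I s \<le> L\<^sup>2" if "0 < s" "s < s0" for s
    unfolding I_def using sq[OF that] usq_int0[OF that] by (rule haar_integral_le_const[rotated])
  define Q where "Q = Sup (I ` {0<..<s0})"
  have bdd: "bdd_above (I ` {0<..<s0})" using Ile by (auto intro!: bdd_aboveI)
  have "I ` {0<..<s0} \<noteq> {}" using s0 by auto
  moreover have "Q - \<eta>\<^sup>2 < Q" using \<eta> by simp
  ultimately obtain q where "q \<in> I ` {0<..<s0}" "Q - \<eta>\<^sup>2 < q"
    using less_cSupE[of "Q - \<eta>\<^sup>2" "I ` {0<..<s0}"] unfolding Q_def by metis
  then obtain \<sigma> where \<sigma>: "0 < \<sigma>" "\<sigma> < s0" "Q - \<eta>\<^sup>2 < I \<sigma>" by auto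
  show thesis
  proof (rule that[OF \<sigma>(1) Ls0[OF \<sigma>(1,2)]])
    fix N :: nat assume N: "1 \<le> N"
    define s where "s = \<sigma> / real N"
    have s: "0 < s" "s \<le> \<sigma>" using N \<sigma> by (auto simp: s_def field_simps)
    have s': "s < s0" using s \<sigma> by simp
    have Ns: "real N * s = \<sigma>" using N by (simp add: s_def)
    have "I s \<le> Q" unfolding Q_def using s s' by (intro cSup_upper bdd) auto
    then have Is: "I s < I \<sigma> + \<eta>\<^sup>2" using \<sigma> by simp
    have avg: "u \<sigma> x = (\<Sum>i<N. u s (vert_rot k (real i * s) x)) / N"
      if "x \<in> torus k" for x
    proof -
      have "incr k (real N * s) x = (\<Sum>i<N. incr k s (vert_rot k (real i * s) x))"
        using Ls0[OF \<sigma>(1,2)] s Ns by (intro incr_mult[OF L k that]) auto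
      then have "u \<sigma> x = (\<Sum>i<N. incr k s (vert_rot k (real i * s) x)) / s / N"
        unfolding u_def Ns[symmetric] by (simp add: mult.commute)
      then show ?thesis unfolding u_def by (simp only: sum_divide_distrib)
    qed
    let ?g = "\<lambda>i x. u s (vert_rot k (real i * s) x) - u \<sigma> x"
    have gm: "?g i \<in> borel_measurable (torus_space k)" for i
      using measurable_compose[OF haar_preserving_measurable[OF hp] um[OF s(1) s']] um[OF \<sigma>(1,2)] by measurable
    have gb: "\<bar>?g i x\<bar> \<le> 2 * L" if "x \<in> torus k" for i x
      using ub[OF s(1) s' rot[OF that, of "real i * s"]] ub[OF \<sigma>(1,2) that] by linarith
    have gint: "integrable (haar_torus k) (?g i)" for i
      by (rule haar_integrable_bounded[OF gm gb])
    have gint2: "integrable (haar_torus k) (\<lambda>x. (?g i x)\<^sup>2)" for i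
    proof (rule haar_integrable_bounded[where C="(2 * L)\<^sup>2"])
      show "(\<lambda>x. (?g i x)\<^sup>2) \<in> borel_measurable (torus_space k)"
        using gm[of i] by measurable
      show "\<bar>(?g i x)\<^sup>2\<bar> \<le> (2 * L)\<^sup>2" if "x \<in> torus k" for x
        using power_mono[OF gb[OF that, of i] abs_ge_zero, of 2] by simp
    qed
    \<comment> \<open>Variance identity: u \<sigma> is the mean of the N rotated copies of u s, so
      the integrated squared deviations add up to N (I s - I \<sigma>), which is below N times
      \<eta> squared. Some i has a deviation below the average, and r is the rotation belonging to
      it.\<close>
    have "(\<Sum>i<N. \<integral>x. (?g i x)\<^sup>2 \<partial>haar_torus k) = (\<integral>x. (\<Sum>i<N. (?g i x)\<^sup>2) \<partial>haar_torus k)"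
      using gint2 by (intro Bochner_Integration.integral_sum[symmetric])
    also have "\<dots> = (\<integral>x. (\<Sum>i<N. (u s (vert_rot k (real i * s) x))\<^sup>2) - N * (u \<sigma> x)\<^sup>2 \<partial>haar_torus k)"
    proof (rule Bochner_Integration.integral_cong)
      fix x assume "x \<in> space (haar_torus k)"
      then have a: "(\<Sum>i<N. u s (vert_rot k (real i * s) x)) = N * u \<sigma> x" using avg N by simp
      have "(\<Sum>i<N. (?g i x)\<^sup>2) = (\<Sum>i<N. (u s (vert_rot k (real i * s) x))\<^sup>2)
         - 2 * u \<sigma> x * (\<Sum>i<N. u s (vert_rot k (real i * s) x)) + N * (u \<sigma> x)\<^sup>2"
        by (simp add: power2_diff sum.distrib sum_subtractf sum_distrib_left algebra_simps)
      then show "(\<Sum>i<N. (?g i x)\<^sup>2) = (\<Sum>i<N. (u s (vert_rot k (real i * s) x))\<^sup>2) - N * (u \<sigma> x)\<^sup>2"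
        unfolding a by (simp add: power2_eq_square)
    qed simp
    also have "\<dots> = (\<Sum>i<N. \<integral>x. (u s (vert_rot k (real i * s) x))\<^sup>2 \<partial>haar_torus k) - N * I \<sigma>"
      using usq_int[OF s(1) s'] usq_int0[OF \<sigma>(1,2)] by (simp add: I_def)
    also have "\<dots> = (\<Sum>i<N. I s) - N * I \<sigma>"
    proof -
      have "(\<integral>x. (u s (vert_rot k r x))\<^sup>2 \<partial>haar_torus k) = I s" for r
        unfolding I_def using um[OF s(1) s']
        by (intro haar_preserving_integral[OF hp, of "\<lambda>x. (u s x)\<^sup>2"]) auto
      then show ?thesis by simp
    qed
    also have "\<dots> < (\<Sum>i<N. \<eta>\<^sup>2)"
    proof -
      have "real N * I s < real N * (I \<sigma> + \<eta>\<^sup>2)" using Is N by simp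
      then show ?thesis by (simp add: algebra_simps)
    qed
    finally obtain i where i: "(\<integral>x. (?g i x)\<^sup>2 \<partial>haar_torus k) < \<eta>\<^sup>2"
      by (meson not_less sum_mono)
    then have "(\<integral>x. \<bar>?g i x\<bar> \<partial>haar_torus k) \<le> \<eta>"
      using gint gint2 \<eta> by (intro H.integral_abs_le_of_square) auto
    then show "\<exists>r. (\<integral>x. \<bar>incr k (\<sigma> / real N) (vert_rot k r x) / (\<sigma> / real N) - incr k \<sigma> x / \<sigma>\<bar> \<partial>haar_torus k) \<le> \<eta>"
      unfolding u_def s_def by blast
  qed
qed

text \<open>The statement carried through the induction on the dimension. Zero mean on every
  vertical circle is the property that \<open>incr k \<sigma> / \<sigma> - D\<close> has, so nothing
  is demanded of functions of the first k - 1 coordinates.\<close>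

definition vert_ergodic :: "nat \<Rightarrow> bool" where
  "vert_ergodic k \<longleftrightarrow> (\<forall>L h. torus_lip k L h \<longrightarrow>
     (\<forall>x\<in>torus k. (\<integral>t. h (x(k - 1 := t)) \<partial>unit_lborel) = 0) \<longrightarrow>
     (\<lambda>n. \<integral>x. \<bar>(\<Sum>j<n. h ((T k ^^ j) x)) / n\<bar> \<partial>haar_torus k) \<longlonglongrightarrow> 0)"

text \<open>The threshold for n does not depend on N, because N will grow with n. Ergodicity is
  applied once, to the quotient of the coarse step \<sigma>; \<open>quotient_approx\<close> passes
  to every finer step with an error that does not increase along orbits, since T preserves Haar
  measure.\<close>

lemma incr_average:
  assumes k: "1 \<le> k" "k < d" and L: "circle_lip k L (f k)" and erg: "vert_ergodic k" and \<eta>: "0 < \<eta>"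
    and mean: "\<And>s x. x \<in> torus k \<Longrightarrow> 0 \<le> s \<Longrightarrow> L * s < 1 / 4 \<Longrightarrow>
      (\<integral>t. incr k s (x(k - 1 := t)) \<partial>unit_lborel) = s * D"
  obtains \<sigma> n0 where "0 < \<sigma>" "L * \<sigma> < 1 / 4"
    "\<And>n N. n0 \<le> n \<Longrightarrow> 1 \<le> N \<Longrightarrow>
       (\<integral>x. \<bar>(\<Sum>j<n. incr k (\<sigma> / real N) ((T k ^^ j) x)) / n / (\<sigma> / real N) - D\<bar> \<partial>haar_torus k) \<le> \<eta>"
proof -
  have "0 < \<eta> / 2" using \<eta> by simp
  from quotient_approx[OF k(1) L this] obtain \<sigma> where \<sigma>: "0 < \<sigma>" "L * \<sigma> < 1 / 4" and
    app: "\<And>N. 1 \<le> N \<Longrightarrow> \<exists>r. (\<integral>x. \<bar>incr k (\<sigma> / real N) (vert_rot k r x) / (\<sigma> / real N) - incr k \<sigma> x / \<sigma>\<bar> \<partial>haar_torus k) \<le> \<eta> / 2"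
    by blast
  interpret U: prob_space unit_lborel by (rule prob_space_unit)
  have L0: "0 \<le> L" using L by (simp add: circle_lip_def)
  have lip\<sigma>: "torus_lip k (2 * L) (incr k \<sigma>)" using \<sigma> by (intro incr_torus_lip[OF L k(1)]) auto
  have T: "haar_preserving k (T k ^^ j)" for j using k by (intro T_funpow_haar_preserving) auto
  define h where "h x = incr k \<sigma> x / \<sigma> - D" for x
  obtain L' where "torus_lip k L' (\<lambda>x. (1 / \<sigma>) * incr k \<sigma> x)"
    using torus_lip_mult[OF torus_lip_const[of k "1 / \<sigma>"] lip\<sigma>] by blast
  from torus_lip_add[OF this torus_lip_const[of k "- D"]] have hlip: "torus_lip k L' h"
    by (simp add: h_def[abs_def])
  have h0: "(\<integral>t. h (x(k - 1 := t)) \<partial>unit_lborel) = 0" if x: "x \<in> torus k" for x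
  proof -
    have "integrable unit_lborel (\<lambda>t. incr k \<sigma> (x(k - 1 := t)))"
      using k by (intro torus_lip_unit_integrable[OF lip\<sigma> x]) auto
    then show ?thesis using mean[OF x, of \<sigma>] \<sigma> U.prob_space unfolding h_def by simp
  qed
  have "(\<lambda>n. \<integral>x. \<bar>(\<Sum>j<n. h ((T k ^^ j) x)) / n\<bar> \<partial>haar_torus k) \<longlonglongrightarrow> 0"
    using erg hlip h0 unfolding vert_ergodic_def by blast
  then have "eventually (\<lambda>n. (\<integral>x. \<bar>(\<Sum>j<n. h ((T k ^^ j) x)) / n\<bar> \<partial>haar_torus k) < \<eta> / 2) sequentially"
    using \<eta> by (auto dest: order_tendstoD(2)[where a="\<eta> / 2"])
  then obtain n1 where n1: "\<And>n. n1 \<le> n \<Longrightarrow> (\<integral>x. \<bar>(\<Sum>j<n. h ((T k ^^ j) x)) / n\<bar> \<partial>haar_torus k) < \<eta> / 2"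
    by (auto simp: eventually_sequentially)
  show thesis
  proof (rule that[OF \<sigma>, of "max n1 1"])
    fix n N :: nat assume n: "max n1 1 \<le> n" and N: "1 \<le> N"
    define s where "s = \<sigma> / real N"
    have s: "0 < s" "s \<le> \<sigma>" using N \<sigma> by (auto simp: s_def field_simps)
    have "L * s \<le> L * \<sigma>" using s L0 by (intro mult_left_mono) auto
    then have Ls: "L * \<bar>s\<bar> < 1 / 4" using \<sigma> s by simp
    have lips: "torus_lip k (2 * L) (incr k s)" by (rule incr_torus_lip[OF L k(1) Ls])
    note ms = torus_lip_measurable[OF lips] and mh = torus_lip_measurable[OF hlip]
    obtain r where r: "(\<integral>x. \<bar>incr k s (vert_rot k r x) / s - incr k \<sigma> x / \<sigma>\<bar> \<partial>haar_torus k) \<le> \<eta> / 2"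
      using app[OF N] unfolding s_def by blast
    have hp: "haar_preserving k (vert_rot k r)"
      using vert_rot_haar_preserving[of "k - 1" r] k by simp
    define w where "w x = incr k s (vert_rot k r x) / s - incr k \<sigma> x / \<sigma>" for x
    obtain L'' where "torus_lip k L'' (\<lambda>x. (1 / s) * incr k s (vert_rot k r x))"
      using torus_lip_mult[OF torus_lip_const[of k "1 / s"] torus_lip_vert_rot[OF lips k(1) order_refl]] by blast
    moreover obtain L3 where "torus_lip k L3 (\<lambda>x. (- 1 / \<sigma>) * incr k \<sigma> x)"
      using torus_lip_mult[OF torus_lip_const[of k "- 1 / \<sigma>"] lip\<sigma>] by blast
    ultimately have wlip: "torus_lip k (L'' + L3) w"
      using torus_lip_add by (fastforce simp: w_def[abs_def])
    note mw = torus_lip_measurable[OF wlip]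
    obtain Cw where Cw: "\<And>x. x \<in> torus k \<Longrightarrow> \<bar>w x\<bar> \<le> Cw" using torus_lip_bounded[OF wlip] by blast
    obtain Ch where Ch: "\<And>x. x \<in> torus k \<Longrightarrow> \<bar>h x\<bar> \<le> Ch" using torus_lip_bounded[OF hlip] by blast
    have Tin: "(T k ^^ j) x \<in> torus k" if "x \<in> torus k" for j x
      by (rule haar_preserving_in[OF T that])
    note mT = haar_preserving_measurable[OF T]
    have iw: "integrable (haar_torus k) (\<lambda>x. \<bar>w ((T k ^^ j) x)\<bar>)" for j
      using measurable_compose[OF mT mw] Tin Cw by (intro haar_integrable_bounded[where C=Cw]) auto
    have ih: "integrable (haar_torus k) (\<lambda>x. h ((T k ^^ j) x))" for j
      using measurable_compose[OF mT mh] Tin Ch by (intro haar_integrable_bounded[where C=Ch]) auto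
    define B where "B x = \<bar>(\<Sum>j<n. incr k s ((T k ^^ j) x)) / n / s - D\<bar>" for x
    have mB: "B \<in> borel_measurable (torus_space k)"
      unfolding B_def[abs_def] using measurable_compose[OF mT ms] by measurable
    \<comment> \<open>T commutes with the rotation by r, so at the rotated point each quotient minus
      D is w + h: w compares the fine quotient with the coarse one, and h is the coarse one minus
      its vertical mean. The rotation is undone afterwards by invariance of Haar measure.\<close>
    have le: "B (vert_rot k r x) \<le> (\<Sum>j<n. \<bar>w ((T k ^^ j) x)\<bar>) / n + \<bar>(\<Sum>j<n. h ((T k ^^ j) x)) / n\<bar>" for x
    proof -
      have n0: "n \<noteq> 0" using n by simp
      have "(\<Sum>j<n. incr k s ((T k ^^ j) (vert_rot k r x))) / n / s - D
         = (\<Sum>j<n. incr k s (vert_rot k r ((T k ^^ j) x)) / s - D) / n"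
        using n0 k by (simp add: T_funpow_vert_rot sum_subtractf sum_divide_distrib[symmetric] field_simps)
      also have "\<dots> = (\<Sum>j<n. w ((T k ^^ j) x) + h ((T k ^^ j) x)) / n"
        by (simp add: w_def h_def)
      also have "\<dots> = (\<Sum>j<n. w ((T k ^^ j) x)) / n + (\<Sum>j<n. h ((T k ^^ j) x)) / n"
        by (simp add: sum.distrib add_divide_distrib)
      finally have "B (vert_rot k r x) \<le> \<bar>(\<Sum>j<n. w ((T k ^^ j) x)) / n\<bar> + \<bar>(\<Sum>j<n. h ((T k ^^ j) x)) / n\<bar>"
        unfolding B_def by (simp only: abs_triangle_ineq)
      also have "\<bar>(\<Sum>j<n. w ((T k ^^ j) x)) / n\<bar> \<le> (\<Sum>j<n. \<bar>w ((T k ^^ j) x)\<bar>) / n"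
        by (simp add: divide_right_mono)
      finally show ?thesis by simp
    qed
    have "(\<integral>x. B x \<partial>haar_torus k) = (\<integral>x. B (vert_rot k r x) \<partial>haar_torus k)"
      by (rule haar_preserving_integral[OF hp mB, symmetric])
    also have "\<dots> \<le> (\<integral>x. (\<Sum>j<n. \<bar>w ((T k ^^ j) x)\<bar>) / n + \<bar>(\<Sum>j<n. h ((T k ^^ j) x)) / n\<bar> \<partial>haar_torus k)"
    proof (rule integral_mono_AE')
      show "integrable (haar_torus k) (\<lambda>x. (\<Sum>j<n. \<bar>w ((T k ^^ j) x)\<bar>) / n + \<bar>(\<Sum>j<n. h ((T k ^^ j) x)) / n\<bar>)"
        using iw ih by auto
    qed (use le in \<open>auto simp: B_def\<close>)
    also have "\<dots> = (\<Sum>j<n. (\<integral>x. \<bar>w ((T k ^^ j) x)\<bar> \<partial>haar_torus k)) / n + (\<integral>x. \<bar>(\<Sum>j<n. h ((T k ^^ j) x)) / n\<bar> \<partial>haar_torus k)"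
      using iw ih by (subst Bochner_Integration.integral_add) auto
    also have "(\<Sum>j<n. (\<integral>x. \<bar>w ((T k ^^ j) x)\<bar> \<partial>haar_torus k)) = (\<Sum>j<n. (\<integral>x. \<bar>w x\<bar> \<partial>haar_torus k))"
      using mw by (intro sum.cong refl haar_preserving_integral[OF T, of "\<lambda>x. \<bar>w x\<bar>"]) auto
    also have "\<dots> / n = (\<integral>x. \<bar>w x\<bar> \<partial>haar_torus k)" using n by simp
    also have "\<dots> + (\<integral>x. \<bar>(\<Sum>j<n. h ((T k ^^ j) x)) / n\<bar> \<partial>haar_torus k) \<le> \<eta> / 2 + \<eta> / 2"
      using r n1[of n] n unfolding w_def by (intro add_mono) auto
    finally show "(\<integral>x. \<bar>(\<Sum>j<n. incr k (\<sigma> / real N) ((T k ^^ j) x)) / n / (\<sigma> / real N) - D\<bar> \<partial>haar_torus k) \<le> \<eta>"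
      unfolding B_def s_def by simp
  qed
qed

end

subsection \<open>Lipschitz functions determine limits and measures\<close>

text \<open>A Lipschitz approximation of the indicator of [0, b) on the circle. The first summand
  tends to the indicator of the open arc (0, b), the second to that of the point 0; for small M both
  can be positive at once, hence the bound 2 in place of 1.\<close>

definition arc_bump :: "real \<Rightarrow> nat \<Rightarrow> real \<Rightarrow> real" where
  "arc_bump b M x = (if b \<le> 0 then 0
     else min 1 (max 0 (M * (b / 2 - tdist x (b / 2)))) + max 0 (1 - M * tdist x 0))"

lemma arc_bump_bounds: "0 \<le> arc_bump b M x" "arc_bump b M x \<le> 2"
proof -
  have "max 0 (1 - M * tdist x 0) \<le> 1" by simp
  moreover have "min 1 (max 0 (M * (b / 2 - tdist x (b / 2)))) \<le> 1" by simp
  ultimately have "min 1 (max 0 (M * (b / 2 - tdist x (b / 2)))) + max 0 (1 - M * tdist x 0) \<le> 2" by linarith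
  then show "arc_bump b M x \<le> 2" unfolding arc_bump_def by (cases "b \<le> 0") auto
  show "0 \<le> arc_bump b M x" unfolding arc_bump_def by auto
qed

lemma arc_bump_lip: "\<bar>arc_bump b M x - arc_bump b M y\<bar> \<le> 2 * M * tdist x y"
proof (cases "b \<le> 0")
  case False
  have 1: "\<bar>min 1 (max 0 u) - min 1 (max 0 v)\<bar> \<le> \<bar>u - v\<bar>" for u v :: real by (auto simp: min_def max_def)
  have 2: "\<bar>max 0 u - max 0 v\<bar> \<le> \<bar>u - v\<bar>" for u v :: real by (auto simp: max_def)
  have 3: "\<bar>M * (b / 2 - tdist x (b / 2)) - M * (b / 2 - tdist y (b / 2))\<bar> \<le> M * tdist x y"
    using mult_left_mono[OF abs_tdist_diff_le[of y "b/2" x], of "real M"]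
    by (simp add: right_diff_distrib[symmetric] abs_mult tdist_commute)
  have 4: "\<bar>(1 - M * tdist x 0) - (1 - M * tdist y 0)\<bar> \<le> M * tdist x y"
    using mult_left_mono[OF abs_tdist_diff_le[of y 0 x], of "real M"]
    by (simp add: right_diff_distrib[symmetric] abs_mult tdist_commute)
  have "arc_bump b M x = min 1 (max 0 (M * (b / 2 - tdist x (b / 2)))) + max 0 (1 - M * tdist x 0)"
    "arc_bump b M y = min 1 (max 0 (M * (b / 2 - tdist y (b / 2)))) + max 0 (1 - M * tdist y 0)"
    using False by (simp_all add: arc_bump_def)
  then show ?thesis
    using order_trans[OF 1 3] order_trans[OF 2 4] by linarith
qed (simp add: arc_bump_def)

lemma real_mult_pos_eventually_ge:
  fixes c :: real assumes "0 < c" shows "eventually (\<lambda>M. 1 \<le> real M * c) sequentially"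
proof -
  obtain m where m: "1 / c < real m" using reals_Archimedean2 by blast
  show ?thesis
  proof (rule eventually_sequentiallyI[of m])
    fix M assume "m \<le> M"
    then have "1 / c < real M" using m by (meson less_le_trans of_nat_le_iff)
    then show "1 \<le> real M * c" using assms by (simp add: field_simps)
  qed
qed

lemma arc_bump_tendsto:
  assumes "b \<le> 1" "0 \<le> x" "x < 1"
  shows "(\<lambda>M. arc_bump b M x) \<longlonglongrightarrow> (if x < b then 1 else 0)"
proof (cases "b \<le> 0")
  case False
  have fx: "frac x = x" using assms by (simp add: frac_eq)
  have arc: "x < b \<longleftrightarrow> tdist x (b / 2) < b / 2 \<or> tdist x 0 = 0"
    using frac_less_iff_tdist[of b x] assms False by (simp add: fx)
  have x0: "tdist x 0 = 0 \<longleftrightarrow> x = 0"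
    unfolding tdist_eq_0_iff using fx by (metis diff_zero frac_eq_0_iff)
  have b0: "tdist 0 (b / 2) = b / 2"
  proof -
    have "frac (- (b / 2)) = 1 - b / 2" by (subst frac_unique_iff) (use False assms in auto)
    then show ?thesis using False assms by (simp add: tdist_def)
  qed
  show ?thesis
  proof (cases "x = 0")
    case True
    then show ?thesis using False by (simp add: arc_bump_def b0)
  next
    case x: False
    then have pos: "0 < tdist x 0" using x0 tdist_nonneg[of x 0] by linarith
    have ev: "eventually (\<lambda>M. 1 \<le> real M * tdist x 0) sequentially" by (rule real_mult_pos_eventually_ge[OF pos])
    show ?thesis
    proof (cases "x < b")
      case True
      then have "0 < b / 2 - tdist x (b / 2)" using arc x x0 by auto
      from real_mult_pos_eventually_ge[OF this] ev
      have "eventually (\<lambda>M. arc_bump b M x = 1) sequentially"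
        by eventually_elim (use False in \<open>simp add: arc_bump_def\<close>)
      then show ?thesis using True by (simp add: tendsto_eventually)
    next
      case nb: False
      then have "b / 2 - tdist x (b / 2) \<le> 0" using arc by auto
      then have le: "real M * (b / 2 - tdist x (b / 2)) \<le> 0" for M by (simp add: mult_nonneg_nonpos)
      from ev have "eventually (\<lambda>M. arc_bump b M x = 0) sequentially"
      proof eventually_elim
        case (elim M)
        then show ?case using le[of M] by (simp add: arc_bump_def)
      qed
      then show ?thesis using nb by (simp add: tendsto_eventually)
    qed
  qed
next
  case True
  then have "\<not> x < b" using assms by linarith
  then show ?thesis using True by (simp add: arc_bump_def)
qed

text \<open>Products of one approximation per coordinate. The bound is the same for all M, as
  dominated convergence requires.\<close>

lemma torus_box_approx:
  assumes "A \<in> torus_boxes k"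
  obtains \<phi> :: "nat \<Rightarrow> (nat \<Rightarrow> real) \<Rightarrow> real" where "\<And>M. \<exists>L. torus_lip k L (\<phi> M)"
    "\<And>M x. \<bar>\<phi> M x\<bar> \<le> 2 ^ k"
    "\<And>x. x \<in> torus k \<Longrightarrow> (\<lambda>M. \<phi> M x) \<longlonglongrightarrow> indicator A x"
proof -
  obtain b where A: "A = {x\<in>torus k. \<forall>i<k. x i < b i}"
    using assms by (auto simp: torus_boxes_def)
  \<comment> \<open>Truncation at 1 changes nothing for coordinates in [0, 1) and meets the
    condition b \<le> 1 of \<open>arc_bump_tendsto\<close>.\<close>
  define \<phi> where "\<phi> M x = (\<Prod>i<k. arc_bump (min (b i) 1) M (x i))" for M x
  have "\<exists>L. torus_lip k L (\<lambda>x. \<Prod>i<m. arc_bump (min (b i) 1) M (x i))" if "m \<le> k" for m M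
    using that
  proof (induction m)
    case 0
    then show ?case using torus_lip_const[of k 1] by auto
  next
    case (Suc m)
    then obtain L where L: "torus_lip k L (\<lambda>x. \<Prod>i<m. arc_bump (min (b i) 1) M (x i))" by auto
    have "torus_lip k (2 * M) (\<lambda>x. arc_bump (min (b m) 1) M (x m))"
      unfolding torus_lip_def
    proof (intro conjI ballI)
      fix x y :: "nat \<Rightarrow> real"
      have "2 * M * tdist (x m) (y m) \<le> 2 * M * tdistn k x y"
        using Suc.prems by (intro mult_left_mono tdist_le_tdistn) auto
      then show "\<bar>arc_bump (min (b m) 1) M (x m) - arc_bump (min (b m) 1) M (y m)\<bar> \<le> real (2 * M) * tdistn k x y"
        using arc_bump_lip[of "min (b m) 1" M "x m" "y m"] by simp
    qed simp
    from torus_lip_mult[OF L this] show ?case by (auto simp: lessThan_Suc mult.commute)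
  qed
  then have 1: "\<exists>L. torus_lip k L (\<phi> M)" for M unfolding \<phi>_def[abs_def] by blast
  have 2: "\<bar>\<phi> M x\<bar> \<le> 2 ^ k" for M x
  proof -
    have "\<bar>\<phi> M x\<bar> = (\<Prod>i<k. arc_bump (min (b i) 1) M (x i))"
      unfolding \<phi>_def using arc_bump_bounds(1) by (simp add: abs_prod)
    also have "\<dots> \<le> (\<Prod>i<k. 2)" using arc_bump_bounds by (intro prod_mono) auto
    finally show ?thesis by simp
  qed
  have 3: "(\<lambda>M. \<phi> M x) \<longlonglongrightarrow> indicator A x" if x: "x \<in> torus k" for x
  proof -
    have "(\<lambda>M. \<phi> M x) \<longlonglongrightarrow> (\<Prod>i<k. if x i < min (b i) 1 then 1 else 0)"
      unfolding \<phi>_def using x by (intro tendsto_prod arc_bump_tendsto) (auto simp: in_torus_space_iff)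
    also have "(\<Prod>i<k. if x i < min (b i) 1 then 1 else 0::real) = indicator A x"
    proof (cases "x \<in> A")
      case True
      then show ?thesis using x unfolding A by (auto simp: in_torus_space_iff intro!: prod.neutral)
    next
      case False
      then obtain i where "i < k" "\<not> x i < b i" using x unfolding A by auto
      then have "(\<Prod>i<k. if x i < min (b i) 1 then 1 else 0::real) = 0"
        by (intro prod_zero) auto
      then show ?thesis using False by simp
    qed
    finally show ?thesis .
  qed
  show thesis by (rule that[OF 1 2 3])
qed

section \<open>From Lipschitz weights to absolutely continuous measures\<close>

lemma integrable_mult_bounded:
  fixes g \<psi> :: "'a \<Rightarrow> real"
  assumes "integrable M g" "\<psi> \<in> borel_measurable M" "\<And>x. x \<in> space M \<Longrightarrow> \<bar>\<psi> x\<bar> \<le> C"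
  shows "integrable M (\<lambda>x. g x * \<psi> x)"
proof (rule Bochner_Integration.integrable_bound)
  show "integrable M (\<lambda>x. C * g x)" using assms by simp
  show "(\<lambda>x. g x * \<psi> x) \<in> borel_measurable M" using assms(1,2) by measurable
  show "AE x in M. norm (g x * \<psi> x) \<le> norm (C * g x)"
  proof (rule AE_I2)
    fix x assume "x \<in> space M"
    then have "\<bar>\<psi> x\<bar> \<le> \<bar>C\<bar>" using assms(3)[of x] by linarith
    then have "\<bar>g x\<bar> * \<bar>\<psi> x\<bar> \<le> \<bar>g x\<bar> * \<bar>C\<bar>" by (rule mult_left_mono) simp
    then show "norm (g x * \<psi> x) \<le> norm (C * g x)" by (simp add: abs_mult mult.commute)
  qed
qed

text \<open>Integration against \<Psi> n is bounded on L1 uniformly in n, so the weights for which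
  the integrals tend to 0 are closed in L1; the domination by w turns pointwise convergence of the
  weights into convergence in L1.\<close>

lemma tendsto_zero_of_L1_approx:
  fixes \<Psi> :: "nat \<Rightarrow> 'a \<Rightarrow> real" and s :: "nat \<Rightarrow> 'a \<Rightarrow> real"
  assumes \<Psi>: "\<And>n. \<Psi> n \<in> borel_measurable M" "\<And>n x. x \<in> space M \<Longrightarrow> \<bar>\<Psi> n x\<bar> \<le> C"
    and s: "\<And>i. integrable M (s i)" "\<And>i. (\<lambda>n. \<integral>x. s i x * \<Psi> n x \<partial>M) \<longlonglongrightarrow> 0"
    and \<phi>: "integrable M \<phi>" and w: "integrable M w"
    and lim: "\<And>x. x \<in> space M \<Longrightarrow> (\<lambda>i. s i x) \<longlonglongrightarrow> \<phi> x"
    and dom: "\<And>i x. x \<in> space M \<Longrightarrow> \<bar>s i x\<bar> \<le> w x"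
  shows "(\<lambda>n. \<integral>x. \<phi> x * \<Psi> n x \<partial>M) \<longlonglongrightarrow> 0"
proof (rule LIMSEQ_I)
  fix e :: real assume e: "0 < e"
  have mult_int: "integrable M (\<lambda>x. g x * \<Psi> n x)" if "integrable M g" for g n
    by (rule integrable_mult_bounded[OF that \<Psi>])
  have "(\<lambda>i. \<integral>x. \<bar>s i x - \<phi> x\<bar> \<partial>M) \<longlonglongrightarrow> (\<integral>x. 0 \<partial>M)"
  proof (rule integral_dominated_convergence)
    show "integrable M (\<lambda>x. w x + \<bar>\<phi> x\<bar>)" using w \<phi> by simp
    show "AE x in M. (\<lambda>i. \<bar>s i x - \<phi> x\<bar>) \<longlonglongrightarrow> 0"
      using lim by (intro AE_I2) (simp add: LIM_zero_iff tendsto_rabs_zero_iff)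
    show "AE x in M. norm \<bar>s i x - \<phi> x\<bar> \<le> w x + \<bar>\<phi> x\<bar>" for i
    proof (rule AE_I2)
      fix x assume "x \<in> space M"
      from dom[OF this, of i] show "norm \<bar>s i x - \<phi> x\<bar> \<le> w x + \<bar>\<phi> x\<bar>" by simp
    qed
  qed (use s \<phi> in auto)
  then have "(\<lambda>i. \<integral>x. \<bar>s i x - \<phi> x\<bar> \<partial>M) \<longlonglongrightarrow> 0" by simp
  then have "eventually (\<lambda>i. (\<integral>x. \<bar>s i x - \<phi> x\<bar> \<partial>M) < e / (2 * (\<bar>C\<bar> + 1))) sequentially"
    using e by (intro order_tendstoD(2)[where a="e / (2 * (\<bar>C\<bar> + 1))"]) auto
  then obtain i where i: "(\<integral>x. \<bar>s i x - \<phi> x\<bar> \<partial>M) < e / (2 * (\<bar>C\<bar> + 1))"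
    using eventually_happens'[OF sequentially_bot] by blast
  from LIMSEQ_D[OF s(2)[of i], of "e / 2"] e
  obtain n0 where n0: "\<And>n. n0 \<le> n \<Longrightarrow> \<bar>\<integral>x. s i x * \<Psi> n x \<partial>M\<bar> < e / 2" by auto
  show "\<exists>no. \<forall>n\<ge>no. norm ((\<integral>x. \<phi> x * \<Psi> n x \<partial>M) - 0) < e"
  proof (intro exI allI impI)
    fix n assume "n0 \<le> n"
    have "\<bar>(\<integral>x. s i x * \<Psi> n x \<partial>M) - (\<integral>x. \<phi> x * \<Psi> n x \<partial>M)\<bar> = \<bar>\<integral>x. s i x * \<Psi> n x - \<phi> x * \<Psi> n x \<partial>M\<bar>"
      using mult_int[OF s(1)] mult_int[OF \<phi>] by simp
    also have "\<dots> \<le> (\<integral>x. \<bar>s i x * \<Psi> n x - \<phi> x * \<Psi> n x\<bar> \<partial>M)" by (rule integral_abs_bound)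
    also have "\<dots> \<le> (\<integral>x. (\<bar>C\<bar> + 1) * \<bar>s i x - \<phi> x\<bar> \<partial>M)"
    proof (rule integral_mono)
      fix x assume "x \<in> space M"
      then have "\<bar>\<Psi> n x\<bar> \<le> \<bar>C\<bar> + 1" using \<Psi>(2)[of x n] by linarith
      then have "\<bar>s i x - \<phi> x\<bar> * \<bar>\<Psi> n x\<bar> \<le> \<bar>s i x - \<phi> x\<bar> * (\<bar>C\<bar> + 1)" by (intro mult_left_mono) auto
      then show "\<bar>s i x * \<Psi> n x - \<phi> x * \<Psi> n x\<bar> \<le> (\<bar>C\<bar> + 1) * \<bar>s i x - \<phi> x\<bar>"
        unfolding left_diff_distrib[symmetric] abs_mult by (simp only: mult.commute)
    qed (use s \<phi> mult_int[OF s(1)] mult_int[OF \<phi>] in auto)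
    also have "\<dots> = (\<bar>C\<bar> + 1) * (\<integral>x. \<bar>s i x - \<phi> x\<bar> \<partial>M)" by simp
    also have "\<dots> < e / 2" using i by (simp add: field_simps)
    finally show "norm ((\<integral>x. \<phi> x * \<Psi> n x \<partial>M) - 0) < e"
      using n0[OF \<open>n0 \<le> n\<close>] unfolding real_norm_def diff_0_right by linarith
  qed
qed

text \<open>The class of admissible weights is enlarged by L1 limits: indicators of boxes as limits
  of Lipschitz functions, then all measurable sets by the pi-lambda argument, then integrable
  functions.\<close>

lemma tendsto_zero_of_torus_lip:
  fixes \<Psi> :: "nat \<Rightarrow> (nat \<Rightarrow> real) \<Rightarrow> real"
  assumes \<Psi>: "\<And>n. \<Psi> n \<in> borel_measurable (torus_space k)" "\<And>n x. x \<in> torus k \<Longrightarrow> \<bar>\<Psi> n x\<bar> \<le> C"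
    and lip: "\<And>L \<phi>. torus_lip k L \<phi> \<Longrightarrow> (\<lambda>n. \<integral>x. \<phi> x * \<Psi> n x \<partial>haar_torus k) \<longlonglongrightarrow> 0"
    and \<phi>: "integrable (haar_torus k) \<phi>"
  shows "(\<lambda>n. \<integral>x. \<phi> x * \<Psi> n x \<partial>haar_torus k) \<longlonglongrightarrow> 0"
proof -
  interpret H: prob_space "haar_torus k" by (rule prob_space_haar_torus)
  let ?P = "\<lambda>\<phi>. (\<lambda>n. \<integral>x. \<phi> x * \<Psi> n x \<partial>haar_torus k) \<longlonglongrightarrow> 0"
  have \<Psi>': "\<And>n. \<Psi> n \<in> borel_measurable (haar_torus k)" "\<And>n x. x \<in> space (haar_torus k) \<Longrightarrow> \<bar>\<Psi> n x\<bar> \<le> C"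
    using \<Psi> by (auto simp: measurable_haar_iff)
  note L1 = tendsto_zero_of_L1_approx[OF \<Psi>']
  have \<Psi>int: "integrable (haar_torus k) (\<Psi> n)" for n by (rule haar_integrable_bounded[OF \<Psi>])
  have set_int: "integrable (haar_torus k) (\<lambda>x. indicator A x * \<Psi> n x)" if "A \<in> sets (torus_space k)" for A n
    using integrable_mult_indicator[OF _ \<Psi>int, of A] that by (simp add: sets_haar_torus)
  have ind_int: "integrable (haar_torus k) (indicator A :: _ \<Rightarrow> real)" if "A \<in> sets (torus_space k)" for A
    using that by (intro haar_integrable_bounded[where C=1]) (auto simp: indicator_def)
  have ind: "?P (indicator A)" if "A \<in> sets (torus_space k)" for A
    using Int_stable_torus_boxes torus_boxes_subset that[unfolded sets_torus_space]
  proof (induction A rule: sigma_sets_induct_disjoint)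
    case (basic A)
    then obtain \<phi> :: "nat \<Rightarrow> (nat \<Rightarrow> real) \<Rightarrow> real" where p: "\<And>M. \<exists>L. torus_lip k L (\<phi> M)"
      "\<And>M x. \<bar>\<phi> M x\<bar> \<le> 2 ^ k" "\<And>x. x \<in> torus k \<Longrightarrow> (\<lambda>M. \<phi> M x) \<longlonglongrightarrow> indicator A x"
      using torus_box_approx by blast
    show ?case
    proof (rule L1[where s=\<phi> and w="\<lambda>_. 2 ^ k"])
      show "integrable (haar_torus k) (\<phi> i)" for i
        using p(1)[of i] p(2) by (auto intro!: haar_integrable_bounded torus_lip_measurable)
      show "?P (\<phi> i)" for i using p(1)[of i] lip by blast
      show "integrable (haar_torus k) (indicator A :: _ \<Rightarrow> real)"
        by (rule ind_int[OF torus_boxes_sets[OF basic]])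
      show "(\<lambda>i. \<phi> i x) \<longlonglongrightarrow> indicator A x" if "x \<in> space (haar_torus k)" for x
        using that p(3) by simp
      show "\<bar>\<phi> i x\<bar> \<le> 2 ^ k" for i x by (rule p(2))
    qed (assumption | rule H.integrable_const)+
  next
    case empty
    then show ?case by simp
  next
    case (compl A)
    then have A: "A \<in> sets (torus_space k)" by (simp add: sets_torus_space)
    have sp: "?P (\<lambda>_. 1)" using lip[OF torus_lip_const[of k 1]] .
    have "(\<integral>x. indicator (torus k - A) x * \<Psi> n x \<partial>haar_torus k) =
      (\<integral>x. 1 * \<Psi> n x \<partial>haar_torus k) - (\<integral>x. indicator A x * \<Psi> n x \<partial>haar_torus k)" for n
    proof -
      have "(\<integral>x. indicator (torus k - A) x * \<Psi> n x \<partial>haar_torus k) =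
        (\<integral>x. 1 * \<Psi> n x - indicator A x * \<Psi> n x \<partial>haar_torus k)"
        by (rule Bochner_Integration.integral_cong) (auto simp: indicator_def)
      also have "\<dots> = (\<integral>x. 1 * \<Psi> n x \<partial>haar_torus k) - (\<integral>x. indicator A x * \<Psi> n x \<partial>haar_torus k)"
        by (rule Bochner_Integration.integral_diff) (use \<Psi>int set_int[OF A] in auto)
      finally show ?thesis .
    qed
    then show ?case using tendsto_diff[OF sp compl(2)] by simp
  next
    case (union A)
    have As: "A i \<in> sets (torus_space k)" for i using union by (auto simp: sets_torus_space)
    show ?case
    proof (rule L1[where s="\<lambda>m x. \<Sum>i<m. indicator (A i) x" and w="\<lambda>_. 1"])
      show "integrable (haar_torus k) (\<lambda>x. \<Sum>i<m. indicator (A i) x :: real)" for m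
        by (intro Bochner_Integration.integrable_sum ind_int As)
      show "(\<lambda>n. \<integral>x. (\<Sum>i<m. indicator (A i) x) * \<Psi> n x \<partial>haar_torus k) \<longlonglongrightarrow> 0" for m
      proof -
        have "(\<integral>x. (\<Sum>i<m. indicator (A i) x) * \<Psi> n x \<partial>haar_torus k) =
           (\<Sum>i<m. \<integral>x. indicator (A i) x * \<Psi> n x \<partial>haar_torus k)" for n
          unfolding sum_distrib_right using set_int[OF As] by (intro Bochner_Integration.integral_sum)
        then show ?thesis using tendsto_sum[of "{..<m}", OF union(3)] by simp
      qed
      have eq: "(\<Sum>i<m. indicator (A i) x :: real) = indicator (\<Union>i<m. A i) x" for m x
        using union(1) by (intro indicator_UN_disjoint[symmetric]) (auto simp: disjoint_family_on_def)
      show "(\<lambda>m. \<Sum>i<m. indicator (A i) x :: real) \<longlonglongrightarrow> indicator (\<Union>i. A i) x" for x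
        unfolding eq by (rule LIMSEQ_indicator_UN)
      show "\<bar>\<Sum>i<m. indicator (A i) x :: real\<bar> \<le> 1" for m x
        unfolding eq by (simp add: indicator_def)
      show "integrable (haar_torus k) (indicator (\<Union>i. A i) :: _ \<Rightarrow> real)"
        by (intro ind_int sets.countable_UN) (use As in auto)
    qed (assumption | rule H.integrable_const)+
  qed
  from \<phi> show ?thesis
  proof (induction rule: integrable_induct)
    case (base A c)
    then have "?P (indicator A)" using ind by (simp add: sets_haar_torus)
    from tendsto_mult_right_zero[OF this, of c] show ?case by (simp add: mult_ac)
  next
    case (add f g)
    have i: "integrable (haar_torus k) (\<lambda>x. h x * \<Psi> n x)" if "integrable (haar_torus k) h" for h n
      by (rule integrable_mult_bounded[OF that \<Psi>'])
    show ?case using tendsto_add[OF add.IH] i[OF add.hyps(1)] i[OF add.hyps(2)]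
      by (simp add: distrib_right)
  next
    case (lim f s)
    show ?case
    proof (rule L1[where s=s and w="\<lambda>x. 2 * \<bar>f x\<bar>"])
      show "integrable (haar_torus k) (s i)" for i by fact
      show "?P (s i)" for i by fact
      show "integrable (haar_torus k) f" by fact
      then show "integrable (haar_torus k) (\<lambda>x. 2 * \<bar>f x\<bar>)" by simp
      show "(\<lambda>i. s i x) \<longlonglongrightarrow> f x" if "x \<in> space (haar_torus k)" for x
        by (rule lim.hyps(2)[OF that])
      show "\<bar>s i x\<bar> \<le> 2 * \<bar>f x\<bar>" if "x \<in> space (haar_torus k)" for i x
        using lim.hyps(3)[OF that, of i] by simp
    qed
  qed
qed

text \<open>The Radon-Nikodym derivative of N is integrable because N is finite, and it serves as
  the weight.\<close>

lemma tendsto_zero_of_absolutely_continuous: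
  fixes \<Psi> :: "nat \<Rightarrow> (nat \<Rightarrow> real) \<Rightarrow> real"
  assumes \<Psi>: "\<And>n. \<Psi> n \<in> borel_measurable (torus_space k)" "\<And>n x. x \<in> torus k \<Longrightarrow> \<bar>\<Psi> n x\<bar> \<le> C"
    and lip: "\<And>L \<phi>. torus_lip k L \<phi> \<Longrightarrow> (\<lambda>n. \<integral>x. \<phi> x * \<Psi> n x \<partial>haar_torus k) \<longlonglongrightarrow> 0"
    and N: "finite_measure N" "sets N = sets (torus_space k)" "absolutely_continuous (haar_torus k) N"
  shows "(\<lambda>n. \<integral>x. \<Psi> n x \<partial>N) \<longlonglongrightarrow> 0"
proof -
  interpret H: prob_space "haar_torus k" by (rule prob_space_haar_torus)
  interpret N: finite_measure N by (rule N(1))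
  have sN: "sets N = sets (haar_torus k)" using N(2) by (simp add: sets_haar_torus)
  have sig: "sigma_finite_measure N" by unfold_locales
  define \<phi> where "\<phi> x = enn2real (RN_deriv (haar_torus k) N x)" for x
  have "integrable N (\<lambda>_. 1 :: real)" by simp
  then have "integrable (haar_torus k) (\<lambda>x. \<phi> x * 1)"
    using H.RN_deriv_integrable[OF sig N(3) sN, of "\<lambda>_. 1 :: real"] by (simp add: \<phi>_def)
  then have "integrable (haar_torus k) \<phi>" by simp
  from tendsto_zero_of_torus_lip[OF \<Psi> lip this]
  have "(\<lambda>n. \<integral>x. \<phi> x * \<Psi> n x \<partial>haar_torus k) \<longlonglongrightarrow> 0" by simp
  moreover have "(\<integral>x. \<Psi> n x \<partial>N) = (\<integral>x. \<phi> x * \<Psi> n x \<partial>haar_torus k)" for n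
    unfolding \<phi>_def using \<Psi>(1)[of n] by (intro H.RN_deriv_integral[OF sig N(3) sN]) (simp add: measurable_haar_iff)
  ultimately show ?thesis by simp
qed

section \<open>Asymptotic invariance of the push-forwards under vertical rotation\<close>

context skew_product
begin

text \<open>Three costs, each by a Lipschitz bound: moving the weight by s, undoing the rotation by
  s of the coordinate before the last after T^n, and replacing the ergodic sum of increments by the
  angle t. The last is measured against any representative t' of t mod 1.\<close>

lemma shift_estimate:
  assumes k: "1 \<le> k" "k < d" and x: "x \<in> torus k" and w0: "0 \<le> w0" "w0 < 1"
    and g: "torus_lip (Suc k) Lg g" "\<And>z. z \<in> torus (Suc k) \<Longrightarrow> \<bar>g z\<bar> \<le> Cg"
    and \<phi>: "torus_lip k L\<phi> \<phi>" "\<And>z. z \<in> torus k \<Longrightarrow> \<bar>\<phi> z\<bar> \<le> C\<phi>"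
    and s: "0 \<le> s" and t: "t' - t \<in> \<int>"
  shows "\<bar>\<phi> (vert_rot k s x) * g ((T (Suc k) ^^ n) ((vert_rot k s x)(k := w0)))
      - \<phi> x * g (vert_rot (Suc k) t ((T (Suc k) ^^ n) (x(k := w0))))\<bar>
    \<le> L\<phi> * s * Cg + C\<phi> * (Lg * (s + \<bar>(\<Sum>j<n. incr k s ((T k ^^ j) x)) - t'\<bar>))"
proof -
  define z where "z = x(k := w0)"
  have z: "z \<in> torus (Suc k)" unfolding z_def by (rule extend_in_torus[OF x w0])
  define y where "y = (T (Suc k) ^^ n) z"
  have y: "y \<in> torus (Suc k)" unfolding y_def using k z by (intro T_funpow_in) auto
  define a where "a = (\<Sum>j<n. incr k s ((T k ^^ j) x))"
  have Lg: "0 \<le> Lg" using g by (simp add: torus_lip_def)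
  have "(vert_rot k s x)(k := w0) = vert_rot k s z" using k by (auto simp: z_def vert_rot_def fun_eq_iff)
  then have eq: "(T (Suc k) ^^ n) ((vert_rot k s x)(k := w0)) = vert_rot (Suc k) a (vert_rot k s y)"
    using T_Suc_funpow_vert_rot[OF k z, of n s] by (simp add: restrict_extend[OF x] z_def a_def y_def del: restrict_fupd restrict_apply restrict_apply')
  have Uy: "vert_rot k s y \<in> torus (Suc k)" using k y by (intro vert_rot_in) auto
  have Ux: "vert_rot k s x \<in> torus k" using k x by (intro vert_rot_in) auto
  have Ray: "vert_rot (Suc k) a (vert_rot k s y) \<in> torus (Suc k)" by (rule vert_rot_in[OF Uy]) auto
  have "\<bar>g (vert_rot (Suc k) a (vert_rot k s y)) - g (vert_rot (Suc k) a y)\<bar>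
      = \<bar>g (vert_rot k s (vert_rot (Suc k) a y)) - g (vert_rot k 0 (vert_rot (Suc k) a y))\<bar>"
    using k y vert_rot_0[OF vert_rot_in[OF y, of "Suc k" a], of k] by (simp add: vert_rot_commute)
  also have "\<dots> \<le> Lg * \<bar>s\<bar>"
    using k y by (intro torus_lip_vert_rot_diff[OF g(1)] vert_rot_in) auto
  finally have 1: "\<bar>g (vert_rot (Suc k) a (vert_rot k s y)) - g (vert_rot (Suc k) a y)\<bar> \<le> Lg * s" using s by simp
  have 2: "\<bar>g (vert_rot (Suc k) a y) - g (vert_rot (Suc k) t y)\<bar> \<le> Lg * \<bar>a - t'\<bar>"
    using t by (intro torus_lip_vert_rot_diff[OF g(1) y]) auto
  have 3: "\<bar>g (vert_rot (Suc k) a (vert_rot k s y)) - g (vert_rot (Suc k) t y)\<bar> \<le> Lg * (s + \<bar>a - t'\<bar>)"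
    using 1 2 by (simp add: distrib_left)
  have 4: "\<bar>\<phi> (vert_rot k s x) - \<phi> x\<bar> \<le> L\<phi> * s"
    using torus_lip_vert_rot_diff[OF \<phi>(1) x, of k s 0 s] vert_rot_0[OF x, of k] k s by simp
  have "\<phi> (vert_rot k s x) * g (vert_rot (Suc k) a (vert_rot k s y)) - \<phi> x * g (vert_rot (Suc k) t y)
     = (\<phi> (vert_rot k s x) - \<phi> x) * g (vert_rot (Suc k) a (vert_rot k s y))
       + \<phi> x * (g (vert_rot (Suc k) a (vert_rot k s y)) - g (vert_rot (Suc k) t y))"
    by (simp add: algebra_simps)
  then have "\<bar>\<phi> (vert_rot k s x) * g (vert_rot (Suc k) a (vert_rot k s y)) - \<phi> x * g (vert_rot (Suc k) t y)\<bar>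
     \<le> \<bar>\<phi> (vert_rot k s x) - \<phi> x\<bar> * \<bar>g (vert_rot (Suc k) a (vert_rot k s y))\<bar>
       + \<bar>\<phi> x\<bar> * \<bar>g (vert_rot (Suc k) a (vert_rot k s y)) - g (vert_rot (Suc k) t y)\<bar>"
    by (metis abs_mult abs_triangle_ineq)
  also have "\<dots> \<le> (L\<phi> * s) * Cg + C\<phi> * (Lg * (s + \<bar>a - t'\<bar>))"
    using 3 4 g(2)[OF Ray] \<phi>(2)[OF x] s \<phi>(1)
    by (intro add_mono mult_mono) (auto simp: torus_lip_def)
  finally show ?thesis unfolding eq by (simp add: y_def z_def a_def)
qed

text \<open>The core estimate, with the last coordinate frozen at w0 so that only Haar measure on
  the base with a Lipschitz weight is involved.\<close>

lemma tendsto_lip_density: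
  assumes k: "1 \<le> k" "k < d" and erg: "vert_ergodic k"
    and deg: "\<And>x. x \<in> torus_pts (k - 1) \<Longrightarrow> circle_degree (\<lambda>t. f k (x(k - 1 := t))) \<noteq> 0"
    and g: "torus_lip (Suc k) Lg g" and w0: "0 \<le> w0" "w0 < 1" and \<phi>: "torus_lip k L\<phi> \<phi>"
  shows "(\<lambda>n. \<integral>x. \<phi> x * (g (vert_rot (Suc k) t ((T (Suc k) ^^ n) (x(k := w0)))) - g ((T (Suc k) ^^ n) (x(k := w0)))) \<partial>haar_torus k) \<longlonglongrightarrow> 0"
    (is "?\<Lambda> \<longlonglongrightarrow> 0")
proof -
  obtain L where L: "0 < L" "circle_lip k L (f k)" using f_circle_lip[OF k] by blast
  obtain D where D: "D \<noteq> 0" and mean: "\<And>s x. x \<in> torus k \<Longrightarrow> 0 \<le> s \<Longrightarrow> L * s < 1 / 4 \<Longrightarrow>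
      (\<integral>t. incr k s (x(k - 1 := t)) \<partial>unit_lborel) = s * D"
    using incr_mean[OF k(1) L(2) deg] by blast
  obtain Cg where Cg: "0 < Cg" "\<And>z. z \<in> torus (Suc k) \<Longrightarrow> \<bar>g z\<bar> \<le> Cg"
    using torus_lip_bounded[OF g] by blast
  obtain C\<phi> where C\<phi>: "0 < C\<phi>" "\<And>z. z \<in> torus k \<Longrightarrow> \<bar>\<phi> z\<bar> \<le> C\<phi>"
    using torus_lip_bounded[OF \<phi>] by blast
  have Lg: "0 \<le> Lg" and L\<phi>: "0 \<le> L\<phi>" using g \<phi> by (auto simp: torus_lip_def)
  interpret H: prob_space "haar_torus k" by (rule prob_space_haar_torus)
  \<comment> \<open>The angle is replaced by a nonzero representative mod 1 with the sign of D, so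
    that the total shift \<tau> = t' / D is positive.\<close>
  obtain t' where t': "t' - t \<in> \<int>" "0 < t' / D"
  proof (cases "0 < D")
    case True
    have "(frac t + 1) - t = of_int (1 - \<lfloor>t\<rfloor>)" by (simp add: frac_def)
    then have "(frac t + 1) - t \<in> \<int>" by (metis Ints_of_int)
    moreover have "0 < (frac t + 1) / D" using True by (simp add: add_nonneg_pos)
    ultimately show ?thesis by (rule that)
  next
    case False
    have "(frac t - 1) - t = of_int (- 1 - \<lfloor>t\<rfloor>)" by (simp add: frac_def)
    then have "(frac t - 1) - t \<in> \<int>" by (metis Ints_of_int)
    moreover have "0 < (frac t - 1) / D" using False D frac_lt_1[of t] by (simp add: zero_less_divide_iff)
    ultimately show ?thesis by (rule that)
  qed
  define \<tau> where "\<tau> = t' / D"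
  have \<tau>: "0 < \<tau>" "\<tau> * D = t'" using t' D by (auto simp: \<tau>_def)
  show ?thesis
  proof (rule LIMSEQ_I)
    fix e :: real assume e: "0 < e"
    \<comment> \<open>Leaves at most half of e to the deviation of the averaged increments; the
      other half goes to errors of order 1 / n.\<close>
    define \<eta> where "\<eta> = e / (2 * (C\<phi> * Lg * \<tau> + 1))"
    have pos: "0 < C\<phi> * Lg * \<tau> + 1" using C\<phi> Lg \<tau> by (simp add: add_nonneg_pos)
    have \<eta>: "0 < \<eta>" using e pos by (simp add: \<eta>_def)
    have C\<eta>: "C\<phi> * Lg * \<tau> * \<eta> \<le> e / 2"
    proof -
      have "C\<phi> * Lg * \<tau> * \<eta> \<le> (C\<phi> * Lg * \<tau> + 1) * \<eta>" using \<eta> by (simp add: algebra_simps)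
      also have "\<dots> = e / 2"
      proof -
        have "q * (e / (2 * q)) = e / 2" if "0 < q" for q using that by simp
        from this[OF pos] show ?thesis unfolding \<eta>_def .
      qed
      finally show ?thesis .
    qed
    obtain \<sigma> n0 where \<sigma>: "0 < \<sigma>" "L * \<sigma> < 1 / 4" and
      av: "\<And>n N. n0 \<le> n \<Longrightarrow> 1 \<le> N \<Longrightarrow>
       (\<integral>x. \<bar>(\<Sum>j<n. incr k (\<sigma> / real N) ((T k ^^ j) x)) / n / (\<sigma> / real N) - D\<bar> \<partial>haar_torus k) \<le> \<eta>"
    proof (rule incr_average[OF k L(2) erg \<eta> mean])
      fix \<sigma> n0
      assume "0 < \<sigma>" "L * \<sigma> < 1 / 4" and "\<And>n N. n0 \<le> n \<Longrightarrow> 1 \<le> N \<Longrightarrow>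
       (\<integral>x. \<bar>(\<Sum>j<n. incr k (\<sigma> / real N) ((T k ^^ j) x)) / n / (\<sigma> / real N) - D\<bar> \<partial>haar_torus k) \<le> \<eta>"
      then show thesis by (rule that)
    qed
    \<comment> \<open>K / n collects the errors that vanish with n: those of the shift s \<le>
      \<tau> / n, and the one from rounding the number of subdivisions.\<close>
    define K where "K = L\<phi> * \<tau> * Cg + C\<phi> * Lg * (\<tau> + \<bar>D\<bar> * (\<tau> * \<tau> / \<sigma>))"
    obtain n1 where n1: "2 * K / e < real n1" using reals_Archimedean2 by blast
    show "\<exists>no. \<forall>n\<ge>no. norm (?\<Lambda> n - 0) < e"
    proof (intro exI allI impI)
      fix n assume n: "max (max n0 n1) 1 \<le> n"
      then have n': "n0 \<le> n" "n1 \<le> n" "1 \<le> n" by auto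
      \<comment> \<open>The least number of subdivisions with \<sigma> / N at most \<tau> / n.
        Rounding up makes n s fall short of \<tau> by at most \<tau> \<tau> / (\<sigma> n).\<close>
      define N where "N = nat \<lceil>n * \<sigma> / \<tau>\<rceil>"
      define s where "s = \<sigma> / real N"
      have q: "0 < n * \<sigma> / \<tau>" using n' \<sigma> \<tau> by simp
      then have Ncl: "0 < \<lceil>n * \<sigma> / \<tau>\<rceil>" by (simp only: zero_less_ceiling)
      then have N: "1 \<le> N" unfolding N_def by linarith
      have Nr: "real N = of_int \<lceil>n * \<sigma> / \<tau>\<rceil>"
        unfolding N_def using Ncl by (intro of_nat_nat) linarith
      have N_ge: "n * \<sigma> / \<tau> \<le> real N" and N_le: "real N \<le> n * \<sigma> / \<tau> + 1"
        unfolding Nr by linarith+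
      have s: "0 < s" using N \<sigma> by (simp add: s_def)
      have ns: "n * s \<le> \<tau>" using N_ge N \<tau> by (simp add: s_def field_simps)
      have s_le: "s \<le> \<tau> / n" using ns n' by (simp add: field_simps)
      have "\<tau> - n * s = (\<tau> * N - n * \<sigma>) / N" using N by (simp add: s_def field_simps)
      also have "\<dots> \<le> \<tau> / N"
        using N_le N \<tau> by (intro divide_right_mono) (auto simp: field_simps)
      also have "\<dots> \<le> \<tau> / (n * \<sigma> / \<tau>)"
        using N_ge q \<tau> N by (intro divide_left_mono mult_pos_pos) auto
      also have "\<dots> = \<tau> * \<tau> / \<sigma> / n" using \<tau> \<sigma> n' by (simp add: field_simps)
      finally have gap: "\<tau> - n * s \<le> \<tau> * \<tau> / \<sigma> / n" .
      have Ls: "L * \<bar>s\<bar> < 1 / 4"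
      proof -
        have "s \<le> \<sigma>" using N \<sigma> by (simp add: s_def field_simps)
        then have "L * s \<le> L * \<sigma>" using L by simp
        then show ?thesis using \<sigma> s by simp
      qed
      note minc = torus_lip_measurable[OF incr_torus_lip[OF L(2) k(1) Ls]]
      have T: "haar_preserving k (T k ^^ j)" for j using k by (intro T_funpow_haar_preserving) auto
      note mT = haar_preserving_measurable[OF T]
      define B where "B x = \<bar>(\<Sum>j<n. incr k s ((T k ^^ j) x)) / n / s - D\<bar>" for x
      have mB: "B \<in> borel_measurable (torus_space k)"
        unfolding B_def[abs_def] using measurable_compose[OF mT minc] by measurable
      have Bb: "B x \<le> L + \<bar>D\<bar>" if x: "x \<in> torus k" for x
      proof -
        have "\<bar>\<Sum>j<n. incr k s ((T k ^^ j) x)\<bar> \<le> (\<Sum>j<n. \<bar>incr k s ((T k ^^ j) x)\<bar>)" by (rule sum_abs)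
        also have "\<dots> \<le> (\<Sum>j<n. L * \<bar>s\<bar>)"
          using haar_preserving_in[OF T x] k by (intro sum_mono incr_bound[OF L(2)]) auto
        finally have "\<bar>(\<Sum>j<n. incr k s ((T k ^^ j) x)) / n / s\<bar> \<le> L"
          using s n' by (simp add: field_simps)
        then show ?thesis unfolding B_def by linarith
      qed
      have iB: "integrable (haar_torus k) B"
        using Bb by (intro haar_integrable_bounded[OF mB, where C="L + \<bar>D\<bar>"]) (auto simp: B_def)
      have intB: "(\<integral>x. B x \<partial>haar_torus k) \<le> \<eta>" using av[OF n'(1) N] unfolding B_def s_def .
      define Y where "Y x = (T (Suc k) ^^ n) (x(k := w0))" for x
      have mext: "(\<lambda>x. x(k := w0)) \<in> measurable (torus_space k) (torus_space (Suc k))"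
        using w0 by (intro measurable_compose[OF _ measurable_torus_extend, of "\<lambda>x. (x, w0)", simplified])
          (auto simp: space_restrict_space)
      have hpT: "haar_preserving (Suc k) (T (Suc k) ^^ n)" using k by (intro T_funpow_haar_preserving) auto
      have mY: "Y \<in> measurable (torus_space k) (torus_space (Suc k))"
        unfolding Y_def by (rule measurable_compose[OF mext haar_preserving_measurable[OF hpT]])
      note Yin = measurable_space[OF mY]
      have mR: "vert_rot (Suc k) t \<in> measurable (torus_space (Suc k)) (torus_space (Suc k))"
        by (rule haar_preserving_measurable[OF vert_rot_haar_preserving])
      note mg = torus_lip_measurable[OF g] and m\<phi> = torus_lip_measurable[OF \<phi>]
      define p where "p x = \<phi> x * g (Y x)" for x
      define p' where "p' x = \<phi> x * g (vert_rot (Suc k) t (Y x))" for x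
      have mp: "p \<in> borel_measurable (torus_space k)"
        unfolding p_def[abs_def] using m\<phi> measurable_compose[OF mY mg] by measurable
      have mp': "p' \<in> borel_measurable (torus_space k)"
        unfolding p'_def[abs_def] using m\<phi> measurable_compose[OF mY measurable_compose[OF mR mg]] by measurable
      have pb: "\<bar>p x\<bar> \<le> C\<phi> * Cg" "\<bar>p' x\<bar> \<le> C\<phi> * Cg" if x: "x \<in> torus k" for x
        unfolding p_def p'_def abs_mult
        using C\<phi>(1) Cg(1) Yin[OF x] x by (auto intro!: mult_mono vert_rot_in C\<phi>(2) Cg(2))
      have ip: "integrable (haar_torus k) p" "integrable (haar_torus k) p'"
        using haar_integrable_bounded[OF mp] haar_integrable_bounded[OF mp'] pb by blast+
      have hp: "haar_preserving k (vert_rot k s)"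
        using vert_rot_haar_preserving[of "k - 1" s] k by simp
      have ips: "integrable (haar_torus k) (\<lambda>x. p (vert_rot k s x))"
        using measurable_compose[OF haar_preserving_measurable[OF hp] mp] pb haar_preserving_in[OF hp]
        by (intro haar_integrable_bounded[where C="C\<phi> * Cg"]) auto
      define c0 where "c0 = L\<phi> * s * Cg + C\<phi> * (Lg * (s + \<bar>n * s * D - t'\<bar>))"
      have pt: "\<bar>p' x - p (vert_rot k s x)\<bar> \<le> c0 + C\<phi> * Lg * (n * s) * B x" if x: "x \<in> torus k" for x
      proof -
        define a where "a = (\<Sum>j<n. incr k s ((T k ^^ j) x))"
        have "a - n * s * D = n * s * (a / n / s - D)" using n' s by (simp add: field_simps)
        then have "\<bar>a - n * s * D\<bar> = n * s * B x"
          using s unfolding B_def a_def[symmetric] by (simp add: abs_mult)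
        then have le: "\<bar>a - t'\<bar> \<le> n * s * B x + \<bar>n * s * D - t'\<bar>" by linarith
        have "\<bar>p' x - p (vert_rot k s x)\<bar> = \<bar>p (vert_rot k s x) - p' x\<bar>" by (rule abs_minus_commute)
        also have "\<dots> \<le> L\<phi> * s * Cg + C\<phi> * (Lg * (s + \<bar>a - t'\<bar>))"
          using shift_estimate[OF k x w0 g Cg(2) \<phi> C\<phi>(2) less_imp_le[OF s] t'(1), of n]
          unfolding p_def p'_def Y_def a_def .
        also have "\<dots> \<le> L\<phi> * s * Cg + C\<phi> * (Lg * (s + (n * s * B x + \<bar>n * s * D - t'\<bar>)))"
          using le C\<phi> Lg by (intro add_left_mono mult_left_mono) auto
        finally show ?thesis by (simp add: c0_def algebra_simps)
      qed
      have "?\<Lambda> n = (\<integral>x. p' x - p x \<partial>haar_torus k)"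
        unfolding p_def p'_def Y_def by (simp add: right_diff_distrib)
      \<comment> \<open>Haar measure is invariant under the shift, so p may be replaced by its
        translate; the weight moves along with the point, and \<open>pt\<close> compares the two
        integrands.\<close>
      also have "\<dots> = (\<integral>x. p' x \<partial>haar_torus k) - (\<integral>x. p (vert_rot k s x) \<partial>haar_torus k)"
        using ip haar_preserving_integral[OF hp mp] by simp
      also have "\<dots> = (\<integral>x. p' x - p (vert_rot k s x) \<partial>haar_torus k)" using ip ips by simp
      finally have "\<bar>?\<Lambda> n\<bar> \<le> (\<integral>x. \<bar>p' x - p (vert_rot k s x)\<bar> \<partial>haar_torus k)" by simp
      also have "\<dots> \<le> (\<integral>x. c0 + C\<phi> * Lg * (n * s) * B x \<partial>haar_torus k)"
        using pt ip ips iB by (intro integral_mono) auto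
      also have "\<dots> = c0 + C\<phi> * Lg * (n * s) * (\<integral>x. B x \<partial>haar_torus k)"
        using iB by (simp add: H.prob_space[simplified])
      also have "\<dots> \<le> c0 + C\<phi> * Lg * \<tau> * \<eta>"
        using ns intB s C\<phi> Lg \<eta> \<tau> by (intro add_left_mono mult_mono) (auto simp: B_def)
      also have "\<dots> \<le> c0 + e / 2" using C\<eta> by simp
      also have "c0 \<le> K / n"
      proof -
        have "\<bar>n * s * D - t'\<bar> = \<bar>D\<bar> * (\<tau> - n * s)"
          using ns unfolding \<tau>(2)[symmetric] left_diff_distrib[symmetric] abs_mult by simp
        also have "\<dots> \<le> \<bar>D\<bar> * (\<tau> * \<tau> / \<sigma> / n)" using gap by (intro mult_left_mono) auto
        finally have sd: "s + \<bar>n * s * D - t'\<bar> \<le> \<tau> / n + \<bar>D\<bar> * (\<tau> * \<tau> / \<sigma> / n)" using s_le by linarith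
        have "c0 \<le> L\<phi> * (\<tau> / n) * Cg + C\<phi> * (Lg * (\<tau> / n + \<bar>D\<bar> * (\<tau> * \<tau> / \<sigma> / n)))"
          unfolding c0_def
          by (rule add_mono[OF mult_right_mono[OF mult_left_mono[OF s_le]] mult_left_mono[OF mult_left_mono[OF sd]]])
             (use L\<phi> Cg(1) C\<phi>(1) Lg in auto)
        also have "\<dots> = K / n" by (simp add: K_def algebra_simps add_divide_distrib)
        finally show ?thesis .
      qed
      also have "K / n < e / 2"
      proof -
        have "2 * K / e < real n" using n1 n' by (meson less_le_trans of_nat_le_iff)
        then show ?thesis using e n' by (simp add: field_simps)
      qed
      finally show "norm (?\<Lambda> n - 0) < e" by simp
    qed
  qed
qed

end

lemma absolutely_continuous_distr_density:
  assumes ac: "absolutely_continuous H (distr M N p)" and p: "p \<in> measurable M N"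
    and w: "w \<in> borel_measurable M"
  shows "absolutely_continuous H (distr (density M w) N p)"
  unfolding absolutely_continuous_def
proof
  fix A assume "A \<in> null_sets H"
  then have "A \<in> null_sets (distr M N p)" using ac by (auto simp: absolutely_continuous_def)
  then have A: "A \<in> sets N" and "emeasure M (p -` A \<inter> space M) = 0"
    using p by (auto simp: null_sets_def emeasure_distr)
  then have "p -` A \<inter> space M \<in> null_sets M" using p by (auto simp: null_sets_def)
  then have "AE x in M. x \<notin> p -` A \<inter> space M" by (rule AE_not_in)
  then have "p -` A \<inter> space M \<in> null_sets (density M w)"
    unfolding null_sets_density_iff[OF w] using A p by auto
  then have "emeasure (density M w) (p -` A \<inter> space (density M w)) = 0" by (simp add: null_sets_def)
  then show "A \<in> null_sets (distr (density M w) N p)"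
    using A p by (auto simp: null_sets_def emeasure_distr)
qed

lemma finite_measure_density_bounded:
  fixes w :: "'a \<Rightarrow> real"
  assumes "finite_measure M" "w \<in> borel_measurable M" "\<And>x. x \<in> space M \<Longrightarrow> w x \<le> C"
  shows "finite_measure (density M (\<lambda>x. ennreal (w x)))"
proof (rule finite_measureI)
  interpret finite_measure M by fact
  have "emeasure (density M (\<lambda>x. ennreal (w x))) (space (density M (\<lambda>x. ennreal (w x))))
     = (\<integral>\<^sup>+x. ennreal (w x) * indicator (space M) x \<partial>M)"
    using assms by (simp add: emeasure_density)
  also have "\<dots> \<le> (\<integral>\<^sup>+x. ennreal C * indicator (space M) x \<partial>M)"
    using assms by (intro nn_integral_mono) (auto intro!: mult_right_mono ennreal_leI)
  also have "\<dots> = ennreal C * emeasure M (space M)" by (simp add: nn_integral_cmult_indicator)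
  also have "\<dots> < \<infinity>"
    unfolding emeasure_eq_measure by (simp add: ennreal_mult_less_top)
  finally show "emeasure (density M (\<lambda>x. ennreal (w x))) (space (density M (\<lambda>x. ennreal (w x)))) \<noteq> \<infinity>" by simp
qed

lemma distr_haar_restrict:
  "distr (haar_torus (Suc k)) (torus_space k) (\<lambda>x. restrict x {..<k}) = haar_torus k"
proof (rule measure_eqI)
  fix A assume "A \<in> sets (distr (haar_torus (Suc k)) (torus_space k) (\<lambda>x. restrict x {..<k}))"
  then have A: "A \<in> sets (torus_space k)" by simp
  interpret U: prob_space unit_lborel by (rule prob_space_unit)
  have m: "(\<lambda>x. restrict x {..<k}) \<in> measurable (torus_space (Suc k)) (torus_space k)"
    by (rule measurable_torus_restrict) simp
  have "emeasure (distr (haar_torus (Suc k)) (torus_space k) (\<lambda>x. restrict x {..<k})) A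
    = (\<integral>\<^sup>+x. indicator A x \<partial>distr (haar_torus (Suc k)) (torus_space k) (\<lambda>x. restrict x {..<k}))"
    using A by simp
  also have "\<dots> = (\<integral>\<^sup>+x. indicator A (restrict x {..<k}) \<partial>haar_torus (Suc k))"
    using A m by (intro nn_integral_distr) (auto simp: measurable_haar_iff)
  also have "\<dots> = (\<integral>\<^sup>+x. (\<integral>\<^sup>+t. indicator A (restrict (x(k := t)) {..<k}) \<partial>unit_lborel) \<partial>haar_torus k)"
    using A by (intro nn_integral_haar_Suc measurable_compose[OF m]) auto
  also have "\<dots> = (\<integral>\<^sup>+x. indicator A x \<partial>haar_torus k)"
  proof (rule nn_integral_cong)
    fix x assume "x \<in> space (haar_torus k)"
    then have "restrict (x(k := t)) {..<k} = x" for t by (intro restrict_extend) simp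
    then show "(\<integral>\<^sup>+t. indicator A (restrict (x(k := t)) {..<k}) \<partial>unit_lborel) = indicator A x"
      using U.emeasure_space_1 by (simp only: nn_integral_const mult_1_right)
  qed
  also have "\<dots> = emeasure (haar_torus k) A" using A by (simp add: sets_haar_torus)
  finally show "emeasure (distr (haar_torus (Suc k)) (torus_space k) (\<lambda>x. restrict x {..<k})) A = emeasure (haar_torus k) A" .
qed (simp add: sets_haar_torus)

context skew_product
begin

lemma T_funpow_measurable:
  "k \<le> d \<Longrightarrow> T k ^^ n \<in> measurable (torus_space k) (torus_space k)"
  by (rule haar_preserving_measurable[OF T_funpow_haar_preserving])

text \<open>The last coordinate of \<mu> is arbitrary, so it is cut into M cells and frozen at the
  left end of each. On a cell the problem descends to the base, where \<mu> has a density; the error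
  of freezing is at most 2 Lg / M for every n.\<close>

lemma vertical_difference_tendsto:
  assumes k: "1 \<le> k" "k < d" and erg: "vert_ergodic k"
    and deg: "\<And>x. x \<in> torus_pts (k - 1) \<Longrightarrow> circle_degree (\<lambda>t. f k (x(k - 1 := t))) \<noteq> 0"
    and g: "torus_lip (Suc k) Lg g"
    and \<mu>: "finite_measure \<mu>" "sets \<mu> = sets (torus_space (Suc k))"
    and ac: "absolutely_continuous (haar_torus k) (distr \<mu> (torus_space k) (\<lambda>x. restrict x {..<k}))"
  shows "(\<lambda>n. \<integral>z. g (vert_rot (Suc k) t ((T (Suc k) ^^ n) z)) - g ((T (Suc k) ^^ n) z) \<partial>\<mu>) \<longlonglongrightarrow> 0"
    (is "?\<Lambda> \<longlonglongrightarrow> 0")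
proof (rule LIMSEQ_I)
  fix e :: real assume e: "0 < e"
  interpret \<mu>: finite_measure \<mu> by (rule \<mu>)
  have sp: "space \<mu> = torus (Suc k)" by (rule sets_eq_imp_space_eq[OF \<mu>(2)])
  have msr: "measurable \<mu> N = measurable (torus_space (Suc k)) N" for N :: "real measure"
    by (rule measurable_cong_sets[OF \<mu>(2) refl])
  obtain Cg where Cg: "0 < Cg" "\<And>z. z \<in> torus (Suc k) \<Longrightarrow> \<bar>g z\<bar> \<le> Cg"
    using torus_lip_bounded[OF g] by blast
  have Lg: "0 \<le> Lg" using g by (simp add: torus_lip_def)
  define m where "m = measure \<mu> (space \<mu>)"
  \<comment> \<open>Makes the error of freezing, 2 Lg m / M, smaller than e / 2; the + 1 yields M
    \<ge> 1 even if Lg or m is 0.\<close>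
  obtain M :: nat where M: "4 * Lg * m / e + 1 < real M" using reals_Archimedean2 by blast
  have "0 \<le> 4 * Lg * m / e" using Lg e by (simp add: m_def)
  then have M1: "1 \<le> M" using M by linarith
  let ?p = "\<lambda>x::nat \<Rightarrow> real. restrict x {..<k}"
  have mp: "?p \<in> measurable (torus_space (Suc k)) (torus_space k)"
    by (rule measurable_torus_restrict) simp
  have mp\<mu>: "?p \<in> measurable \<mu> (torus_space k)" unfolding measurable_cong_sets[OF \<mu>(2) refl] by (rule mp)
  define Tn where "Tn n = T (Suc k) ^^ n" for n
  have mTn: "Tn n \<in> measurable (torus_space (Suc k)) (torus_space (Suc k))" for n
    unfolding Tn_def using k by (intro T_funpow_measurable) auto
  note Tin = measurable_space[OF mTn]
  have mR: "vert_rot (Suc k) t \<in> measurable (torus_space (Suc k)) (torus_space (Suc k))"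
    by (rule haar_preserving_measurable[OF vert_rot_haar_preserving])
  note mg = torus_lip_measurable[OF g]
  define \<Delta> where "\<Delta> n z = g (vert_rot (Suc k) t (Tn n z)) - g (Tn n z)" for n z
  have m\<Delta>: "\<Delta> n \<in> borel_measurable (torus_space (Suc k))" for n
    unfolding \<Delta>_def[abs_def]
    using measurable_compose[OF mTn measurable_compose[OF mR mg]] measurable_compose[OF mTn mg] by measurable
  have \<Delta>b: "\<bar>\<Delta> n z\<bar> \<le> 2 * Cg" if "z \<in> torus (Suc k)" for n z
    using Cg(2)[OF Tin[OF that], of n] Cg(2)[OF measurable_space[OF mR Tin[OF that]], of n]
    unfolding \<Delta>_def by linarith
  define \<iota> where "\<iota> l x = (x::nat \<Rightarrow> real)(k := real l / real M)" for l :: nat and x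
  have lM: "0 \<le> real l / real M" "real l / real M < 1" if "l < M" for l
    using that by (auto simp: field_simps)
  have m\<iota>: "\<iota> l \<in> measurable (torus_space k) (torus_space (Suc k))" if "l < M" for l
    unfolding \<iota>_def[abs_def] using lM[OF that]
    by (intro measurable_compose[OF _ measurable_torus_extend, of "\<lambda>x. (x, real l / real M)", simplified])
       (auto simp: space_restrict_space)
  define \<Psi> where "\<Psi> l n x = \<Delta> n (\<iota> l x)" for l n x
  define B where "B l = {z \<in> torus (Suc k). real l / M \<le> z k \<and> z k < real (Suc l) / M}" for l
  note mk = measurable_torus_component[of k "Suc k", simplified]
  have mB: "B l \<in> sets (torus_space (Suc k))" for l
    unfolding B_def using mk by measurable
  have lim: "(\<lambda>n. \<integral>z. indicator (B l) z * \<Psi> l n (?p z) \<partial>\<mu>) \<longlonglongrightarrow> 0" if l: "l < M" for l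
  proof -
    \<comment> \<open>The projection of \<mu> restricted to the cell B l. It inherits absolute
      continuity from the projection of \<mu>.\<close>
    define N where "N = distr (density \<mu> (\<lambda>z. ennreal (indicator (B l) z))) (torus_space k) ?p"
    have wB: "(indicator (B l) :: _ \<Rightarrow> real) \<in> borel_measurable \<mu>"
      using mB[of l] by (intro borel_measurable_indicator) (simp add: \<mu>(2))
    have m\<Psi>: "\<Psi> l n \<in> borel_measurable (torus_space k)" for n
      unfolding \<Psi>_def[abs_def] by (rule measurable_compose[OF m\<iota>[OF l] m\<Delta>])
    have fd: "finite_measure (density \<mu> (\<lambda>z. ennreal (indicator (B l) z)))"
      by (rule finite_measure_density_bounded[OF \<mu>(1) wB, of 1]) (auto simp: indicator_def)
    have "(\<lambda>n. \<integral>x. \<Psi> l n x \<partial>N) \<longlonglongrightarrow> 0"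
    proof (rule tendsto_zero_of_absolutely_continuous[where k=k and C="2 * Cg"])
      show "\<bar>\<Psi> l n x\<bar> \<le> 2 * Cg" if "x \<in> torus k" for n x
        unfolding \<Psi>_def by (rule \<Delta>b[OF measurable_space[OF m\<iota>[OF l] that]])
      show "(\<lambda>n. \<integral>x. \<phi> x * \<Psi> l n x \<partial>haar_torus k) \<longlonglongrightarrow> 0" if "torus_lip k L \<phi>" for L \<phi>
        unfolding \<Psi>_def \<Delta>_def \<iota>_def Tn_def
        by (rule tendsto_lip_density[OF k erg deg g lM[OF l] that])
      show "finite_measure N" unfolding N_def
        by (rule finite_measure.finite_measure_distr[OF fd]) (use mp\<mu> in simp)
      show "sets N = sets (torus_space k)" by (simp add: N_def)
      show "absolutely_continuous (haar_torus k) N"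
        unfolding N_def using wB by (intro absolutely_continuous_distr_density[OF ac mp\<mu>]) auto
    qed (rule m\<Psi>)
    moreover have "(\<integral>x. \<Psi> l n x \<partial>N) = (\<integral>z. indicator (B l) z * \<Psi> l n (?p z) \<partial>\<mu>)" for n
    proof -
      have "(\<integral>x. \<Psi> l n x \<partial>N) = (\<integral>z. \<Psi> l n (?p z) \<partial>density \<mu> (\<lambda>z. ennreal (indicator (B l) z)))"
        unfolding N_def using mp\<mu> m\<Psi> by (intro integral_distr) auto
      also have "\<dots> = (\<integral>z. indicator (B l) z *\<^sub>R \<Psi> l n (?p z) \<partial>\<mu>)"
        using wB measurable_compose[OF mp\<mu> m\<Psi>] by (intro integral_density) auto
      finally show ?thesis by simp
    qed
    ultimately show ?thesis by simp
  qed
  define \<Phi> where "\<Phi> n z = (\<Sum>l<M. indicator (B l) z * \<Psi> l n (?p z))" for n z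
  have m\<Phi>l: "(\<lambda>z. indicator (B l) z * \<Psi> l n (?p z)) \<in> borel_measurable \<mu>" if "l < M" for l n
  proof -
    have "(\<lambda>z. \<Psi> l n (?p z)) \<in> borel_measurable \<mu>"
      unfolding \<Psi>_def by (rule measurable_compose[OF mp\<mu> measurable_compose[OF m\<iota>[OF that] m\<Delta>]])
    moreover have "B l \<in> sets \<mu>" using mB \<mu>(2) by simp
    ultimately show ?thesis by measurable
  qed
  have i\<Phi>l: "integrable \<mu> (\<lambda>z. indicator (B l) z * \<Psi> l n (?p z))" if "l < M" for l n
  proof (rule \<mu>.integrable_const_bound[where B="2 * Cg"])
    show "AE z in \<mu>. norm (indicator (B l) z * \<Psi> l n (?p z)) \<le> 2 * Cg"
    proof (rule AE_I2)
      fix z assume "z \<in> space \<mu>"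
      then have "\<bar>\<Psi> l n (?p z)\<bar> \<le> 2 * Cg"
        unfolding \<Psi>_def sp by (intro \<Delta>b measurable_space[OF m\<iota>[OF that]] measurable_space[OF mp])
      then show "norm (indicator (B l) z * \<Psi> l n (?p z)) \<le> 2 * Cg"
        using Cg(1) by (auto simp: indicator_def)
    qed
  qed (rule m\<Phi>l[OF that])
  have close: "\<bar>\<Delta> n z - \<Phi> n z\<bar> \<le> 2 * Lg / M" if z: "z \<in> torus (Suc k)" for n z
  proof -
    have zk: "0 \<le> z k" "z k < 1" using z by (auto simp: in_torus_space_iff)
    obtain l where lM': "l < M" and zl: "real l / M \<le> z k" "z k \<le> real l / M + 1 / M"
      and cell: "\<And>l'. real l' / M \<le> z k \<and> z k < real (Suc l') / M \<longleftrightarrow> l' = l"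
      using unit_interval_cell[OF zk M1] by blast
    have inB: "z \<in> B l' \<longleftrightarrow> l' = l" for l'
      using z cell[of l'] by (simp add: B_def)
    have "\<Phi> n z = (\<Sum>l'<M. if l' = l then \<Psi> l n (?p z) else 0)"
      unfolding \<Phi>_def by (intro sum.cong refl) (auto simp: inB indicator_def)
    then have \<Phi>: "\<Phi> n z = \<Psi> l n (?p z)" using lM' by simp
    define \<delta> where "\<delta> = z k - real l / M"
    have \<delta>: "0 \<le> \<delta>" "\<delta> \<le> 1 / M" using zl by (auto simp: \<delta>_def)
    have ip: "\<iota> l (?p z) \<in> torus (Suc k)"
      by (rule measurable_space[OF m\<iota>[OF lM'] measurable_space[OF mp z]])
    \<comment> \<open>z is its frozen point rotated vertically by \<delta>. T^n commutes with this
      rotation, so the two orbits stay at the same vertical offset for all n.\<close>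
    have "z = vert_rot (Suc k) \<delta> (\<iota> l (?p z))"
      using z by (auto simp: vert_rot_def \<iota>_def \<delta>_def fun_eq_iff in_torus_space_iff extensional_def frac_eq)
    then have Tz: "Tn n z = vert_rot (Suc k) \<delta> (Tn n (\<iota> l (?p z)))"
      unfolding Tn_def using T_funpow_vert_rot[of "Suc k" n \<delta> "\<iota> l (?p z)"] k by (metis Suc_leI le_add1 plus_1_eq_Suc)
    define y where "y = Tn n (\<iota> l (?p z))"
    have y: "y \<in> torus (Suc k)" unfolding y_def by (rule Tin[OF ip])
    have 1: "\<bar>g (vert_rot (Suc k) (t + \<delta>) y) - g (vert_rot (Suc k) t y)\<bar> \<le> Lg * \<bar>\<delta>\<bar>"
      by (rule torus_lip_vert_rot_diff[OF g y]) auto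
    have 2: "\<bar>g (vert_rot (Suc k) \<delta> y) - g (vert_rot (Suc k) 0 y)\<bar> \<le> Lg * \<bar>\<delta>\<bar>"
      by (rule torus_lip_vert_rot_diff[OF g y]) auto
    have "\<Delta> n z - \<Phi> n z = (g (vert_rot (Suc k) (t + \<delta>) y) - g (vert_rot (Suc k) t y))
        - (g (vert_rot (Suc k) \<delta> y) - g (vert_rot (Suc k) 0 y))"
      unfolding \<Phi> \<Psi>_def \<Delta>_def Tz y_def[symmetric] vert_rot_add
      using vert_rot_0[OF y, of "Suc k"] by simp
    then have "\<bar>\<Delta> n z - \<Phi> n z\<bar> \<le> 2 * (Lg * \<bar>\<delta>\<bar>)" using 1 2 by linarith
    also have "\<dots> \<le> 2 * (Lg * (1 / M))" using \<delta> Lg by (intro mult_left_mono) auto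
    finally show ?thesis by simp
  qed
  have i\<Delta>: "integrable \<mu> (\<Delta> n)" for n
    using \<Delta>b m\<Delta> by (intro \<mu>.integrable_const_bound[where B="2 * Cg"]) (auto simp: sp msr intro!: AE_I2)
  have i\<Phi>: "integrable \<mu> (\<Phi> n)" for n
    unfolding \<Phi>_def[abs_def] using i\<Phi>l by (intro Bochner_Integration.integrable_sum) auto
  have "(\<lambda>n. \<Sum>l<M. \<integral>z. indicator (B l) z * \<Psi> l n (?p z) \<partial>\<mu>) \<longlonglongrightarrow> (\<Sum>l<M. 0)"
    using lim by (intro tendsto_sum) auto
  moreover have "(\<integral>z. \<Phi> n z \<partial>\<mu>) = (\<Sum>l<M. \<integral>z. indicator (B l) z * \<Psi> l n (?p z) \<partial>\<mu>)" for n
    unfolding \<Phi>_def using i\<Phi>l by (intro Bochner_Integration.integral_sum) auto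
  ultimately have "(\<lambda>n. \<integral>z. \<Phi> n z \<partial>\<mu>) \<longlonglongrightarrow> 0" by simp
  from LIMSEQ_D[OF this, of "e / 2"] e
  obtain n0 where n0: "\<And>n. n0 \<le> n \<Longrightarrow> \<bar>\<integral>z. \<Phi> n z \<partial>\<mu>\<bar> < e / 2" by auto
  show "\<exists>no. \<forall>n\<ge>no. norm (?\<Lambda> n - 0) < e"
  proof (intro exI allI impI)
    fix n assume n: "n0 \<le> n"
    have "?\<Lambda> n = (\<integral>z. \<Delta> n z \<partial>\<mu>)" by (simp add: \<Delta>_def Tn_def)
    have "\<bar>(\<integral>z. \<Delta> n z \<partial>\<mu>) - (\<integral>z. \<Phi> n z \<partial>\<mu>)\<bar> = \<bar>\<integral>z. \<Delta> n z - \<Phi> n z \<partial>\<mu>\<bar>"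
      using i\<Delta> i\<Phi> by simp
    also have "\<dots> \<le> (\<integral>z. \<bar>\<Delta> n z - \<Phi> n z\<bar> \<partial>\<mu>)" by (rule integral_abs_bound)
    also have "\<dots> \<le> (\<integral>z. 2 * Lg / M \<partial>\<mu>)"
      using close i\<Delta> i\<Phi> by (intro integral_mono) (auto simp: sp)
    also have "\<dots> = 2 * Lg / M * m" by (simp add: m_def)
    also have "\<dots> < e / 2"
    proof -
      have "4 * Lg * m / e < real M" using M by simp
      then show ?thesis using e M1 by (simp add: field_simps)
    qed
    finally show "norm (?\<Lambda> n - 0) < e"
      using n0[OF n] unfolding \<open>?\<Lambda> n = _\<close> real_norm_def diff_0_right by linarith
  qed
qed

end

subsection \<open>Ergodicity in the vertical direction\<close>

text \<open>A Riemann sum with an explicit error. Averaging over finitely many rotations instead of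
  integrating over all of them means that convergence for each fixed rotation is enough in what
  follows.\<close>

lemma equidistant_average_bound:
  fixes \<phi> :: "real \<Rightarrow> real"
  assumes lip: "\<And>a b. a \<in> {0..<1} \<Longrightarrow> b \<in> {0..<1} \<Longrightarrow> \<bar>\<phi> a - \<phi> b\<bar> \<le> K * \<bar>a - b\<bar>" and K: "0 \<le> K"
    and int: "integrable unit_lborel \<phi>" "(\<integral>t. \<phi> t \<partial>unit_lborel) = 0" and M: "1 \<le> M"
  shows "\<bar>(\<Sum>l<M. \<phi> (real l / real M)) / real M\<bar> \<le> K / real M"
proof -
  interpret U: prob_space unit_lborel by (rule prob_space_unit)
  define J where "J l = {real l / real M..<real (Suc l) / real M}" for l
  define \<psi> where "\<psi> t = (\<Sum>l<M. \<phi> (real l / real M) * indicator (J l) t)" for t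
  have Jsub: "J l \<subseteq> {0..<1}" if "l < M" for l
  proof -
    have "real (Suc l) / real M \<le> 1" using that by simp
    then show ?thesis unfolding J_def by (auto intro: order_trans[rotated])
  qed
  have JU: "J l \<in> sets unit_lborel" if "l < M" for l
  proof -
    have "J l \<in> sets borel" unfolding J_def by simp
    with Jsub[OF that] show ?thesis by (simp add: sets_restrict_space_iff)
  qed
  have mJ: "measure unit_lborel (J l) = 1 / M" if "l < M" for l
  proof -
    have "measure unit_lborel (J l) = measure lborel (J l)"
      using Jsub[OF that] by (intro measure_restrict_space) auto
    also have "\<dots> = real (Suc l) / real M - real l / real M"
      unfolding J_def by (subst measure_lborel_Ico) (auto intro: divide_right_mono)
    also have "\<dots> = 1 / M" by (simp add: diff_divide_distrib[symmetric])
    finally show ?thesis .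
  qed
  have iJ: "integrable unit_lborel (\<lambda>t. \<phi> (real l / real M) * indicator (J l) t)" if "l < M" for l
    using JU[OF that] by (intro integrable_mult_right integrable_real_indicator) (auto simp: U.emeasure_finite less_top[symmetric])
  have i\<psi>: "integrable unit_lborel \<psi>"
    unfolding \<psi>_def[abs_def] by (rule Bochner_Integration.integrable_sum) (rule iJ, simp)
  have "(\<integral>t. \<psi> t \<partial>unit_lborel) = (\<Sum>l<M. \<integral>t. \<phi> (real l / real M) * indicator (J l) t \<partial>unit_lborel)"
    unfolding \<psi>_def using iJ by (intro Bochner_Integration.integral_sum) auto
  also have "\<dots> = (\<Sum>l<M. \<phi> (real l / real M) * (1 / M))"
  proof (intro sum.cong refl)
    fix l assume l: "l \<in> {..<M}"
    have "J l \<inter> space unit_lborel = J l" using Jsub l by (auto simp: space_restrict_space)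
    then show "(\<integral>t. \<phi> (real l / real M) * indicator (J l) t \<partial>unit_lborel) = \<phi> (real l / real M) * (1 / M)"
      using mJ[of l] l by simp
  qed
  also have "\<dots> = (\<Sum>l<M. \<phi> (real l / real M)) / real M" by (simp add: sum_divide_distrib)
  finally have \<psi>: "(\<integral>t. \<psi> t \<partial>unit_lborel) = (\<Sum>l<M. \<phi> (real l / real M)) / real M" .
  have close: "\<bar>\<psi> t - \<phi> t\<bar> \<le> K / M" if t: "t \<in> space unit_lborel" for t
  proof -
    have t: "0 \<le> t" "t < 1" using t by (auto simp: space_restrict_space)
    obtain l where lM: "l < M" and tl: "real l / M \<le> t" "t \<le> real l / M + 1 / M"
      and cell: "\<And>l'. real l' / M \<le> t \<and> t < real (Suc l') / M \<longleftrightarrow> l' = l"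
      using unit_interval_cell[OF t M] by blast
    have inJ: "t \<in> J l' \<longleftrightarrow> l' = l" for l'
      using cell[of l'] by (simp add: J_def)
    have "\<psi> t = (\<Sum>l'<M. if l' = l then \<phi> (real l / real M) else 0)"
      unfolding \<psi>_def by (intro sum.cong refl) (auto simp: inJ indicator_def)
    then have "\<psi> t = \<phi> (real l / real M)" using lM by simp
    moreover have "\<bar>\<phi> (real l / real M) - \<phi> t\<bar> \<le> K * \<bar>real l / real M - t\<bar>"
      using t lM by (intro lip) auto
    moreover have "K * \<bar>real l / real M - t\<bar> \<le> K * (1 / M)"
      using tl by (intro mult_left_mono K) auto
    ultimately show ?thesis by simp
  qed
  have "\<bar>(\<integral>t. \<psi> t \<partial>unit_lborel)\<bar> = \<bar>\<integral>t. \<psi> t - \<phi> t \<partial>unit_lborel\<bar>"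
    using i\<psi> int by simp
  also have "\<dots> \<le> (\<integral>t. \<bar>\<psi> t - \<phi> t\<bar> \<partial>unit_lborel)" by (rule integral_abs_bound)
  also have "\<dots> \<le> K / M"
    using close i\<psi> int by (intro U.integral_le_const) (auto intro!: AE_I2)
  finally show ?thesis unfolding \<psi> .
qed

text \<open>The vertical circle through x, entered at x and not at 0, is a rotated copy, so the mean
  along it is still 0.\<close>

lemma vertical_average_bound:
  assumes h: "torus_lip (Suc k) K h"
    and mean: "\<And>x. x \<in> torus (Suc k) \<Longrightarrow> (\<integral>t. h (x(k := t)) \<partial>unit_lborel) = 0"
    and x: "x \<in> torus (Suc k)" and M: "1 \<le> M"
  shows "\<bar>(\<Sum>l<M. h (vert_rot (Suc k) (real l / real M) x)) / real M\<bar> \<le> K / real M"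
proof (rule equidistant_average_bound[OF _ _ _ _ M, of "\<lambda>t. h (vert_rot (Suc k) t x)"])
  show "\<bar>h (vert_rot (Suc k) a x) - h (vert_rot (Suc k) b x)\<bar> \<le> K * \<bar>a - b\<bar>" for a b
    by (rule torus_lip_vert_rot_diff[OF h x]) auto
  show "0 \<le> K" using h by (simp add: torus_lip_def)
  have eq: "vert_rot (Suc k) t x = x(k := frac (t + x k))" for t
    by (simp add: vert_rot_def add.commute)
  have i: "integrable unit_lborel (\<lambda>t. h (x(k := t)))"
    by (rule torus_lip_unit_integrable[OF h x]) simp
  then have m: "(\<lambda>t. h (x(k := t))) \<in> borel_measurable unit_lborel" by auto
  show "integrable unit_lborel (\<lambda>t. h (vert_rot (Suc k) t x))"
    unfolding eq using i
    by (intro integrable_distr[OF measurable_unit_rotation, where f="\<lambda>t. h (x(k := t))"])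
       (simp add: unit_rotation_invariant)
  have "(\<integral>t. h (vert_rot (Suc k) t x) \<partial>unit_lborel) =
    (\<integral>t. h (x(k := t)) \<partial>distr unit_lborel unit_lborel (\<lambda>t. frac (t + x k)))"
    unfolding eq by (rule integral_distr[OF measurable_unit_rotation m, symmetric])
  then show "(\<integral>t. h (vert_rot (Suc k) t x) \<partial>unit_lborel) = 0"
    by (simp add: unit_rotation_invariant mean[OF x])
qed

context skew_product
begin

text \<open>By \<open>vertical_difference_tendsto\<close>, correlating h with h after T^n, or with a
  vertically rotated copy of it, makes no difference in the limit. The average of the copies over M
  equidistant rotations is of size K / M.\<close>

lemma haar_correlation_tendsto:
  assumes k: "1 \<le> k" "k < d" and erg: "vert_ergodic k"
    and deg: "\<And>x. x \<in> torus_pts (k - 1) \<Longrightarrow> circle_degree (\<lambda>t. f k (x(k - 1 := t))) \<noteq> 0"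
    and h: "torus_lip (Suc k) K h"
    and mean: "\<And>x. x \<in> torus (Suc k) \<Longrightarrow> (\<integral>t. h (x(k := t)) \<partial>unit_lborel) = 0"
  shows "(\<lambda>m. \<integral>x. h x * h ((T (Suc k) ^^ m) x) \<partial>haar_torus (Suc k)) \<longlonglongrightarrow> 0"
proof -
  let ?H = "haar_torus (Suc k)"
  interpret H: prob_space ?H by (rule prob_space_haar_torus)
  obtain C where C: "0 < C" "\<And>z. z \<in> torus (Suc k) \<Longrightarrow> \<bar>h z\<bar> \<le> C"
    using torus_lip_bounded[OF h] by blast
  have K: "0 \<le> K" using h by (simp add: torus_lip_def)
  note mh = torus_lip_measurable[OF h]
  define Tn where "Tn n = T (Suc k) ^^ n" for n
  have hpT: "haar_preserving (Suc k) (Tn n)" for n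
    unfolding Tn_def using k by (intro T_funpow_haar_preserving) auto
  note mT = haar_preserving_measurable[OF hpT]
  note hpR = vert_rot_haar_preserving[of k]
  note mR = haar_preserving_measurable[OF hpR]
  have mhT: "(\<lambda>x. h (Tn n x)) \<in> borel_measurable (torus_space (Suc k))" for n
    by (rule measurable_compose[OF mT mh])
  have mhRT: "(\<lambda>x. h (vert_rot (Suc k) t (Tn n x))) \<in> borel_measurable (torus_space (Suc k))" for n t
    by (rule measurable_compose[OF mT measurable_compose[OF mR mh]])
  have Tin: "Tn n x \<in> torus (Suc k)" if "x \<in> torus (Suc k)" for n x
    by (rule haar_preserving_in[OF hpT that])
  have RTin: "vert_rot (Suc k) t (Tn n x) \<in> torus (Suc k)" if "x \<in> torus (Suc k)" for n x t
    by (rule haar_preserving_in[OF hpR Tin[OF that]])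
  have prod_b: "\<bar>h x * h y\<bar> \<le> C * C" if "x \<in> torus (Suc k)" "y \<in> torus (Suc k)" for x y
    unfolding abs_mult using C that by (intro mult_mono) auto
  have ihT: "integrable ?H (\<lambda>x. h (Tn n x))" for n
    using C(2) Tin by (intro haar_integrable_bounded[OF mhT]) auto
  have ihRT: "integrable ?H (\<lambda>x. h (vert_rot (Suc k) t (Tn n x)))" for n t
    using C(2) RTin by (intro haar_integrable_bounded[OF mhRT]) auto
  have ic: "integrable ?H (\<lambda>x. h x * h (Tn n x))" for n
    using prod_b Tin mh mhT[of n] by (intro haar_integrable_bounded[where C="C * C"] borel_measurable_times) auto
  have icR: "integrable ?H (\<lambda>x. h x * h (vert_rot (Suc k) t (Tn n x)))" for n t
    using prod_b RTin mh mhRT[of t n] by (intro haar_integrable_bounded[where C="C * C"] borel_measurable_times) auto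
  define c where "c m = (\<integral>x. h x * h (Tn m x) \<partial>?H)" for m
  define cR where "cR t m = (\<integral>x. h x * h (vert_rot (Suc k) t (Tn m x)) \<partial>?H)" for t m
  have step: "(\<lambda>m. cR t m - c m) \<longlonglongrightarrow> 0" for t
  proof -
    \<comment> \<open>The lemma on push-forwards wants a measure, and h may change sign; adding its
      bound C makes it a density. The contribution of C cancels, as T^n and the rotation both
      preserve the integral of h.\<close>
    define w where "w x = h x + C" for x
    have w0: "0 \<le> w x" "w x \<le> 2 * C" if "x \<in> torus (Suc k)" for x
      using C(2)[OF that] unfolding w_def by linarith+
    have mw: "w \<in> borel_measurable ?H" unfolding w_def[abs_def] using mh by (simp add: measurable_haar_iff)
    have mp: "(\<lambda>x. restrict x {..<k}) \<in> measurable ?H (torus_space k)"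
      unfolding measurable_haar_iff by (rule measurable_torus_restrict) simp
    define \<mu> where "\<mu> = density ?H (\<lambda>x. ennreal (w x))"
    have "finite_measure \<mu>" unfolding \<mu>_def
      by (rule finite_measure_density_bounded[OF _ mw]) (use w0 in \<open>auto intro: H.finite_measure_axioms\<close>)
    moreover have "sets \<mu> = sets (torus_space (Suc k))" by (simp add: \<mu>_def sets_haar_torus)
    moreover have "absolutely_continuous (haar_torus k) (distr \<mu> (torus_space k) (\<lambda>x. restrict x {..<k}))"
      unfolding \<mu>_def
    proof (rule absolutely_continuous_distr_density[OF _ mp])
      show "absolutely_continuous (haar_torus k) (distr ?H (torus_space k) (\<lambda>x. restrict x {..<k}))"
        unfolding distr_haar_restrict by (simp add: absolutely_continuous_def)
    qed (use mw in simp)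
    ultimately have "(\<lambda>n. \<integral>z. h (vert_rot (Suc k) t (Tn n z)) - h (Tn n z) \<partial>\<mu>) \<longlonglongrightarrow> 0"
      unfolding Tn_def by (intro vertical_difference_tendsto[OF k erg deg h])
    moreover have "(\<integral>z. h (vert_rot (Suc k) t (Tn n z)) - h (Tn n z) \<partial>\<mu>) = cR t n - c n" for n
    proof -
      have "(\<integral>z. h (vert_rot (Suc k) t (Tn n z)) - h (Tn n z) \<partial>\<mu>) =
        (\<integral>z. w z *\<^sub>R (h (vert_rot (Suc k) t (Tn n z)) - h (Tn n z)) \<partial>?H)"
        unfolding \<mu>_def
      proof (rule integral_density)
        show "AE x in ?H. 0 \<le> w x" using w0 by (intro AE_I2) auto
        show "(\<lambda>z. h (vert_rot (Suc k) t (Tn n z)) - h (Tn n z)) \<in> borel_measurable ?H"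
          using mhRT[of t n] mhT[of n] by (simp add: measurable_haar_iff)
      qed (rule mw)
      also have "\<dots> = (\<integral>z. (h z * h (vert_rot (Suc k) t (Tn n z)) - h z * h (Tn n z))
          + C * (h (vert_rot (Suc k) t (Tn n z)) - h (Tn n z)) \<partial>?H)"
        by (rule Bochner_Integration.integral_cong) (auto simp: w_def algebra_simps)
      also have "\<dots> = cR t n - c n + C * ((\<integral>z. h (vert_rot (Suc k) t (Tn n z)) \<partial>?H) - (\<integral>z. h (Tn n z) \<partial>?H))"
        using icR[of t n] ic[of n] ihT[of n] ihRT[of t n] by (simp add: c_def cR_def)
      also have "(\<integral>z. h (vert_rot (Suc k) t (Tn n z)) \<partial>?H) = (\<integral>z. h (vert_rot (Suc k) t z) \<partial>?H)"
        by (rule haar_preserving_integral[OF hpT measurable_compose[OF mR mh]])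
      also have "\<dots> = (\<integral>z. h z \<partial>?H)" by (rule haar_preserving_integral[OF hpR mh])
      also have "(\<integral>z. h (Tn n z) \<partial>?H) = (\<integral>z. h z \<partial>?H)" by (rule haar_preserving_integral[OF hpT mh])
      finally show ?thesis by simp
    qed
    ultimately show ?thesis by simp
  qed
  have "c \<longlonglongrightarrow> 0"
  proof (rule LIMSEQ_I)
    fix e :: real assume e: "0 < e"
    obtain M :: nat where M: "2 * C * K / e + 1 < real M" using reals_Archimedean2 by blast
    have "0 \<le> 2 * C * K / e" using C K e by simp
    then have M1: "1 \<le> M" using M by linarith
    have CM: "C * (K / M) < e / 2"
    proof -
      have "2 * C * K / e < real M" using M by simp
      then show ?thesis using e M1 by (simp add: field_simps)
    qed
    \<comment> \<open>The mean of the M rotated correlations: small for every m because h has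
      vertical mean 0, and close to c m for large m by \<open>step\<close>.\<close>
    define a where "a m = (\<Sum>l<M. cR (real l / real M) m) / M" for m
    have a_le: "\<bar>a m\<bar> \<le> C * (K / M)" for m
    proof -
      have "a m = (\<integral>x. (\<Sum>l<M. h x * h (vert_rot (Suc k) (real l / real M) (Tn m x))) \<partial>?H) / M"
        unfolding a_def cR_def by (subst Bochner_Integration.integral_sum) (use icR in auto)
      also have "\<dots> = (\<integral>x. (\<Sum>l<M. h x * h (vert_rot (Suc k) (real l / real M) (Tn m x))) / M \<partial>?H)" by simp
      also have "\<bar>\<dots>\<bar> \<le> (\<integral>x. \<bar>(\<Sum>l<M. h x * h (vert_rot (Suc k) (real l / real M) (Tn m x))) / M\<bar> \<partial>?H)"
        by (rule integral_abs_bound)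
      also have "\<dots> \<le> C * (K / M)"
      proof (rule haar_integral_le_const)
        show "integrable ?H (\<lambda>x. \<bar>(\<Sum>l<M. h x * h (vert_rot (Suc k) (real l / real M) (Tn m x))) / M\<bar>)"
          using icR by auto
        fix x assume x: "x \<in> torus (Suc k)"
        have "\<bar>(\<Sum>l<M. h x * h (vert_rot (Suc k) (real l / real M) (Tn m x))) / M\<bar>
           = \<bar>h x\<bar> * \<bar>(\<Sum>l<M. h (vert_rot (Suc k) (real l / real M) (Tn m x))) / M\<bar>"
          by (simp add: sum_distrib_left[symmetric] abs_mult)
        also have "\<dots> \<le> C * (K / M)"
          using C(1) C(2)[OF x] vertical_average_bound[OF h mean Tin[OF x] M1] by (intro mult_mono) auto
        finally show "\<bar>(\<Sum>l<M. h x * h (vert_rot (Suc k) (real l / real M) (Tn m x))) / M\<bar> \<le> C * (K / M)" .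
      qed
      finally show ?thesis .
    qed
    have "(\<lambda>m. (\<Sum>l<M. cR (real l / real M) m - c m) / M) \<longlonglongrightarrow> (\<Sum>l<M. 0) / M"
      using M1 by (intro tendsto_divide tendsto_sum step tendsto_const) auto
    moreover have "(\<Sum>l<M. cR (real l / real M) m - c m) / M = a m - c m" for m
      using M1 by (simp add: a_def sum_subtractf diff_divide_distrib)
    ultimately have "(\<lambda>m. a m - c m) \<longlonglongrightarrow> 0" by simp
    from LIMSEQ_D[OF this, of "e / 2"] e
    obtain m0 where m0: "\<And>m. m0 \<le> m \<Longrightarrow> \<bar>a m - c m\<bar> < e / 2" by auto
    show "\<exists>no. \<forall>m\<ge>no. norm (c m - 0) < e"
    proof (intro exI allI impI)
      fix m assume "m0 \<le> m"
      from m0[OF this] a_le[of m] CM show "norm (c m - 0) < e"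
        unfolding real_norm_def diff_0_right by linarith
    qed
  qed
  then show ?thesis unfolding c_def Tn_def .
qed

text \<open>Decay of correlations makes the off-diagonal terms in the square of the ergodic sum negligible.\<close>
lemma vert_ergodic_Suc:
  assumes k: "1 \<le> k" "k < d" and erg: "vert_ergodic k"
    and deg: "\<And>x. x \<in> torus_pts (k - 1) \<Longrightarrow> circle_degree (\<lambda>t. f k (x(k - 1 := t))) \<noteq> 0"
  shows "vert_ergodic (Suc k)"
  unfolding vert_ergodic_def
proof (intro allI impI)
  fix K h assume h: "torus_lip (Suc k) K h"
    and "\<forall>x\<in>torus (Suc k). (\<integral>t. h (x(Suc k - 1 := t)) \<partial>unit_lborel) = 0"
  then have mean: "\<And>x. x \<in> torus (Suc k) \<Longrightarrow> (\<integral>t. h (x(k := t)) \<partial>unit_lborel) = 0" by simp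
  let ?H = "haar_torus (Suc k)"
  interpret H: prob_space ?H by (rule prob_space_haar_torus)
  obtain C where C: "0 < C" "\<And>z. z \<in> torus (Suc k) \<Longrightarrow> \<bar>h z\<bar> \<le> C"
    using torus_lip_bounded[OF h] by blast
  note mh = torus_lip_measurable[OF h]
  define Tn where "Tn n = T (Suc k) ^^ n" for n
  have hpT: "haar_preserving (Suc k) (Tn n)" for n
    unfolding Tn_def using k by (intro T_funpow_haar_preserving) auto
  note mT = haar_preserving_measurable[OF hpT]
  have mhT: "(\<lambda>x. h (Tn n x)) \<in> borel_measurable (torus_space (Suc k))" for n
    by (rule measurable_compose[OF mT mh])
  have Tin: "Tn n x \<in> torus (Suc k)" if "x \<in> torus (Suc k)" for n x
    by (rule haar_preserving_in[OF hpT that])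
  have hTb: "\<bar>h (Tn n x)\<bar> \<le> C" if "x \<in> torus (Suc k)" for n x
    by (rule C(2)[OF Tin[OF that]])
  have ihh: "integrable ?H (\<lambda>x. h (Tn i x) * h (Tn j x))" for i j
  proof (rule haar_integrable_bounded[where C="C * C"])
    show "(\<lambda>x. h (Tn i x) * h (Tn j x)) \<in> borel_measurable (torus_space (Suc k))"
      using mhT[of i] mhT[of j] by measurable
    show "\<bar>h (Tn i x) * h (Tn j x)\<bar> \<le> C * C" if "x \<in> torus (Suc k)" for x
      unfolding abs_mult using hTb[OF that] C(1) by (intro mult_mono) auto
  qed
  define c where "c m = (\<integral>x. h x * h (Tn m x) \<partial>?H)" for m
  have c0: "c \<longlonglongrightarrow> 0" unfolding c_def Tn_def by (rule haar_correlation_tendsto[OF k erg deg h mean])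
  have corr: "(\<integral>x. h (Tn i x) * h (Tn (i + m) x) \<partial>?H) = c m" for i m
  proof -
    have "Tn (i + m) x = Tn m (Tn i x)" for x
      unfolding Tn_def by (simp add: funpow_add add.commute[of i m])
    then have "(\<integral>x. h (Tn i x) * h (Tn (i + m) x) \<partial>?H) = (\<integral>x. h (Tn i x) * h (Tn m (Tn i x)) \<partial>?H)" by simp
    also have "\<dots> = c m" unfolding c_def
      using mh mhT[of m] by (intro haar_preserving_integral[OF hpT, of "\<lambda>x. h x * h (Tn m x)"]) auto
    finally show ?thesis .
  qed
  have cb: "\<bar>c m\<bar> \<le> C * C" for m
  proof -
    have "\<bar>c m\<bar> \<le> (\<integral>x. \<bar>h x * h (Tn m x)\<bar> \<partial>?H)" unfolding c_def by (rule integral_abs_bound)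
    also have "\<dots> \<le> C * C"
    proof (rule haar_integral_le_const)
      show "integrable ?H (\<lambda>x. \<bar>h x * h (Tn m x)\<bar>)"
        using ihh[of 0 m] by (simp add: Tn_def)
      show "\<bar>h x * h (Tn m x)\<bar> \<le> C * C" if "x \<in> torus (Suc k)" for x
        unfolding abs_mult using hTb[OF that] C that by (intro mult_mono) auto
    qed
    finally show ?thesis .
  qed
  show "(\<lambda>n. \<integral>x. \<bar>(\<Sum>j<n. h ((T (Suc k) ^^ j) x)) / n\<bar> \<partial>?H) \<longlonglongrightarrow> 0"
  proof (rule LIMSEQ_I)
    fix e :: real assume e: "0 < e"
    \<comment> \<open>Far pairs and near-diagonal pairs each get \<epsilon>, so the mean square is
      at most (e / 2)^2 and the mean at most e / 2.\<close>
    define \<epsilon> where "\<epsilon> = (e / 2)\<^sup>2 / 2"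
    have \<epsilon>: "0 < \<epsilon>" using e by (simp add: \<epsilon>_def)
    from LIMSEQ_D[OF c0 \<epsilon>] obtain m0 where m0: "\<And>m. m0 \<le> m \<Longrightarrow> \<bar>c m\<bar> < \<epsilon>" by auto
    obtain n1 where n1: "2 * m0 * (C * C) / \<epsilon> < real n1" using reals_Archimedean2 by blast
    show "\<exists>no. \<forall>n\<ge>no. norm ((\<integral>x. \<bar>(\<Sum>j<n. h ((T (Suc k) ^^ j) x)) / n\<bar> \<partial>?H) - 0) < e"
    proof (intro exI allI impI)
      fix n assume "max n1 1 \<le> n"
      then have n: "n1 \<le> n" "1 \<le> n" by auto
      \<comment> \<open>The correlation depends on the time difference alone. From m0 on it is below
        \<epsilon>; closer to the diagonal the trivial bound is taken, and a row of the double sum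
        contains at most 2 m0 such pairs.\<close>
      have pair: "(\<integral>x. h (Tn i x) * h (Tn j x) \<partial>?H) \<le> \<epsilon> + (if i < j + m0 \<and> j < i + m0 then C * C else 0)" for i j
      proof -
        define m where "m = (if i \<le> j then j - i else i - j)"
        have "(\<integral>x. h (Tn i x) * h (Tn j x) \<partial>?H) = c m"
        proof (cases "i \<le> j")
          case True
          then show ?thesis using corr[of i "j - i"] by (simp add: m_def)
        next
          case False
          then show ?thesis using corr[of j "i - j"] by (simp add: m_def mult.commute)
        qed
        moreover have "c m \<le> \<epsilon> + (if i < j + m0 \<and> j < i + m0 then C * C else 0)"
        proof (cases "i < j + m0 \<and> j < i + m0")
          case True
          then show ?thesis using cb[of m] \<epsilon> by simp
        next
          case False
          then have "m0 \<le> m" unfolding m_def by auto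
          from m0[OF this] False show ?thesis by auto
        qed
        ultimately show ?thesis by simp
      qed
      have row: "(\<Sum>j<n. \<epsilon> + (if i < j + m0 \<and> j < i + m0 then C * C else 0)) \<le> n * \<epsilon> + 2 * m0 * (C * C)" for i
      proof -
        have "(\<Sum>j<n. if i < j + m0 \<and> j < i + m0 then C * C else 0)
           = (\<Sum>j\<in>{j\<in>{..<n}. i < j + m0 \<and> j < i + m0}. C * C)"
          by (rule sum.inter_filter[symmetric]) simp
        also have "\<dots> = card {j\<in>{..<n}. i < j + m0 \<and> j < i + m0} * (C * C)" by simp
        also have "\<dots> \<le> (2 * m0) * (C * C)"
        proof (intro mult_right_mono)
          have "card {j\<in>{..<n}. i < j + m0 \<and> j < i + m0} \<le> card {i - m0..<i + m0}"
            by (rule card_mono) auto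
          also have "\<dots> \<le> 2 * m0" by simp
          finally show "real (card {j\<in>{..<n}. i < j + m0 \<and> j < i + m0}) \<le> real (2 * m0)" by simp
        qed (use C in simp)
        finally show ?thesis by (simp add: sum.distrib)
      qed
      let ?A = "\<lambda>x. (\<Sum>j<n. h (Tn j x)) / n"
      have mA: "?A \<in> borel_measurable (torus_space (Suc k))" using mhT by measurable
      have Ab: "\<bar>?A x\<bar> \<le> C" if x: "x \<in> torus (Suc k)" for x
      proof -
        have "\<bar>\<Sum>j<n. h (Tn j x)\<bar> \<le> (\<Sum>j<n. \<bar>h (Tn j x)\<bar>)" by (rule sum_abs)
        also have "\<dots> \<le> (\<Sum>j<n. C)" by (intro sum_mono hTb[OF x])
        finally show ?thesis using n by (simp add: field_simps)
      qed
      have iA: "integrable ?H ?A" by (rule haar_integrable_bounded[OF mA Ab])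
      have A2: "(?A x)\<^sup>2 = (\<Sum>i<n. \<Sum>j<n. h (Tn i x) * h (Tn j x)) / (real n)\<^sup>2" for x
        unfolding power_divide by (simp add: power2_eq_square sum_product)
      have iA2: "integrable ?H (\<lambda>x. (?A x)\<^sup>2)"
        unfolding A2 using ihh by auto
      have "(\<integral>x. (?A x)\<^sup>2 \<partial>?H) = (\<Sum>i<n. \<Sum>j<n. \<integral>x. h (Tn i x) * h (Tn j x) \<partial>?H) / (real n)\<^sup>2"
        unfolding A2 using ihh by (simp add: Bochner_Integration.integral_sum)
      also have "\<dots> \<le> (\<Sum>i<n. n * \<epsilon> + 2 * m0 * (C * C)) / (real n)\<^sup>2"
        by (intro divide_right_mono sum_mono order_trans[OF sum_mono[OF pair] row]) simp
      also have "\<dots> = \<epsilon> + 2 * m0 * (C * C) / n"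
        using n by (simp add: power2_eq_square field_simps)
      also have "\<dots> \<le> \<epsilon> + \<epsilon>"
      proof -
        have "2 * m0 * (C * C) / \<epsilon> < real n" using n1 n(1) by (meson less_le_trans of_nat_le_iff)
        then have "2 * m0 * (C * C) / n \<le> \<epsilon>" using \<epsilon> n by (simp add: field_simps)
        then show ?thesis by simp
      qed
      also have "\<dots> = (e / 2)\<^sup>2" by (simp add: \<epsilon>_def)
      finally have "(\<integral>x. \<bar>?A x\<bar> \<partial>?H) \<le> e / 2"
        using e by (intro H.integral_abs_le_of_square iA iA2) auto
      moreover have "0 \<le> (\<integral>x. \<bar>?A x\<bar> \<partial>?H)" by (rule Bochner_Integration.integral_nonneg) simp
      ultimately show "norm ((\<integral>x. \<bar>(\<Sum>j<n. h ((T (Suc k) ^^ j) x)) / n\<bar> \<partial>?H) - 0) < e"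
        using e unfolding Tn_def real_norm_def diff_0_right by linarith
    qed
  qed
qed

section \<open>Base case: the irrational rotation\<close>

lemma T_1_funpow:
  assumes "1 \<le> d" "x \<in> torus 1"
  shows "(T 1 ^^ n) x = vert_rot 1 (n * \<alpha>) x"
proof (induction n)
  case 0
  then show ?case using vert_rot_0[OF assms(2)] by simp
next
  case (Suc n)
  have T1: "T 1 y = vert_rot 1 \<alpha> y" if "y \<in> torus 1" for y
    using that by (auto simp: skew_map_def vert_rot_def fun_eq_iff in_torus_space_iff extensional_def)
  have "vert_rot 1 (n * \<alpha>) x \<in> torus 1" using assms by (intro vert_rot_in) auto
  then show ?case using Suc T1 by (simp add: vert_rot_add algebra_simps)
qed

text \<open>A rotation of the starting point by l / M is imitated by a delay of q l steps, and a
  bounded delay does not affect long averages. So all M rotated starting points have nearly the same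
  average, whereas their mean is almost 0; the bound is uniform in x.\<close>

lemma vert_ergodic_1:
  assumes d: "1 \<le> d" and irr: "\<alpha> \<notin> \<rat>"
  shows "vert_ergodic 1"
  unfolding vert_ergodic_def
proof (intro allI impI)
  fix K h assume h: "torus_lip 1 K h"
    and "\<forall>x\<in>torus 1. (\<integral>t. h (x(1 - 1 := t)) \<partial>unit_lborel) = 0"
  then have mean: "\<And>x. x \<in> torus 1 \<Longrightarrow> (\<integral>t. h (x(0 := t)) \<partial>unit_lborel) = 0" by simp
  obtain C where C: "0 < C" "\<And>z. z \<in> torus 1 \<Longrightarrow> \<bar>h z\<bar> \<le> C"
    using torus_lip_bounded[OF h] by blast
  have K: "0 \<le> K" using h by (simp add: torus_lip_def)
  define a where "a x j = h (vert_rot 1 (real j * \<alpha>) x)" for x j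
  have rin: "vert_rot 1 t x \<in> torus 1" if "x \<in> torus 1" for t x
    using that by (intro vert_rot_in) auto
  have ab: "\<bar>a x j\<bar> \<le> C" if "x \<in> torus 1" for x j
    unfolding a_def by (rule C(2)[OF rin[OF that]])
  \<comment> \<open>Each unit of delay drops one term and gains one, a change of at most 2
    C.\<close>
  have tele: "\<bar>(\<Sum>j<n. a x (j + q)) - (\<Sum>j<n. a x j)\<bar> \<le> 2 * q * C" if x: "x \<in> torus 1" for x n q
  proof (induction q)
    case (Suc q)
    have "(\<Sum>j<n. a x (j + Suc q)) - (\<Sum>j<n. a x (j + q)) = a x (n + q) - a x q"
      using sum_lessThan_telescope[of "\<lambda>j. a x (j + q)" n] by (simp add: sum_subtractf)
    moreover have "\<bar>a x (n + q) - a x q\<bar> \<le> 2 * C" using ab[OF x, of "n + q"] ab[OF x, of q] by linarith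
    moreover have "2 * real (Suc q) * C = 2 * real q * C + 2 * C" by (simp add: algebra_simps)
    ultimately show ?case using Suc by linarith
  qed simp
  show "(\<lambda>n. \<integral>x. \<bar>(\<Sum>j<n. h ((T 1 ^^ j) x)) / n\<bar> \<partial>haar_torus 1) \<longlonglongrightarrow> 0"
  proof (rule LIMSEQ_I)
    fix e :: real assume e: "0 < e"
    obtain M :: nat where M: "4 * K / e + 1 < real M" using reals_Archimedean2 by blast
    have "0 \<le> 4 * K / e" using K e by simp
    then have M1: "1 \<le> M" using M by linarith
    have KM: "K / M < e / 4"
    proof -
      have "4 * K / e < real M" using M by simp
      then show ?thesis using e M1 by (simp add: field_simps)
    qed
    \<comment> \<open>Irrationality enters here: the multiples of \<alpha> come within 1 / M of
      every l / M.\<close>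
    have "\<exists>q. \<bar>frac (real q * \<alpha>) - real l / real M\<bar> < 1 / M" if "l < M" for l
      using Kronecker_approx_1_explicit[OF irr, of "real l / real M" "1 / M"] M1 that by (auto simp: field_simps)
    then obtain q where q: "\<And>l. l < M \<Longrightarrow> \<bar>frac (real (q l) * \<alpha>) - real l / real M\<bar> < 1 / M" by metis
    \<comment> \<open>One bound for all delays q l; a sum is simpler to handle than a
      maximum.\<close>
    define Q where "Q = (\<Sum>l<M. q l)"
    have qQ: "q l \<le> Q" if "l < M" for l unfolding Q_def using that by (intro member_le_sum) auto
    obtain n1 where n1: "8 * Q * C / e < real n1" using reals_Archimedean2 by blast
    show "\<exists>no. \<forall>n\<ge>no. norm ((\<integral>x. \<bar>(\<Sum>j<n. h ((T 1 ^^ j) x)) / n\<bar> \<partial>haar_torus 1) - 0) < e"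
    proof (intro exI allI impI)
      fix n assume "max n1 1 \<le> n"
      then have n: "n1 \<le> n" "1 \<le> n" by auto
      have nQ: "2 * Q * C / n < e / 4"
      proof -
        have "8 * Q * C / e < real n" using n1 n(1) by (meson less_le_trans of_nat_le_iff)
        then show ?thesis using e n by (simp add: field_simps)
      qed
      define A where "A x = (\<Sum>j<n. a x j) / n" for x
      have shift: "\<bar>A (vert_rot 1 (real l / real M) x) - A x\<bar> \<le> K / M + 2 * Q * C / n"
        if x: "x \<in> torus 1" and l: "l < M" for x l
      proof -
        let ?y = "vert_rot 1 (real l / real M) x"
        have 1: "\<bar>a ?y j - a x (j + q l)\<bar> \<le> K / M" for j
        proof -
          define \<delta> where "\<delta> = real l / real M - frac (real (q l) * \<alpha>)"
          have "\<bar>h (vert_rot 1 (real j * \<alpha> + real l / real M) x) - h (vert_rot 1 (real (j + q l) * \<alpha>) x)\<bar> \<le> K * \<bar>\<delta>\<bar>"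
          proof (rule torus_lip_vert_rot_diff[OF h x])
            have "real j * \<alpha> + real l / real M - real (j + q l) * \<alpha> - \<delta> = - of_int \<lfloor>real (q l) * \<alpha>\<rfloor>"
              by (simp add: \<delta>_def frac_def algebra_simps)
            then show "real j * \<alpha> + real l / real M - real (j + q l) * \<alpha> - \<delta> \<in> \<int>" by simp
          qed auto
          also have "\<dots> \<le> K * (1 / M)"
            using q[OF l] K by (intro mult_left_mono) (auto simp: \<delta>_def abs_minus_commute)
          finally show ?thesis unfolding a_def by (simp add: vert_rot_add)
        qed
        have "\<bar>(\<Sum>j<n. a ?y j) - (\<Sum>j<n. a x (j + q l))\<bar> \<le> (\<Sum>j<n. \<bar>a ?y j - a x (j + q l)\<bar>)"
          unfolding sum_subtractf[symmetric] by (rule sum_abs)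
        also have "\<dots> \<le> (\<Sum>j<n. K / M)" by (intro sum_mono 1)
        finally have 2: "\<bar>(\<Sum>j<n. a ?y j) - (\<Sum>j<n. a x (j + q l))\<bar> \<le> n * (K / M)" by simp
        have "2 * real (q l) * C \<le> 2 * real Q * C" using qQ[OF l] C(1) by (intro mult_right_mono) auto
        then have "\<bar>(\<Sum>j<n. a ?y j) - (\<Sum>j<n. a x j)\<bar> \<le> n * (K / M) + 2 * Q * C"
          using 2 tele[OF x, of "q l" n] by linarith
        then have "\<bar>(\<Sum>j<n. a ?y j) - (\<Sum>j<n. a x j)\<bar> / n \<le> (n * (K / M) + 2 * Q * C) / n"
          by (rule divide_right_mono) simp
        moreover have "A ?y - A x = ((\<Sum>j<n. a ?y j) - (\<Sum>j<n. a x j)) / n"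
          unfolding A_def by (rule diff_divide_distrib[symmetric])
        moreover have "(n * (K / M) + 2 * Q * C) / n = K / M + 2 * Q * C / n"
          using n by (simp add: add_divide_distrib)
        ultimately show ?thesis by simp
      qed
      have bound: "\<bar>A x\<bar> < 3 * e / 4" if x: "x \<in> torus 1" for x
      proof -
        \<comment> \<open>The mean of A over the rotated starting points. Summing over l first
          bounds it by K / M; comparing it with A x term by term costs K / M + 2 Q C / n. Each of
          the three summands is below e / 4.\<close>
        define S where "S = (\<Sum>l<M. A (vert_rot 1 (real l / real M) x)) / M"
        define u where "u j = (\<Sum>l<M. h (vert_rot 1 (real l / real M) (vert_rot 1 (real j * \<alpha>) x))) / M" for j
        have u: "\<bar>u j\<bar> \<le> K / M" for j
          unfolding u_def
          using vertical_average_bound[of 0 K h "vert_rot 1 (real j * \<alpha>) x" M] h mean rin[OF x] M1 by simp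
        have "S = (\<Sum>j<n. u j) / n"
          unfolding S_def A_def a_def u_def sum_divide_distrib[symmetric]
          by (subst sum.swap) (simp add: vert_rot_add add.commute)
        also have "\<bar>\<dots>\<bar> \<le> (\<Sum>j<n. \<bar>u j\<bar>) / n"
          by (simp add: divide_right_mono)
        also have "\<dots> \<le> (\<Sum>j<n. K / M) / n"
          by (intro divide_right_mono sum_mono u) simp
        also have "\<dots> = K / M" using n by simp
        finally have S: "\<bar>S\<bar> \<le> K / M" .
        have "S - A x = (\<Sum>l<M. A (vert_rot 1 (real l / real M) x) - A x) / M"
          using M1 by (simp add: S_def sum_subtractf diff_divide_distrib)
        also have "\<bar>\<dots>\<bar> \<le> (\<Sum>l<M. \<bar>A (vert_rot 1 (real l / real M) x) - A x\<bar>) / M"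
          by (simp add: divide_right_mono)
        also have "\<dots> \<le> (\<Sum>l<M. K / M + 2 * Q * C / n) / M"
          using shift[OF x] by (intro divide_right_mono sum_mono) auto
        also have "\<dots> = K / M + 2 * Q * C / n" using M1 by simp
        finally show ?thesis using S KM nQ by linarith
      qed
      have mA: "(\<lambda>x. \<bar>A x\<bar>) \<in> borel_measurable (torus_space 1)"
      proof -
        have "vert_rot 1 t \<in> measurable (torus_space 1) (torus_space 1)" for t
          using haar_preserving_measurable[OF vert_rot_haar_preserving[of 0 t]] by simp
        from measurable_compose[OF this torus_lip_measurable[OF h]]
        show ?thesis unfolding A_def a_def by measurable
      qed
      have "(\<integral>x. \<bar>(\<Sum>j<n. h ((T 1 ^^ j) x)) / n\<bar> \<partial>haar_torus 1) = (\<integral>x. \<bar>A x\<bar> \<partial>haar_torus 1)"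
        by (rule Bochner_Integration.integral_cong)
           (simp_all only: space_haar_torus T_1_funpow[OF d] A_def a_def)
      also have "\<dots> \<le> 3 * e / 4"
        using bound by (intro haar_integral_le_const haar_integrable_bounded[OF mA, where C="3 * e / 4"])
          (auto intro: less_imp_le)
      finally have "(\<integral>x. \<bar>(\<Sum>j<n. h ((T 1 ^^ j) x)) / n\<bar> \<partial>haar_torus 1) \<le> 3 * e / 4" .
      moreover have "0 \<le> (\<integral>x. \<bar>(\<Sum>j<n. h ((T 1 ^^ j) x)) / n\<bar> \<partial>haar_torus 1)" by simp
      ultimately show "norm ((\<integral>x. \<bar>(\<Sum>j<n. h ((T 1 ^^ j) x)) / n\<bar> \<partial>haar_torus 1) - 0) < e"
        using e unfolding real_norm_def diff_0_right by linarith
    qed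
  qed
qed

end

subsection \<open>Invariance of the limit\<close>

text \<open>By \<open>torus_box_approx\<close> and dominated convergence, integrals of Lipschitz
  functions determine the measure of each box, and the boxes form a generating system stable under
  intersection.\<close>

lemma torus_measure_eqI:
  assumes M: "finite_measure M" "sets M = sets (torus_space k)"
    and N: "finite_measure N" "sets N = sets (torus_space k)"
    and eq: "\<And>L g. torus_lip k L g \<Longrightarrow> (\<integral>x. g x \<partial>M) = (\<integral>x. g x \<partial>N)"
  shows "M = N"
proof (rule measure_eqI_generator_eq[OF Int_stable_torus_boxes torus_boxes_subset])
  interpret M: finite_measure M by (rule M)
  interpret N: finite_measure N by (rule N)
  have lim: "(\<lambda>i. \<integral>x. \<phi> i x \<partial>P) \<longlonglongrightarrow> measure P A"
    if P: "finite_measure P" "sets P = sets (torus_space k)" and A: "A \<in> torus_boxes k"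
      and p: "\<And>M. \<exists>L. torus_lip k L (\<phi> M)" "\<And>M x. \<bar>\<phi> M x\<bar> \<le> 2 ^ k"
      "\<And>x. x \<in> torus k \<Longrightarrow> (\<lambda>M. \<phi> M x) \<longlonglongrightarrow> indicator A x"
    for P A and \<phi> :: "nat \<Rightarrow> (nat \<Rightarrow> real) \<Rightarrow> real"
  proof -
    interpret P: finite_measure P by (rule P)
    have sp: "space P = torus k" by (rule sets_eq_imp_space_eq[OF P(2)])
    have As: "A \<in> sets P" using torus_boxes_sets[OF A] P(2) by simp
    have "(\<lambda>i. \<integral>x. \<phi> i x \<partial>P) \<longlonglongrightarrow> (\<integral>x. indicator A x \<partial>P)"
    proof (rule integral_dominated_convergence)
      show "(indicator A :: _ \<Rightarrow> real) \<in> borel_measurable P" using As by simp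
      show "\<phi> i \<in> borel_measurable P" for i
        using p(1)[of i] torus_lip_measurable measurable_cong_sets[OF P(2) refl] by blast
      show "integrable P (\<lambda>_. 2 ^ k :: real)" by (rule P.integrable_const)
      show "AE x in P. (\<lambda>i. \<phi> i x) \<longlonglongrightarrow> indicator A x" using p(3) by (intro AE_I2) (simp add: sp)
      show "AE x in P. norm (\<phi> i x) \<le> 2 ^ k" for i using p(2) by (intro AE_I2) simp
    qed
    also have "(\<integral>x. indicator A x \<partial>P) = measure P A"
      using As sets.sets_into_space[OF As] by (simp add: Int_absorb2)
    finally show ?thesis .
  qed
  show "emeasure M A = emeasure N A" if A: "A \<in> torus_boxes k" for A
  proof -
    obtain \<phi> :: "nat \<Rightarrow> (nat \<Rightarrow> real) \<Rightarrow> real" where p: "\<And>M. \<exists>L. torus_lip k L (\<phi> M)"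
      "\<And>M x. \<bar>\<phi> M x\<bar> \<le> 2 ^ k" "\<And>x. x \<in> torus k \<Longrightarrow> (\<lambda>M. \<phi> M x) \<longlonglongrightarrow> indicator A x"
      using torus_box_approx[OF A] by blast
    have "(\<integral>x. \<phi> i x \<partial>M) = (\<integral>x. \<phi> i x \<partial>N)" for i using p(1)[of i] eq by blast
    with lim[OF M A p] lim[OF N A p] have "measure M A = measure N A"
      using LIMSEQ_unique by simp
    then show ?thesis by (simp add: M.emeasure_eq_measure N.emeasure_eq_measure)
  qed
  show "sets M = sigma_sets (torus k) (torus_boxes k)" using M(2) by (simp add: sets_torus_space)
  show "sets N = sigma_sets (torus k) (torus_boxes k)" using N(2) by (simp add: sets_torus_space)
  show "range (\<lambda>_::nat. torus k) \<subseteq> torus_boxes k" using space_in_torus_boxes by auto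
  show "emeasure M (torus k) \<noteq> \<infinity>" by simp
qed auto

theorem theorem4p1:
  fixes d :: nat and \<alpha> :: real and f :: "nat \<Rightarrow> (nat \<Rightarrow> real) \<Rightarrow> real"
    and \<mu> \<nu> :: "(nat \<Rightarrow> real) measure"
  assumes "d \<ge> 2" and "\<alpha> \<notin> \<rat>"
    and "\<forall>k\<in>{1..<d}. depends_on_first k (f k)"
    and "\<forall>k\<in>{1..<d}. lipschitz_torus k (f k)"
    and "\<forall>k\<in>{1..<d}. \<forall>x\<in>torus_pts (k - 1).
           circle_degree (\<lambda>t. f k (x(k - 1 := t))) \<noteq> 0"
    and "prob_space \<mu>" and "sets \<mu> = sets (torus_space d)"
    and "absolutely_continuous (haar_torus (d - 1))
           (distr \<mu> (torus_space (d - 1)) (\<lambda>x. restrict x {..<d - 1}))"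
    and "prob_space \<nu>" and "sets \<nu> = sets (torus_space d)"
    and "weak_star_limit_point d (\<lambda>n. distr \<mu> (torus_space d) (skew_map d \<alpha> f ^^ n)) \<nu>"
  shows "\<forall>t::real. distr \<nu> (torus_space d) (vert_rot d t) = \<nu>"
proof
  fix t :: real
  interpret skew_product d \<alpha> f
    by unfold_locales (use assms(3,4) in auto)
  interpret \<mu>: prob_space \<mu> by (rule assms)
  interpret \<nu>: prob_space \<nu> by (rule assms)
  have deg: "circle_degree (\<lambda>t. f k (x(k - 1 := t))) \<noteq> 0"
    if "1 \<le> k" "k < d" "x \<in> torus_pts (k - 1)" for k x
    using assms(5) that by auto
  \<comment> \<open>Only the base up to dimension d - 1 is treated by induction; the last coordinate
    is handled by \<open>vertical_difference_tendsto\<close>, where \<mu> itself enters.\<close>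
  have erg: "vert_ergodic k" if "1 \<le> k" "k \<le> d - 1" for k
    using that
  proof (induction k rule: nat_induct_at_least)
    case base
    show ?case using assms(1,2) by (intro vert_ergodic_1) auto
  next
    case (Suc n)
    then show ?case using deg by (intro vert_ergodic_Suc) auto
  qed
  define k where "k = d - 1"
  have k: "1 \<le> k" "k < d" "Suc k = d" using assms(1) by (auto simp: k_def)
  have mT: "skew_map d \<alpha> f ^^ n \<in> measurable \<mu> (torus_space d)" for n
    using T_funpow_measurable[of d n] unfolding measurable_cong_sets[OF assms(7) refl] by simp
  have mR0: "vert_rot d t \<in> measurable (torus_space d) (torus_space d)"
    using haar_preserving_measurable[OF vert_rot_haar_preserving[of k t]] k by simp
  then have mR: "vert_rot d t \<in> measurable \<nu> (torus_space d)"
    using measurable_cong_sets[OF assms(10) refl] by blast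
  obtain r where r: "strict_mono r" and lim: "\<And>g. torus_continuous d g \<Longrightarrow>
    (\<lambda>j. integral\<^sup>L (distr \<mu> (torus_space d) (skew_map d \<alpha> f ^^ r j)) g) \<longlonglongrightarrow> integral\<^sup>L \<nu> g"
    using assms(11) unfolding weak_star_limit_point_def by blast
  show "distr \<nu> (torus_space d) (vert_rot d t) = \<nu>"
  proof (rule torus_measure_eqI[where k=d])
    show "finite_measure (distr \<nu> (torus_space d) (vert_rot d t))"
      by (rule \<nu>.finite_measure_distr[OF mR])
    show "finite_measure \<nu>" by (rule \<nu>.finite_measure_axioms)
    fix L g assume g: "torus_lip d L g"
    define g' where "g' x = g (vert_rot d t x)" for x
    have g': "torus_lip d L g'"
      unfolding g'_def using assms(1) by (intro torus_lip_vert_rot[OF g]) auto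
    note mg = torus_lip_measurable[OF g] and mg' = torus_lip_measurable[OF g']
    have int: "integrable \<mu> (\<lambda>z. u ((skew_map d \<alpha> f ^^ n) z))" if u: "torus_lip d L u" for u n
    proof -
      obtain C where C: "\<And>x. x \<in> torus d \<Longrightarrow> \<bar>u x\<bar> \<le> C" using torus_lip_bounded[OF u] by blast
      show ?thesis
        using C measurable_space[OF mT] measurable_compose[OF mT torus_lip_measurable[OF u]]
        by (intro \<mu>.integrable_const_bound[where B=C]) (auto intro!: AE_I2)
    qed
    have eq: "integral\<^sup>L (distr \<mu> (torus_space d) (skew_map d \<alpha> f ^^ n)) g'
        - integral\<^sup>L (distr \<mu> (torus_space d) (skew_map d \<alpha> f ^^ n)) g
        = (\<integral>z. g (vert_rot d t ((skew_map d \<alpha> f ^^ n) z)) - g ((skew_map d \<alpha> f ^^ n) z) \<partial>\<mu>)" for n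
      using int[OF g] int[OF g'] by (simp add: integral_distr[OF mT mg] integral_distr[OF mT mg'] g'_def)
    \<comment> \<open>The limit along r is tested on both g and its rotation g', which is again
      Lipschitz. The same differences tend to 0 along the full sequence, so \<nu> gives g and g'
      equal integrals.\<close>
    have "(\<lambda>j. integral\<^sup>L (distr \<mu> (torus_space d) (skew_map d \<alpha> f ^^ r j)) g'
        - integral\<^sup>L (distr \<mu> (torus_space d) (skew_map d \<alpha> f ^^ r j)) g) \<longlonglongrightarrow> integral\<^sup>L \<nu> g' - integral\<^sup>L \<nu> g"
      by (intro tendsto_diff lim torus_lip_continuous[OF g] torus_lip_continuous[OF g'])
    note lim1 = this[unfolded eq]
    have "(\<lambda>n. \<integral>z. g (vert_rot (Suc k) t ((skew_map (Suc k) \<alpha> f ^^ n) z)) - g ((skew_map (Suc k) \<alpha> f ^^ n) z) \<partial>\<mu>) \<longlonglongrightarrow> 0"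
    proof (rule vertical_difference_tendsto[OF k(1,2)])
      show "vert_ergodic k" using k by (intro erg) auto
      show "circle_degree (\<lambda>t. f k (x(k - 1 := t))) \<noteq> 0" if "x \<in> torus_pts (k - 1)" for x
        by (rule deg[OF k(1,2) that])
      show "torus_lip (Suc k) L g" using g k(3) by simp
      show "finite_measure \<mu>" by (rule \<mu>.finite_measure_axioms)
      show "sets \<mu> = sets (torus_space (Suc k))" using assms(7) k(3) by simp
      show "absolutely_continuous (haar_torus k) (distr \<mu> (torus_space k) (\<lambda>x. restrict x {..<k}))"
        unfolding k_def by (rule assms(8))
    qed
    from LIMSEQ_subseq_LIMSEQ[OF this[unfolded k(3)] r]
    have "(\<lambda>j. \<integral>z. g (vert_rot d t ((skew_map d \<alpha> f ^^ r j) z)) - g ((skew_map d \<alpha> f ^^ r j) z) \<partial>\<mu>) \<longlonglongrightarrow> 0"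
      unfolding comp_def .
    from LIMSEQ_unique[OF lim1 this] have "integral\<^sup>L \<nu> g' = integral\<^sup>L \<nu> g" by simp
    then show "(\<integral>x. g x \<partial>distr \<nu> (torus_space d) (vert_rot d t)) = (\<integral>x. g x \<partial>\<nu>)"
      unfolding g'_def[abs_def] by (simp add: integral_distr[OF mR mg])
  qed (simp_all add: assms(10))
qed

end
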